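(* Let $n\ge 1$ and let $X(\mathbb{R}^n)$ be a Banach function space satisfying the weak doubling property. If $a\in\mathcal{M}_{X(\mathbb{R}^n)}\subset S'(\mathbb{R}^n)$, then $a\in L^\infty(\mathbb{R}^n)$ and \[ \|a\|_{L^\infty(\mathbb{R}^n)}\le\|a\|_{\mathcal{M}_{X(\mathbb{R}^n)}}. \] The constant $1$ on the right-hand side is best possible, i.e. it cannot be replaced by any smaller constant.
   Context: Banach function spaces: let $\mathfrak{M}^+(\mathbb{R}^n)$ be the set of Lebesgue measurable functions on $\mathbb{R}^n$ with values in $[0,\infty]$. A Banach function norm is a map $\rho:\mathfrak{M}^+(\mathbb{R}^n)\to[0,\infty]$ such that for all $f,g,f_j\in\mathfrak{M}^+(\mathbb{R}^n)$, all constants $a\ge0$ and all measurable $E\subset\mathbb{R}^n$: (A1) $\rho(f)=0\iff f=0$ a.e., $\rho(af)=a\rho(f)$, $\rho(f+g)\le\rho(f)+\rho(g)$; (A2) $0\le g\le f$ a.e. implies $\rho(g)\le\rho(f)$; (A3) $0\le f_j\uparrow f$ a.e. implies $\rho(f_j)\uparrow\rho(f)$; (A4) $|E|<\infty$ implies $\rho(\chi_E)<\infty$; (A5) $|E|<\infty$ implies $\int_E f\,dx\le C_E\rho(f)$ with $C_E\in(0,\infty)$ independent of $f$. The Banach function space $X(\mathbb{R}^n)$ is the set of measurable complex-valued $f$ with $\rho(|f|)<\infty$ (a.e.-equal functions identified), normed by $\|f\|_{X(\mathbb{R}^n)}=\rho(|f|)$. $B(y,R)$ is the open ball of radius $R$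 centered at $y$, $\chi_E$ the characteristic function of $E$. Weak doubling property: $X(\mathbb{R}^n)$ has it if there is $\tau>1$ with $\liminf_{R\to\infty}\big(\inf_{y\in\mathbb{R}^n}\|\chi_{B(y,\tau R)}\|_{X(\mathbb{R}^n)}/\|\chi_{B(y,R)}\|_{X(\mathbb{R}^n)}\big)<\infty$. Fourier multipliers: $(Fu)(\xi)=\int_{\mathbb{R}^n}u(x)e^{-ix\xi}dx$ on the Schwartz space $S(\mathbb{R}^n)$, extended to tempered distributions $S'(\mathbb{R}^n)$ as usual. For $a\in S'(\mathbb{R}^n)$ and $u\in S(\mathbb{R}^n)$, $F^{-1}aFu$ is a smooth polynomially bounded function. $\mathcal{M}_{X(\mathbb{R}^n)}$ is the set of $a\in S'(\mathbb{R}^n)$ with $\|a\|_{\mathcal{M}_{X(\mathbb{R}^n)}}:=\sup\{\|F^{-1}aFu\|_{X(\mathbb{R}^n)}/\|u\|_{X(\mathbb{R}^n)}: u\in (S(\mathbb{R}^n)\cap X(\mathbb{R}^n))\setminus\{0\}\}<\infty$. *)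

theory Defs
  imports "HOL-Analysis.Analysis" "HOL-Probability.Essential_Supremum"
begin

text \<open>Euclidean space R^n is modelled as real^'n for a finite index type 'n
  (so n = CARD('n) \<ge> 1). Functions on R^n are complex valued.\<close>

primrec pderivs :: "'n::finite list \<Rightarrow> (real^'n \<Rightarrow> complex) \<Rightarrow> real^'n \<Rightarrow> complex" where
  "pderivs [] f = f"
| "pderivs (i # is) f = (\<lambda>x. frechet_derivative (pderivs is f) (at x) (axis i 1))"

definition smooth_fun :: "(real^'n::finite \<Rightarrow> complex) \<Rightarrow> bool" where
  "smooth_fun f \<longleftrightarrow> (\<forall>is x. pderivs is f differentiable (at x))"

definition schwartz_seminorm :: "nat \<Rightarrow> 'n::finite list \<Rightarrow> (real^'n \<Rightarrow> complex) \<Rightarrow> real" where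
  "schwartz_seminorm m is f = (SUP x. norm x ^ m * norm (pderivs is f x))"

definition schwartz :: "(real^'n::finite \<Rightarrow> complex) set" where
  "schwartz = {f. smooth_fun f \<and>
     (\<forall>m is. bounded (range (\<lambda>x. norm x ^ m * norm (pderivs is f x))))}"

text \<open>A tempered distribution is a linear functional on the Schwartz space which is
  continuous, i.e. bounded by finitely many Schwartz seminorms. Its values outside the
  Schwartz space are irrelevant.\<close>

definition tempered :: "((real^'n::finite \<Rightarrow> complex) \<Rightarrow> complex) \<Rightarrow> bool" where
  "tempered T \<longleftrightarrow>
     (\<forall>f\<in>schwartz. \<forall>g\<in>schwartz. T (\<lambda>x. f x + g x) = T f + T g) \<and>
     (\<forall>f\<in>schwartz. \<forall>c. T (\<lambda>x. c * f x) = c * T f) \<and>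
     (\<exists>C N. \<forall>f\<in>schwartz. norm (T f) \<le>
        C * (\<Sum>m\<le>N. \<Sum>is\<in>{is. length is \<le> N}. schwartz_seminorm m is f))"

definition fourier :: "(real^'n::finite \<Rightarrow> complex) \<Rightarrow> real^'n \<Rightarrow> complex" where
  "fourier u = (\<lambda>\<xi>. integral\<^sup>L lebesgue (\<lambda>x. u x * cis (- (x \<bullet> \<xi>))))"

definition ifourier :: "(real^'n::finite \<Rightarrow> complex) \<Rightarrow> real^'n \<Rightarrow> complex" where
  "ifourier v = (\<lambda>x. complex_of_real (1 / (2 * pi) ^ CARD('n)) *
       integral\<^sup>L lebesgue (\<lambda>\<xi>. v \<xi> * cis (x \<bullet> \<xi>)))"

definition dist_ifourier :: "((real^'n::finite \<Rightarrow> complex) \<Rightarrow> complex) \<Rightarrow> (real^'n \<Rightarrow> complex) \<Rightarrow> complex" where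
  "dist_ifourier T = (\<lambda>\<phi>. T (ifourier \<phi>))"

definition dist_mult :: "((real^'n::finite \<Rightarrow> complex) \<Rightarrow> complex) \<Rightarrow> (real^'n \<Rightarrow> complex) \<Rightarrow> (real^'n \<Rightarrow> complex) \<Rightarrow> complex" where
  "dist_mult T \<psi> = (\<lambda>\<phi>. T (\<lambda>x. \<psi> x * \<phi> x))"

definition represents :: "((real^'n::finite \<Rightarrow> complex) \<Rightarrow> complex) \<Rightarrow> (real^'n \<Rightarrow> complex) \<Rightarrow> bool" where
  "represents T g \<longleftrightarrow> g \<in> borel_measurable lebesgue \<and>
     (\<forall>\<phi>\<in>schwartz. integrable lebesgue (\<lambda>x. g x * \<phi> x) \<and>
                   T \<phi> = integral\<^sup>L lebesgue (\<lambda>x. g x * \<phi> x))"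

text \<open>F^{-1} a F u, as a function (it is a smooth polynomially bounded function).\<close>

definition multiplier_op :: "((real^'n::finite \<Rightarrow> complex) \<Rightarrow> complex) \<Rightarrow> (real^'n \<Rightarrow> complex) \<Rightarrow> real^'n \<Rightarrow> complex" where
  "multiplier_op a u = (SOME g. represents (dist_ifourier (dist_mult a (fourier u))) g)"

definition in_Linf :: "((real^'n::finite \<Rightarrow> complex) \<Rightarrow> complex) \<Rightarrow> bool" where
  "in_Linf T \<longleftrightarrow> (\<exists>f. represents T f \<and> esssup lebesgue (\<lambda>x. ereal (norm (f x))) < \<infinity>)"

definition Linf_norm :: "((real^'n::finite \<Rightarrow> complex) \<Rightarrow> complex) \<Rightarrow> ereal" where
  "Linf_norm T = (INF f\<in>{f. represents T f}. esssup lebesgue (\<lambda>x. ereal (norm (f x))))"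

definition banach_function_norm :: "((real^'n::finite \<Rightarrow> ennreal) \<Rightarrow> ennreal) \<Rightarrow> bool" where
  "banach_function_norm \<rho> \<longleftrightarrow>
    \<comment> \<open>(A1)\<close>
    (\<forall>f\<in>borel_measurable lebesgue. \<rho> f = 0 \<longleftrightarrow> (AE x in lebesgue. f x = 0)) \<and>
    (\<forall>f\<in>borel_measurable lebesgue. \<forall>a::real. a \<ge> 0 \<longrightarrow>
        \<rho> (\<lambda>x. ennreal a * f x) = ennreal a * \<rho> f) \<and>
    (\<forall>f\<in>borel_measurable lebesgue. \<forall>g\<in>borel_measurable lebesgue.
        \<rho> (\<lambda>x. f x + g x) \<le> \<rho> f + \<rho> g) \<and>
    \<comment> \<open>(A2)\<close>
    (\<forall>f\<in>borel_measurable lebesgue. \<forall>g\<in>borel_measurable lebesgue.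
        (AE x in lebesgue. g x \<le> f x) \<longrightarrow> \<rho> g \<le> \<rho> f) \<and>
    \<comment> \<open>(A3)\<close>
    (\<forall>F f. (\<forall>j. F j \<in> borel_measurable lebesgue) \<longrightarrow> f \<in> borel_measurable lebesgue \<longrightarrow>
        (AE x in lebesgue. incseq (\<lambda>j. F j x) \<and> (\<lambda>j. F j x) \<longlonglongrightarrow> f x) \<longrightarrow>
        incseq (\<lambda>j. \<rho> (F j)) \<and> (\<lambda>j. \<rho> (F j)) \<longlonglongrightarrow> \<rho> f) \<and>
    \<comment> \<open>(A4)\<close>
    (\<forall>E\<in>sets lebesgue. emeasure lebesgue E < \<infinity> \<longrightarrow> \<rho> (indicator E) < \<infinity>) \<and>
    \<comment> \<open>(A5)\<close>
    (\<forall>E\<in>sets lebesgue. emeasure lebesgue E < \<infinity> \<longrightarrow>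
        (\<exists>C::real. C > 0 \<and> (\<forall>f\<in>borel_measurable lebesgue.
            (\<integral>\<^sup>+ x\<in>E. f x \<partial>lebesgue) \<le> ennreal C * \<rho> f)))"

definition Xnorm :: "((real^'n::finite \<Rightarrow> ennreal) \<Rightarrow> ennreal) \<Rightarrow> (real^'n \<Rightarrow> complex) \<Rightarrow> ennreal" where
  "Xnorm \<rho> f = \<rho> (\<lambda>x. ennreal (norm (f x)))"

definition in_X :: "((real^'n::finite \<Rightarrow> ennreal) \<Rightarrow> ennreal) \<Rightarrow> (real^'n \<Rightarrow> complex) \<Rightarrow> bool" where
  "in_X \<rho> f \<longleftrightarrow> f \<in> borel_measurable lebesgue \<and> Xnorm \<rho> f < \<infinity>"

definition weak_doubling :: "((real^'n::finite \<Rightarrow> ennreal) \<Rightarrow> ennreal) \<Rightarrow> bool" where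
  "weak_doubling \<rho> \<longleftrightarrow> (\<exists>\<tau>::real. \<tau> > 1 \<and>
     Liminf at_top (\<lambda>R::real. INF y. Xnorm \<rho> (indicator (ball y (\<tau> * R)))
                                      / Xnorm \<rho> (indicator (ball y R))) < \<infinity>)"

definition mult_norm :: "((real^'n::finite \<Rightarrow> ennreal) \<Rightarrow> ennreal) \<Rightarrow> ((real^'n \<Rightarrow> complex) \<Rightarrow> complex) \<Rightarrow> ennreal" where
  "mult_norm \<rho> a = (SUP u\<in>{u. u \<in> schwartz \<and> in_X \<rho> u \<and> u \<noteq> (\<lambda>x. 0)}.
                       Xnorm \<rho> (multiplier_op a u) / Xnorm \<rho> u)"

definition is_multiplier :: "((real^'n::finite \<Rightarrow> ennreal) \<Rightarrow> ennreal) \<Rightarrow> ((real^'n \<Rightarrow> complex) \<Rightarrow> complex) \<Rightarrow> bool" where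
  "is_multiplier \<rho> a \<longleftrightarrow> tempered a \<and> mult_norm \<rho> a < \<infinity>"

end

theory Submission
  imports Defs "HOL-Probability.Probability" "HOL-Computational_Algebra.Polynomial"
begin

text \<open>
  Let \<open>M\<close> be the multiplier norm of \<open>a\<close>. The core of the argument is the bound
  \<open>norm (a \<psi>) \<le> M * \<integral> norm \<psi>\<close> for Schwartz functions \<open>\<psi>\<close>; the duality between \<open>L\<^sup>1\<close> and
  \<open>L\<^sup>\<infinity>\<close> then turns \<open>a\<close> into a function bounded by \<open>M\<close>.

  Weak doubling and a pigeonhole argument give, for every \<open>\<epsilon> > 0\<close>, numbers \<open>s < t\<close> such that for
  arbitrarily large \<open>R\<close> the characteristic functions of some concentric balls of radii \<open>s * R\<close> and
  \<open>t * R\<close> have norms differing at most by the factor \<open>1 + \<epsilon>\<close>. Let \<open>\<eta>\<close> be a smooth plateau between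
  these two balls. Applying the multiplier to all modulations of \<open>\<eta>\<close> and superposing the results
  with weight \<open>\<psi>\<close> yields, by Minkowski's inequality, a function of norm at most
  \<open>M * \<integral> norm \<psi>\<close> times the norm of \<open>\<eta>\<close>. On the smaller ball this function equals \<open>a \<psi>\<close> up
  to an error \<open>O (1 / R)\<close>, because there the translates of \<open>\<eta>\<close> are \<open>1\<close> near the origin. The constant
  is optimal since \<open>a = 1\<close> is the identity multiplier.
\<close>

section \<open>Iterated partial derivatives and Schwartz seminorms\<close>

text \<open>The norm of X sees only absolute values. It need not be translation invariant, and
  Schwartz functions need neither lie in X nor be dense in it. What survives is that modulation
  leaves \<open>Xnorm\<close> unchanged and that compactly supported plateaus lie in X by (A2) and
  (A4). Applied to \<eta> modulated by the frequency -h, the multiplier gives at x, up to a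
  unimodular factor, (2 pi)^-n times \<open>a\<close> of the transform of \<eta>(x - z) times the
  exponential of frequency h. Integration against \<phi>(h) replaces that exponential by
  \<open>cft \<phi>\<close>, and where the plateau is 1, inversion returns (2 pi)^n times
  \<open>a\<close> of the reflected \<phi>. So \<phi> is taken to be the reflection of \<psi>, the
  powers of 2 pi cancel, and exactly M remains. As \<open>a\<close> is only a distribution,
  integrals pass through it as limits of finite sums, with convergence measured by Schwartz bounds.
  The plateau is fixed before R and then only dilated, so its derivatives shrink as R grows.
  \<open>multiplier_op\<close> is a choice among representing functions, whence the need for their
  uniqueness almost everywhere.\<close>

lemma frechet_derivative_eqI:
  "(f has_derivative f') (at x) \<Longrightarrow> frechet_derivative f (at x) = f'"
  by (rule frechet_derivative_at [symmetric])

lemma pderivs_append: "pderivs (is @ js) f = pderivs is (pderivs js f)"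
  by (induction "is") auto

lemma smooth_fun_pderivs: "smooth_fun f \<Longrightarrow> smooth_fun (pderivs is f)"
  unfolding smooth_fun_def pderivs_append [symmetric] by blast

lemma smooth_fun_differentiable: "smooth_fun f \<Longrightarrow> pderivs is f differentiable (at x)"
  by (simp add: smooth_fun_def)

lemma smooth_fun_has_derivative:
  "smooth_fun f \<Longrightarrow> (pderivs is f has_derivative frechet_derivative (pderivs is f) (at x)) (at x)"
  using frechet_derivative_works smooth_fun_differentiable by blast

lemma smooth_fun_continuous: "smooth_fun f \<Longrightarrow> continuous_on S (pderivs is f)"
  by (meson continuous_at_imp_continuous_on differentiable_imp_continuous_within
      smooth_fun_differentiable)

text \<open>Closure under partial derivatives puts every iterated derivative into \<open>S\<close>,
  where it is differentiable. Smoothness of plateaus and of transforms can so be shown without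
  formulas for their higher derivatives.\<close>

lemma smooth_fun_coinduct:
  assumes "f \<in> S"
    and "\<And>f x. f \<in> S \<Longrightarrow> f differentiable (at x)"
    and "\<And>f i. f \<in> S \<Longrightarrow> (\<lambda>x. frechet_derivative f (at x) (axis i 1)) \<in> S"
  shows "smooth_fun f"
proof -
  have "pderivs is f \<in> S" for "is"
    by (induction "is") (use assms in auto)
  then show ?thesis
    using assms(2) by (auto simp: smooth_fun_def)
qed

lemma pderivs_add:
  assumes "smooth_fun f" "smooth_fun g"
  shows "pderivs is (\<lambda>x. f x + g x) = (\<lambda>x. pderivs is f x + pderivs is g x)"
proof (induction "is")
  case (Cons i "is")
  have "frechet_derivative (\<lambda>x. pderivs is f x + pderivs is g x) (at x) =
     (\<lambda>h. frechet_derivative (pderivs is f) (at x) h + frechet_derivative (pderivs is g) (at x) h)" for x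
    by (intro frechet_derivative_eqI has_derivative_add smooth_fun_has_derivative assms)
  then show ?case
    by (simp add: Cons)
qed simp

lemma smooth_fun_add:
  assumes "smooth_fun f" "smooth_fun g"
  shows "smooth_fun (\<lambda>x. f x + g x)"
  using assms by (simp add: smooth_fun_def pderivs_add)

lemma pderivs_cmult:
  assumes "smooth_fun f"
  shows "pderivs is (\<lambda>x. c * f x) = (\<lambda>x. c * pderivs is f x)"
proof (induction "is")
  case (Cons i "is")
  have "frechet_derivative (\<lambda>x. c * pderivs is f x) (at x) =
     (\<lambda>h. c * frechet_derivative (pderivs is f) (at x) h)" for x
    by (intro frechet_derivative_eqI has_derivative_mult_right smooth_fun_has_derivative assms)
  then show ?case
    by (simp add: Cons)
qed simp

lemma smooth_fun_cmult:
  assumes "smooth_fun f"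
  shows "smooth_fun (\<lambda>x. c * f x)"
  using assms by (simp add: smooth_fun_def pderivs_cmult)

lemma pderivs_diff:
  assumes "smooth_fun f" "smooth_fun g"
  shows "pderivs is (\<lambda>x. f x - g x) = (\<lambda>x. pderivs is f x - pderivs is g x)"
  using pderivs_add [OF assms(1) smooth_fun_cmult [OF assms(2), of "-1"], of "is"]
  by (simp add: pderivs_cmult [OF assms(2), of _ "-1", simplified])

lemma pderivs_const: "pderivs is (\<lambda>x. c) = (\<lambda>x. if is = [] then c else 0)"
proof (induction "is")
  case (Cons i "is")
  have "frechet_derivative (\<lambda>x. if is = [] then c else 0) (at x) = (\<lambda>h. 0)" for x :: "real^'n"
    by (intro frechet_derivative_eqI) auto
  then show ?case
    by (simp add: Cons)
qed simp

lemma smooth_fun_const: "smooth_fun (\<lambda>x. c)"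
  by (auto simp: smooth_fun_def pderivs_const)

text \<open>Both claims share one induction: adding a summand to the derivative formula requires
  smoothness of the partial sum.\<close>

lemma pderivs_sum:
  assumes "finite A" "\<And>a. a \<in> A \<Longrightarrow> smooth_fun (f a)"
  shows "smooth_fun (\<lambda>x. \<Sum>a\<in>A. f a x) \<and>
         pderivs is (\<lambda>x. \<Sum>a\<in>A. f a x) = (\<lambda>x. \<Sum>a\<in>A. pderivs is (f a) x)"
  using assms
  by (induction A rule: finite_induct)
     (simp_all add: smooth_fun_const pderivs_const smooth_fun_add pderivs_add)

text \<open>All ways to distribute the derivatives in \<open>is\<close> over two factors with their
  order kept, repetitions included. This keeps binomial coefficients out of the product rule; only
  the number of terms, a power of 2, enters the estimates.\<close>

fun leibniz_splits :: "'n list \<Rightarrow> ('n list \<times> 'n list) list" where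
  "leibniz_splits [] = [([], [])]"
| "leibniz_splits (i # is) = map (\<lambda>(b, c). (i # b, c)) (leibniz_splits is)
                           @ map (\<lambda>(b, c). (b, i # c)) (leibniz_splits is)"

lemma length_leibniz_splits: "length (leibniz_splits is) = 2 ^ length is"
  by (induction "is") auto

lemma leibniz_splits_length_le:
  "(b, c) \<in> set (leibniz_splits is) \<Longrightarrow> length b \<le> length is \<and> length c \<le> length is"
  by (induction "is" arbitrary: b c) fastforce+

lemma has_derivative_sum_list:
  assumes "\<And>p. p \<in> set ps \<Longrightarrow> (f p has_derivative f' p) (at x)"
  shows "((\<lambda>x. \<Sum>p\<leftarrow>ps. f p x) has_derivative (\<lambda>h. \<Sum>p\<leftarrow>ps. f' p h)) (at x)"
  using assms by (induction ps) (auto intro: has_derivative_add)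

lemma pderivs_mult:
  assumes "smooth_fun f" "smooth_fun g"
  shows "pderivs is (\<lambda>x. f x * g x) =
     (\<lambda>x. \<Sum>p\<leftarrow>leibniz_splits is. pderivs (fst p) f x * pderivs (snd p) g x)"
proof (induction "is")
  case (Cons i "is")
  have "frechet_derivative (\<lambda>x. \<Sum>p\<leftarrow>leibniz_splits is. pderivs (fst p) f x * pderivs (snd p) g x) (at x) =
     (\<lambda>h. \<Sum>p\<leftarrow>leibniz_splits is. pderivs (fst p) f x * frechet_derivative (pderivs (snd p) g) (at x) h
          + frechet_derivative (pderivs (fst p) f) (at x) h * pderivs (snd p) g x)" for x
    by (intro frechet_derivative_eqI has_derivative_sum_list has_derivative_mult
        smooth_fun_has_derivative assms)
  then have "pderivs (i # is) (\<lambda>x. f x * g x) = (\<lambda>x. \<Sum>p\<leftarrow>leibniz_splits is.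
      pderivs (fst p) f x * pderivs (i # snd p) g x + pderivs (i # fst p) f x * pderivs (snd p) g x)"
    by (simp add: Cons)
  also have "\<dots> = (\<lambda>x. \<Sum>p\<leftarrow>leibniz_splits (i # is). pderivs (fst p) f x * pderivs (snd p) g x)"
    by (simp add: sum_list_addf case_prod_beta o_def add.commute)
  finally show ?case .
qed simp

lemma smooth_fun_mult:
  assumes "smooth_fun f" "smooth_fun g"
  shows "smooth_fun (\<lambda>x. f x * g x)"
  unfolding smooth_fun_def
proof (intro allI)
  fix "is" x
  have "((\<lambda>x. \<Sum>p\<leftarrow>leibniz_splits is. pderivs (fst p) f x * pderivs (snd p) g x) has_derivative
     (\<lambda>h. \<Sum>p\<leftarrow>leibniz_splits is. pderivs (fst p) f x * frechet_derivative (pderivs (snd p) g) (at x) h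
          + frechet_derivative (pderivs (fst p) f) (at x) h * pderivs (snd p) g x)) (at x)"
    by (intro has_derivative_sum_list has_derivative_mult smooth_fun_has_derivative assms)
  then show "pderivs is (\<lambda>x. f x * g x) differentiable (at x)"
    unfolding pderivs_mult [OF assms] by (rule differentiableI)
qed

lemma has_derivative_affine_compose:
  fixes f :: "real^'n::finite \<Rightarrow> complex"
  assumes "(f has_derivative f') (at (c *\<^sub>R x + a))"
  shows "((\<lambda>x. f (c *\<^sub>R x + a)) has_derivative (\<lambda>h. f' (c *\<^sub>R h))) (at x)"
  by (rule has_derivative_compose [where f = "\<lambda>x. c *\<^sub>R x + a" and g = f and f' = "\<lambda>h. c *\<^sub>R h" and g' = f'])
     (auto intro!: derivative_eq_intros assms)

lemma pderivs_affine:
  assumes "smooth_fun f"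
  shows "pderivs is (\<lambda>x. f (c *\<^sub>R x + a)) = (\<lambda>x. complex_of_real c ^ length is * pderivs is f (c *\<^sub>R x + a))"
proof (induction "is")
  case (Cons i "is")
  let ?D = "\<lambda>x. frechet_derivative (pderivs is f) (at x)"
  have "frechet_derivative (\<lambda>x. complex_of_real c ^ length is * pderivs is f (c *\<^sub>R x + a)) (at x) =
     (\<lambda>h. complex_of_real c ^ length is * ?D (c *\<^sub>R x + a) (c *\<^sub>R h))" for x
    by (intro frechet_derivative_eqI has_derivative_mult_right has_derivative_affine_compose
        smooth_fun_has_derivative assms)
  moreover have "?D x (c *\<^sub>R h) = complex_of_real c * ?D x h" for x h
    using linear_scale [OF has_derivative_linear [OF smooth_fun_has_derivative [OF assms]]]
    by (simp add: scaleR_conv_of_real)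
  ultimately show ?case
    by (simp add: Cons mult_ac)
qed simp

lemma smooth_fun_affine:
  assumes "smooth_fun f"
  shows "smooth_fun (\<lambda>x. f (c *\<^sub>R x + a))"
  unfolding smooth_fun_def pderivs_affine [OF assms]
  by (intro allI, rule differentiableI, rule has_derivative_mult_right,
      rule has_derivative_affine_compose, rule smooth_fun_has_derivative [OF assms])

section \<open>Derivatives of coordinate functions and exponentials\<close>

lemma has_derivative_coord:
  "((\<lambda>x::real^'n::finite. complex_of_real (x $ i)) has_derivative (\<lambda>h. complex_of_real (h $ i))) (at x)"
  by (rule bounded_linear_imp_has_derivative)
     (rule bounded_linear_compose [OF bounded_linear_of_real bounded_linear_vec_nth])

text \<open>The last entry of a list is the derivative taken first. It turns the coordinate into the
  constant 0 or 1, and any further derivative gives 0.\<close>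

lemma pderivs_coord_Cons:
  "\<exists>c\<in>{0,1}. pderivs (js @ [j]) (\<lambda>x::real^'n::finite. complex_of_real (x $ i)) = (\<lambda>x. c)"
proof -
  have "pderivs [j] (\<lambda>x::real^'n. complex_of_real (x $ i)) = (\<lambda>x. complex_of_real (axis j 1 $ i))"
    by (simp add: frechet_derivative_eqI [OF has_derivative_coord])
  then show ?thesis
    by (simp add: pderivs_append pderivs_const axis_def del: pderivs.simps)
qed

lemma smooth_fun_coord: "smooth_fun (\<lambda>x::real^'n::finite. complex_of_real (x $ i))"
  unfolding smooth_fun_def
proof (intro allI)
  fix "is" :: "'n list" and x :: "real^'n"
  show "pderivs is (\<lambda>x::real^'n. complex_of_real (x $ i)) differentiable (at x)"
  proof (cases "is" rule: rev_cases)
    case Nil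
    then show ?thesis
      using has_derivative_coord by (auto intro: differentiableI)
  next
    case (snoc js j)
    then show ?thesis
      using pderivs_coord_Cons [of js j i] by auto
  qed
qed

lemma has_derivative_cis_inner:
  fixes x :: "real^'n::finite"
  shows "((\<lambda>\<xi>. cis (x \<bullet> \<xi>)) has_derivative (\<lambda>h. \<i> * of_real (x \<bullet> h) * cis (x \<bullet> \<xi>))) (at \<xi>)"
proof -
  have "((\<lambda>\<xi>. x \<bullet> \<xi>) has_derivative (\<lambda>h. x \<bullet> h)) (at \<xi>)"
    by (auto intro!: derivative_eq_intros)
  moreover have "(cis has_derivative (\<lambda>t. t *\<^sub>R (\<i> * cis (x \<bullet> \<xi>)))) (at (x \<bullet> \<xi>))"
    by (rule has_derivative_cis) (rule has_derivative_ident)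
  ultimately have "((\<lambda>\<xi>. cis (x \<bullet> \<xi>)) has_derivative (\<lambda>h. (x \<bullet> h) *\<^sub>R (\<i> * cis (x \<bullet> \<xi>)))) (at \<xi>)"
    by (rule has_derivative_compose)
  then show ?thesis
    by (simp add: scaleR_conv_of_real mult_ac)
qed

lemma pderivs_cis:
  fixes x :: "real^'n::finite"
  shows "pderivs is (\<lambda>\<xi>. cis (x \<bullet> \<xi>)) = (\<lambda>\<xi>. (\<Prod>i\<leftarrow>is. \<i> * of_real (x $ i)) * cis (x \<bullet> \<xi>))"
proof (induction "is")
  case (Cons i "is")
  have "frechet_derivative (\<lambda>\<xi>. (\<Prod>i\<leftarrow>is. \<i> * of_real (x $ i)) * cis (x \<bullet> \<xi>)) (at \<xi>) =
    (\<lambda>h. (\<Prod>i\<leftarrow>is. \<i> * of_real (x $ i)) * (\<i> * of_real (x \<bullet> h) * cis (x \<bullet> \<xi>)))" for \<xi>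
    by (intro frechet_derivative_eqI has_derivative_mult_right has_derivative_cis_inner)
  then show ?case
    by (simp add: Cons inner_axis mult_ac)
qed simp

lemma smooth_fun_cis:
  fixes x :: "real^'n::finite"
  shows "smooth_fun (\<lambda>\<xi>. cis (x \<bullet> \<xi>))"
  unfolding smooth_fun_def pderivs_cis
  by (intro allI, rule differentiableI, rule has_derivative_mult_right, rule has_derivative_cis_inner)

lemma norm_prod_list_coord_le:
  fixes x :: "real^'n::finite"
  shows "norm (\<Prod>i\<leftarrow>is. \<i> * complex_of_real (x $ i)) \<le> (1 + norm x) ^ length is"
proof (induction "is")
  case (Cons i "is")
  have "\<bar>x $ i\<bar> \<le> 1 + norm x"
    using component_le_norm_cart [of x i] by linarith
  with Cons show ?case
    by (simp add: norm_mult mult_mono)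
qed simp

text \<open>One index serves as polynomial weight and as order of differentiation. Taken over all
  \<open>N\<close>, these bounds describe the same topology as the seminorms, but they avoid suprema
  and pass directly to sums, products and transforms.\<close>

definition schwartz_le :: "nat \<Rightarrow> (real^'n::finite \<Rightarrow> complex) \<Rightarrow> real \<Rightarrow> bool" where
  "schwartz_le N f B \<longleftrightarrow> (\<forall>is x. length is \<le> N \<longrightarrow> (1 + norm x) ^ N * norm (pderivs is f x) \<le> B)"

text \<open>The constant \<open>e\<close> is kept explicit because convergence of multipliers to 0
  is later expressed by letting it tend to 0 with \<open>N\<close> and \<open>K\<close>
  fixed.\<close>

definition growth_le :: "nat \<Rightarrow> nat \<Rightarrow> (real^'n::finite \<Rightarrow> complex) \<Rightarrow> real \<Rightarrow> bool" where
  "growth_le N K G e \<longleftrightarrow> (\<forall>is x. length is \<le> N \<longrightarrow> norm (pderivs is G x) \<le> e * (1 + norm x) ^ K)"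

lemma schwartz_leD: "schwartz_le N f B \<Longrightarrow> length is \<le> N \<Longrightarrow> (1 + norm x) ^ N * norm (pderivs is f x) \<le> B"
  by (simp add: schwartz_le_def)

lemma schwartz_le_nonneg: "schwartz_le N f B \<Longrightarrow> 0 \<le> B"
  using schwartz_leD [of N f B "[]" 0] order_trans [OF norm_ge_zero [of "f 0"], of B] by simp

lemma schwartz_le_mono:
  assumes "schwartz_le N f B" "M \<le> N" "B \<le> B'"
  shows "schwartz_le M f B'"
  unfolding schwartz_le_def
proof (intro allI impI)
  fix "is" :: "'a list" and x :: "real^'a"
  assume "length is \<le> M"
  have "(1 + norm x) ^ M \<le> (1 + norm x) ^ N"
    using assms by (intro power_increasing) auto
  then have "(1 + norm x) ^ M * norm (pderivs is f x) \<le> (1 + norm x) ^ N * norm (pderivs is f x)"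
    by (intro mult_right_mono) auto
  also have "\<dots> \<le> B"
    using assms \<open>length is \<le> M\<close> by (intro schwartz_leD) auto
  finally show "(1 + norm x) ^ M * norm (pderivs is f x) \<le> B'"
    using assms by simp
qed

lemma schwartz_le_decay: "schwartz_le N f B \<Longrightarrow> length is \<le> N \<Longrightarrow> norm (pderivs is f x) \<le> B / (1 + norm x) ^ N"
  using schwartz_leD [of N f B "is" x] by (simp add: field_simps add_pos_nonneg)

lemma norm_sum_list_le: "norm (\<Sum>p\<leftarrow>ps. f p) \<le> (\<Sum>p\<leftarrow>ps. norm (f p))"
  by (induction ps) (auto intro: norm_triangle_le)

text \<open>Each of the at most 2^N Leibniz terms spends \<open>K\<close> of the
  \<open>N + K\<close> weights of \<open>f\<close> on the growth of \<open>G\<close>. The bound is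
  linear in \<open>e\<close>, so a small multiplier yields a small Schwartz function.\<close>

lemma schwartz_le_mult:
  assumes "smooth_fun f" "smooth_fun G" "schwartz_le (N + K) f B" "growth_le N K G e" "0 \<le> e"
  shows "schwartz_le N (\<lambda>x. f x * G x) (2 ^ N * B * e)"
  unfolding schwartz_le_def
proof (intro allI impI)
  fix "is" :: "'a list" and x :: "real^'a"
  assume len: "length is \<le> N"
  note B = schwartz_le_nonneg [OF assms(3)]
  have *: "(1 + norm x) ^ N * norm (pderivs (fst p) f x * pderivs (snd p) G x) \<le> B * e"
    if "p \<in> set (leibniz_splits is)" for p
  proof -
    have l: "length (fst p) \<le> N" "length (snd p) \<le> N"
      using leibniz_splits_length_le [of "fst p" "snd p" "is"] that len by auto
    have "(1 + norm x) ^ N * norm (pderivs (fst p) f x * pderivs (snd p) G x)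
        \<le> (1 + norm x) ^ N * (norm (pderivs (fst p) f x) * (e * (1 + norm x) ^ K))"
      using assms(4) l unfolding norm_mult growth_le_def by (intro mult_left_mono) auto
    also have "\<dots> = ((1 + norm x) ^ (N + K) * norm (pderivs (fst p) f x)) * e"
      by (simp add: power_add mult_ac)
    also have "\<dots> \<le> B * e"
      using assms l by (intro mult_right_mono schwartz_leD) auto
    finally show ?thesis .
  qed
  have "(1 + norm x) ^ N * norm (pderivs is (\<lambda>x. f x * G x) x)
      \<le> (1 + norm x) ^ N * (\<Sum>p\<leftarrow>leibniz_splits is. norm (pderivs (fst p) f x * pderivs (snd p) G x))"
    unfolding pderivs_mult [OF assms(1,2)]
    by (intro mult_left_mono norm_sum_list_le) auto
  also have "\<dots> = (\<Sum>p\<leftarrow>leibniz_splits is. (1 + norm x) ^ N * norm (pderivs (fst p) f x * pderivs (snd p) G x))"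
    by (simp add: sum_list_const_mult)
  also have "\<dots> \<le> (\<Sum>p\<leftarrow>leibniz_splits is. B * e)"
    by (intro sum_list_mono *)
  also have "\<dots> = 2 ^ length is * (B * e)"
    by (simp add: sum_list_triv length_leibniz_splits)
  also have "\<dots> \<le> 2 ^ N * (B * e)"
    using len B assms(5) by (intro mult_right_mono power_increasing) auto
  finally show "(1 + norm x) ^ N * norm (pderivs is (\<lambda>x. f x * G x) x) \<le> 2 ^ N * B * e"
    by (simp add: mult_ac)
qed

section \<open>Weighted bounds compared with the defining seminorms\<close>

lemma finite_lists_le: "finite {is::'n::finite list. length is \<le> N}"
  using finite_lists_length_le [of "UNIV::'n set" N] by simp

lemma one_plus_power_le:
  assumes "0 \<le> (t::real)"
  shows "(1 + t) ^ N \<le> 2 ^ N * (1 + t ^ N)"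
proof -
  have "(1 + t) ^ N \<le> (2 * max 1 t) ^ N"
    using assms by (intro power_mono) auto
  also have "\<dots> = 2 ^ N * max 1 t ^ N"
    by (simp add: power_mult_distrib)
  also have "max 1 t ^ N \<le> 1 + t ^ N"
    using assms by (auto simp: max_def)
  finally show ?thesis
    by simp
qed

lemma schwartz_seminorm_upper:
  assumes "f \<in> schwartz"
  shows "norm x ^ m * norm (pderivs is f x) \<le> schwartz_seminorm m is f"
  unfolding schwartz_seminorm_def
  using assms by (intro cSUP_upper bounded_imp_bdd_above) (auto simp: schwartz_def)

lemma schwartz_seminorm_nonneg: "f \<in> schwartz \<Longrightarrow> 0 \<le> schwartz_seminorm m is f"
  by (rule order_trans [OF _ schwartz_seminorm_upper [where x = 0]]) auto

definition schwartz_total :: "nat \<Rightarrow> (real^'n::finite \<Rightarrow> complex) \<Rightarrow> real" where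
  "schwartz_total N f = (\<Sum>m\<le>N. \<Sum>is\<in>{is. length is \<le> N}. schwartz_seminorm m is f)"

lemma schwartz_seminorm_le_total:
  assumes "f \<in> schwartz" "m \<le> N" "length is \<le> N"
  shows "schwartz_seminorm m is f \<le> schwartz_total N f"
proof -
  have "schwartz_seminorm m is f \<le> (\<Sum>is\<in>{is. length is \<le> N}. schwartz_seminorm m is f)"
    using assms by (intro member_le_sum finite_lists_le) (auto simp: schwartz_seminorm_nonneg)
  also have "\<dots> \<le> schwartz_total N f"
    unfolding schwartz_total_def
    using assms by (intro member_le_sum) (auto simp: schwartz_seminorm_nonneg intro: sum_nonneg)
  finally show ?thesis .
qed

lemma schwartz_smooth: "f \<in> schwartz \<Longrightarrow> smooth_fun f"
  by (simp add: schwartz_def)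

text \<open>Since \<open>(1 + t) ^ N \<le> 2 ^ N * (1 + t ^ N)\<close>, the seminorms with exponents
  0 and \<open>N\<close> control the weight; being two, they account for the factor 2.\<close>

lemma schwartz_le_total:
  assumes "f \<in> schwartz"
  shows "schwartz_le N f (2 ^ N * (2 * schwartz_total N f))"
  unfolding schwartz_le_def
proof (intro allI impI)
  fix "is" :: "'a list" and x :: "real^'a"
  assume "length is \<le> N"
  have "(1 + norm x) ^ N * norm (pderivs is f x) \<le> (2 ^ N * (1 + norm x ^ N)) * norm (pderivs is f x)"
    by (intro mult_right_mono one_plus_power_le) auto
  also have "\<dots> = 2 ^ N * (norm x ^ 0 * norm (pderivs is f x) + norm x ^ N * norm (pderivs is f x))"
    by (simp add: algebra_simps)
  also have "\<dots> \<le> 2 ^ N * (schwartz_total N f + schwartz_total N f)"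
    using assms \<open>length is \<le> N\<close>
    by (intro mult_left_mono add_mono order_trans [OF schwartz_seminorm_upper schwartz_seminorm_le_total])
       auto
  finally show "(1 + norm x) ^ N * norm (pderivs is f x) \<le> 2 ^ N * (2 * schwartz_total N f)"
    by simp
qed

text \<open>From right to left, the index \<open>m + length is\<close> dominates the exponent
  \<open>m\<close> and the order of the derivative at once.\<close>

lemma schwartz_iff: "f \<in> schwartz \<longleftrightarrow> smooth_fun f \<and> (\<forall>N. \<exists>B. schwartz_le N f B)"
proof
  assume "f \<in> schwartz"
  then show "smooth_fun f \<and> (\<forall>N. \<exists>B. schwartz_le N f B)"
    using schwartz_le_total schwartz_smooth by blast
next
  assume R: "smooth_fun f \<and> (\<forall>N. \<exists>B. schwartz_le N f B)"
  have "bounded (range (\<lambda>x. norm x ^ m * norm (pderivs is f x)))" for m "is"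
  proof -
    obtain B where B: "schwartz_le (m + length is) f B"
      using R by blast
    have "norm (norm x ^ m * norm (pderivs is f x)) \<le> B" for x
    proof -
      have "norm x ^ m \<le> (1 + norm x) ^ m"
        by (intro power_mono) auto
      also have "\<dots> \<le> (1 + norm x) ^ (m + length is)"
        by (intro power_increasing) auto
      finally have "norm x ^ m * norm (pderivs is f x) \<le> (1 + norm x) ^ (m + length is) * norm (pderivs is f x)"
        by (rule mult_right_mono) auto
      also have "\<dots> \<le> B"
        using B by (rule schwartz_leD) auto
      finally show ?thesis
        by simp
    qed
    then show ?thesis
      unfolding bounded_iff by blast
  qed
  with R show "f \<in> schwartz"
    by (auto simp: schwartz_def)
qed

lemma schwartz_le_exists: "f \<in> schwartz \<Longrightarrow> \<exists>B. schwartz_le N f B"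
  by (simp add: schwartz_iff)

lemma schwartz_mult:
  assumes "f \<in> schwartz" "smooth_fun G" "\<And>N. \<exists>K e. 0 \<le> e \<and> growth_le N K G e"
  shows "(\<lambda>x. f x * G x) \<in> schwartz"
  unfolding schwartz_iff
  using schwartz_le_mult [OF schwartz_smooth [OF assms(1)] assms(2)] assms(3) schwartz_le_exists [OF assms(1)]
    smooth_fun_mult [OF schwartz_smooth [OF assms(1)] assms(2)]
  by meson

lemma schwartz_le_add:
  assumes "smooth_fun f" "smooth_fun g" "schwartz_le N f B" "schwartz_le N g C"
  shows "schwartz_le N (\<lambda>x. f x + g x) (B + C)"
  unfolding schwartz_le_def
proof (intro allI impI)
  fix "is" :: "'a list" and x :: "real^'a"
  assume "length is \<le> N"
  have "(1 + norm x) ^ N * norm (pderivs is f x + pderivs is g x)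
     \<le> (1 + norm x) ^ N * (norm (pderivs is f x) + norm (pderivs is g x))"
    by (intro mult_left_mono norm_triangle_ineq) auto
  then show "(1 + norm x) ^ N * norm (pderivs is (\<lambda>x. f x + g x) x) \<le> B + C"
    using schwartz_leD [OF assms(3) \<open>length is \<le> N\<close>, of x] schwartz_leD [OF assms(4) \<open>length is \<le> N\<close>, of x] assms(1,2)
    by (simp add: pderivs_add algebra_simps)
qed

lemma schwartz_le_cmult:
  assumes "smooth_fun f" "schwartz_le N f B"
  shows "schwartz_le N (\<lambda>x. c * f x) (norm c * B)"
  using assms(2) mult_left_mono [OF _ norm_ge_zero [of c]]
  unfolding schwartz_le_def pderivs_cmult [OF assms(1)] norm_mult by (metis mult.left_commute)

lemma schwartz_add: "f \<in> schwartz \<Longrightarrow> g \<in> schwartz \<Longrightarrow> (\<lambda>x. f x + g x) \<in> schwartz"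
  unfolding schwartz_iff by (blast intro: schwartz_le_add smooth_fun_add)

lemma schwartz_cmult: "f \<in> schwartz \<Longrightarrow> (\<lambda>x. c * f x) \<in> schwartz"
  unfolding schwartz_iff by (blast intro: schwartz_le_cmult smooth_fun_cmult)

lemma schwartz_diff: "f \<in> schwartz \<Longrightarrow> g \<in> schwartz \<Longrightarrow> (\<lambda>x. f x - g x) \<in> schwartz"
  using schwartz_add [OF _ schwartz_cmult [of g "-1"]] by simp

lemma schwartz_zero: "(\<lambda>x. 0) \<in> schwartz"
  unfolding schwartz_iff schwartz_le_def by (auto simp: smooth_fun_const pderivs_const)

lemma schwartz_sum:
  "finite A \<Longrightarrow> (\<And>a. a \<in> A \<Longrightarrow> f a \<in> schwartz) \<Longrightarrow> (\<lambda>x. \<Sum>a\<in>A. f a x) \<in> schwartz"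
  by (induction A rule: finite_induct) (auto simp: schwartz_zero schwartz_add)

lemma schwartz_le_pderivs:
  assumes "schwartz_le (N + length js) f B"
  shows "schwartz_le N (pderivs js f) B"
  unfolding schwartz_le_def
proof (intro allI impI)
  fix "is" :: "'a list" and x :: "real^'a"
  assume "length is \<le> N"
  then have "(1 + norm x) ^ (N + length js) * norm (pderivs (is @ js) f x) \<le> B"
    by (intro schwartz_leD assms) auto
  moreover have "(1 + norm x) ^ N \<le> (1 + norm x) ^ (N + length js)"
    by (intro power_increasing) auto
  then have "(1 + norm x) ^ N * norm (pderivs (is @ js) f x)
    \<le> (1 + norm x) ^ (N + length js) * norm (pderivs (is @ js) f x)"
    by (rule mult_right_mono) auto
  ultimately show "(1 + norm x) ^ N * norm (pderivs is (pderivs js f) x) \<le> B"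
    by (simp add: pderivs_append)
qed

lemma schwartz_pderivs: "f \<in> schwartz \<Longrightarrow> pderivs js f \<in> schwartz"
  unfolding schwartz_iff by (blast intro: schwartz_le_pderivs smooth_fun_pderivs)

lemma growth_le_coord: "growth_le N 1 (\<lambda>x::real^'n::finite. complex_of_real (x $ i)) 1"
  unfolding growth_le_def
proof (intro allI impI)
  fix "is" :: "'n list" and x :: "real^'n"
  show "norm (pderivs is (\<lambda>x::real^'n. complex_of_real (x $ i)) x) \<le> 1 * (1 + norm x) ^ 1"
  proof (cases "is" rule: rev_cases)
    case Nil
    then show ?thesis
      using component_le_norm_cart [of x i] by simp
  next
    case (snoc js j)
    then show ?thesis
      using pderivs_coord_Cons [of js j i] by auto
  qed
qed

lemma growth_le_cis: "growth_le N 0 (\<lambda>\<xi>. cis (x \<bullet> \<xi>)) ((1 + norm (x::real^'n::finite)) ^ N)"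
  unfolding growth_le_def
proof (intro allI impI)
  fix "is" :: "'n list" and \<xi> :: "real^'n"
  assume "length is \<le> N"
  then have "(1 + norm x) ^ length is \<le> (1 + norm x) ^ N"
    by (intro power_increasing) auto
  with norm_prod_list_coord_le [of x "is"]
  show "norm (pderivs is (\<lambda>\<xi>. cis (x \<bullet> \<xi>)) \<xi>) \<le> (1 + norm x) ^ N * (1 + norm \<xi>) ^ 0"
    by (simp add: pderivs_cis norm_mult)
qed

lemma schwartz_mult_coord: "f \<in> schwartz \<Longrightarrow> (\<lambda>x. f x * complex_of_real (x $ i)) \<in> schwartz"
  by (rule schwartz_mult [OF _ smooth_fun_coord]) (use growth_le_coord in \<open>auto intro: zero_le_one\<close>)

lemma schwartz_mult_cis: "f \<in> schwartz \<Longrightarrow> (\<lambda>\<xi>. f \<xi> * cis (x \<bullet> \<xi>)) \<in> schwartz"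
  by (rule schwartz_mult [OF _ smooth_fun_cis], assumption, intro exI conjI, rule_tac [2] growth_le_cis) simp

section \<open>Tempered distributions through weighted bounds\<close>

lemma tempered_add: "tempered T \<Longrightarrow> f \<in> schwartz \<Longrightarrow> g \<in> schwartz \<Longrightarrow> T (\<lambda>x. f x + g x) = T f + T g"
  by (simp add: tempered_def)

lemma tempered_cmult: "tempered T \<Longrightarrow> f \<in> schwartz \<Longrightarrow> T (\<lambda>x. c * f x) = c * T f"
  by (simp add: tempered_def)

lemma tempered_diff: "tempered T \<Longrightarrow> f \<in> schwartz \<Longrightarrow> g \<in> schwartz \<Longrightarrow> T (\<lambda>x. f x - g x) = T f - T g"
  using tempered_add [of T f "\<lambda>x. -1 * g x"] tempered_cmult [of T g "-1"] schwartz_cmult [of g "-1"]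
  by simp

lemma tempered_zero: "tempered T \<Longrightarrow> T (\<lambda>x. 0) = 0"
  using tempered_cmult [OF _ schwartz_zero, of T 0] by simp

lemma tempered_sum:
  assumes "tempered T" "finite A" "\<And>a. a \<in> A \<Longrightarrow> f a \<in> schwartz"
  shows "T (\<lambda>x. \<Sum>a\<in>A. f a x) = (\<Sum>a\<in>A. T (f a))"
  using assms(2,3)
proof (induction A rule: finite_induct)
  case (insert a A)
  then show ?case
    using tempered_add [OF assms(1), of "f a" "\<lambda>x. \<Sum>a\<in>A. f a x"] by (simp add: schwartz_sum)
qed (simp add: tempered_zero [OF assms(1)])

text \<open>A single weighted bound of index \<open>N\<close> dominates every seminorm in the
  defining sum, so only the number of summands enters the constant.\<close>

lemma tempered_boundE:
  assumes "tempered T"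
  obtains C N where "0 \<le> C" "\<And>f B. f \<in> schwartz \<Longrightarrow> schwartz_le N f B \<Longrightarrow> norm (T f) \<le> C * B"
proof -
  obtain C N where C: "\<And>f. f \<in> schwartz \<Longrightarrow> norm (T f) \<le> C * schwartz_total N f"
    using assms unfolding tempered_def schwartz_total_def by blast
  \<comment> \<open>The number of seminorms in the sum. \<open>C\<close> has no prescribed sign,
    which is why its absolute value is used below.\<close>
  let ?k = "real (Suc N) * real (card {is::'a list. length is \<le> N})"
  show ?thesis
  proof (rule that [of "\<bar>C\<bar> * ?k" N])
    fix f :: "real^'a \<Rightarrow> complex" and B
    assume f: "f \<in> schwartz" and B: "schwartz_le N f B"
    have "schwartz_seminorm m is f \<le> B" if "m \<le> N" "length is \<le> N" for m "is"
      unfolding schwartz_seminorm_def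
    proof (rule cSUP_least)
      fix x :: "real^'a"
      have "norm x ^ m \<le> (1 + norm x) ^ m"
        by (intro power_mono) auto
      also have "\<dots> \<le> (1 + norm x) ^ N"
        using that by (intro power_increasing) auto
      finally have "norm x ^ m * norm (pderivs is f x) \<le> (1 + norm x) ^ N * norm (pderivs is f x)"
        by (rule mult_right_mono) auto
      also have "\<dots> \<le> B"
        using B that by (intro schwartz_leD)
      finally show "norm x ^ m * norm (pderivs is f x) \<le> B" .
    qed auto
    then have "schwartz_total N f \<le> (\<Sum>m\<le>N. \<Sum>is\<in>{is::'a list. length is \<le> N}. B)"
      unfolding schwartz_total_def by (intro sum_mono) auto
    also have "\<dots> = ?k * B"
      by simp
    finally have tot: "schwartz_total N f \<le> ?k * B" .
    have "0 \<le> schwartz_total N f"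
      unfolding schwartz_total_def using f by (intro sum_nonneg schwartz_seminorm_nonneg)
    then have "C * schwartz_total N f \<le> \<bar>C\<bar> * schwartz_total N f"
      by (intro mult_right_mono) auto
    also have "\<dots> \<le> \<bar>C\<bar> * (?k * B)"
      by (intro mult_left_mono tot) auto
    finally show "norm (T f) \<le> \<bar>C\<bar> * ?k * B"
      using C [OF f] by (simp add: mult_ac)
  qed simp
qed

lemma temperedI:
  assumes "\<And>f g. f \<in> schwartz \<Longrightarrow> g \<in> schwartz \<Longrightarrow> T (\<lambda>x. f x + g x) = T f + T g"
    and "\<And>f c. f \<in> schwartz \<Longrightarrow> T (\<lambda>x. c * f x) = c * T f"
    and "\<And>f B. f \<in> schwartz \<Longrightarrow> schwartz_le N f B \<Longrightarrow> norm (T f) \<le> C * B"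
  shows "tempered T"
proof -
  have "norm (T f) \<le> (C * 2 ^ N * 2) * schwartz_total N f" if "f \<in> schwartz" for f
    using assms(3) [OF that schwartz_le_total [OF that]] by (simp add: mult_ac)
  then show ?thesis
    unfolding tempered_def using assms(1,2) unfolding schwartz_total_def by blast
qed

section \<open>Smooth plateau functions\<close>

text \<open>The classical function exp(-1/t), flat at 0, with a polynomial in 1/t in front of it so
  that the family is closed under differentiation.\<close>

definition flat_exp :: "real poly \<Rightarrow> real \<Rightarrow> real" where
  "flat_exp p t = (if 0 < t then poly p (inverse t) * exp (- inverse t) else 0)"

text \<open>With s = 1/t, the derivative of p(s) exp(-s) with respect to t is s^2 (p(s) - p'(s))
  exp(-s).\<close>

definition flat_exp_deriv_poly :: "real poly \<Rightarrow> real poly" where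
  "flat_exp_deriv_poly p = monom 1 2 * (p - pderiv p)"

lemma poly_mult_exp_neg_at_top: "((\<lambda>x::real. poly p x * exp (- x)) \<longlongrightarrow> 0) at_top"
proof -
  have "((\<lambda>x. \<Sum>i\<le>degree p. coeff p i * (x ^ i / exp x)) \<longlongrightarrow> (\<Sum>i\<le>degree p. coeff p i * 0)) at_top"
    by (intro tendsto_intros tendsto_power_div_exp_0)
  then show ?thesis
    by (simp add: poly_altdef sum_distrib_right exp_minus divide_inverse mult.assoc)
qed

lemma flat_exp_has_derivative:
  "(flat_exp p has_real_derivative flat_exp (flat_exp_deriv_poly p) t) (at t)"
proof -
  consider "t < 0" | "t = 0" | "t > 0" by linarith
  then show ?thesis
  proof cases
    case 1
    have "((\<lambda>t. 0) has_real_derivative 0) (at t)"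
      by simp
    then have "(flat_exp p has_real_derivative 0) (at t)"
      by (rule has_field_derivative_transform_within_open [where S = "{..<0}"])
         (use 1 in \<open>auto simp: flat_exp_def\<close>)
    with 1 show ?thesis
      by (simp add: flat_exp_def)
  next
    case 2
    have "((\<lambda>h. (flat_exp p (t + h) - flat_exp p t) / h) \<longlongrightarrow> 0) (at 0)"
    proof (rule filterlim_split_at)
      \<comment> \<open>For h > 0 the difference quotient at 0 is of the same type: the factor 1/h
        is absorbed by the polynomial, and exp(-1/h) beats every polynomial in 1/h.\<close>
      have "((\<lambda>h. poly (monom 1 1 * p) (inverse h) * exp (- inverse h)) \<longlongrightarrow> 0) (at_right (0::real))"
        by (rule filterlim_compose [OF poly_mult_exp_neg_at_top filterlim_inverse_at_top_right])
      moreover have "\<forall>\<^sub>F h in at_right 0. poly (monom 1 1 * p) (inverse h) * exp (- inverse h)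
          = (flat_exp p (t + h) - flat_exp p t) / h"
        unfolding eventually_at_right_field
        by (rule exI [of _ 1]) (auto simp: 2 flat_exp_def poly_monom field_simps)
      ultimately show "((\<lambda>h. (flat_exp p (t + h) - flat_exp p t) / h) \<longlongrightarrow> 0) (at_right 0)"
        by (rule Lim_transform_eventually)
    next
      have "\<forall>\<^sub>F h in at_left 0. 0 = (flat_exp p (t + h) - flat_exp p t) / h"
        unfolding eventually_at_left_field
        by (rule exI [of _ "-1"]) (auto simp: 2 flat_exp_def)
      then show "((\<lambda>h. (flat_exp p (t + h) - flat_exp p t) / h) \<longlongrightarrow> 0) (at_left 0)"
        by (rule Lim_transform_eventually [OF tendsto_const])
    qed
    then show ?thesis
      by (simp add: DERIV_def 2 flat_exp_def)
  next
    case 3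
    have "((\<lambda>t. poly p (inverse t) * exp (- inverse t)) has_real_derivative
        flat_exp (flat_exp_deriv_poly p) t) (at t)"
      using 3 by (auto intro!: derivative_eq_intros
        simp: flat_exp_def flat_exp_deriv_poly_def poly_monom algebra_simps power2_eq_square)
    then show ?thesis
      by (rule has_field_derivative_transform_within_open [where S = "{0<..}"])
         (use 3 in \<open>auto simp: flat_exp_def\<close>)
  qed
qed

lemma flat_exp_continuous: "continuous_on S (flat_exp p)"
  by (meson DERIV_isCont continuous_at_imp_continuous_on flat_exp_has_derivative)

lemma flat_exp_one: "flat_exp 1 t \<ge> 0" "0 < t \<Longrightarrow> flat_exp 1 t > 0" "t \<le> 0 \<Longrightarrow> flat_exp 1 t = 0"
  by (auto simp: flat_exp_def)

text \<open>The class of functions generated below is closed under partial derivatives, which makes its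
  members smooth; \<open>G\<close> is the radial profile of a plateau function.\<close>

inductive_set radial_alg :: "(real \<Rightarrow> real) \<Rightarrow> real \<Rightarrow> real \<Rightarrow> (real^'n::finite \<Rightarrow> complex) set"
  for G :: "real \<Rightarrow> real" and a b :: real where
  profile: "(\<lambda>x. of_real (G (x \<bullet> x))) \<in> radial_alg G a b"
| const: "(\<lambda>x. c) \<in> radial_alg G a b"
| coord: "(\<lambda>x. of_real (x $ i)) \<in> radial_alg G a b"
| inner_flat: "(\<lambda>x. of_real (flat_exp p (x \<bullet> x - a))) \<in> radial_alg G a b"
| outer_flat: "(\<lambda>x. of_real (flat_exp p (b - x \<bullet> x))) \<in> radial_alg G a b"
| add: "f \<in> radial_alg G a b \<Longrightarrow> g \<in> radial_alg G a b \<Longrightarrow> (\<lambda>x. f x + g x) \<in> radial_alg G a b"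
| mult: "f \<in> radial_alg G a b \<Longrightarrow> g \<in> radial_alg G a b \<Longrightarrow> (\<lambda>x. f x * g x) \<in> radial_alg G a b"

text \<open>The parameters \<open>c\<close> and \<open>e\<close> let one chain rule serve the three
  radial generators, with arguments \<open>x \<bullet> x\<close>, \<open>x \<bullet> x - a\<close>
  and \<open>b - x \<bullet> x\<close>.\<close>

lemma has_derivative_radial:
  fixes x :: "real^'n::finite"
  assumes "(g has_real_derivative d) (at (c * (x \<bullet> x) + e))"
  shows "((\<lambda>x. complex_of_real (g (c * (x \<bullet> x) + e))) has_derivative
          (\<lambda>h. complex_of_real d * complex_of_real c * 2 * of_real (x \<bullet> h))) (at x)"
proof -
  have "((\<lambda>x::real^'n. c * (x \<bullet> x) + e) has_derivative (\<lambda>h. c * (2 * (x \<bullet> h)))) (at x)"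
    by (auto intro!: derivative_eq_intros simp: inner_commute)
  from has_derivative_compose [OF this assms [unfolded has_field_derivative_def]]
  have "((\<lambda>x. g (c * (x \<bullet> x) + e)) has_derivative (\<lambda>h. d * (c * (2 * (x \<bullet> h))))) (at x)" .
  then have "((\<lambda>x. complex_of_real (g (c * (x \<bullet> x) + e))) has_derivative
      (\<lambda>h. complex_of_real (d * (c * (2 * (x \<bullet> h)))))) (at x)"
    by (rule has_derivative_of_real)
  then show ?thesis
    by (simp add: mult_ac)
qed

text \<open>The derivative of \<open>G\<close> is assumed to be a product of two flat functions, and
  the gradient of \<open>x \<bullet> x\<close> brings in the coordinates; this is why all of these
  are generators. The derivative of \<open>G\<close> is asked for at nonnegative arguments because
  \<open>x \<bullet> x\<close> is nonnegative.\<close>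

lemma radial_alg_derivative:
  fixes f :: "real^'n::finite \<Rightarrow> complex"
  assumes "f \<in> radial_alg G a b"
    and G: "\<And>t. 0 \<le> t \<Longrightarrow> (G has_real_derivative (c * flat_exp 1 (t - a) * flat_exp 1 (b - t))) (at t)"
  shows "\<exists>f'. (\<forall>x. (f has_derivative f' x) (at x)) \<and> (\<forall>i. (\<lambda>x. f' x (axis i 1)) \<in> radial_alg G a b)"
  using assms(1)
proof induction
  case profile
  let ?f' = "\<lambda>x h::real^'n. complex_of_real (c * flat_exp 1 (x \<bullet> x - a) * flat_exp 1 (b - x \<bullet> x))
      * complex_of_real 1 * 2 * of_real (x \<bullet> h)"
  have "((\<lambda>x::real^'n. complex_of_real (G (x \<bullet> x))) has_derivative ?f' x) (at x)" for x
    using has_derivative_radial [of G _ 1 x 0, simplified, OF G] by simp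
  moreover have "(\<lambda>x::real^'n. ((complex_of_real c * complex_of_real (flat_exp 1 (x \<bullet> x - a)))
      * complex_of_real (flat_exp 1 (b - x \<bullet> x))) * 2 * of_real (x $ i)) \<in> radial_alg G a b" for i
    by (intro radial_alg.intros)
  ultimately show ?case
    by (intro exI [of _ ?f']) (simp add: inner_axis)
next
  case (const c)
  then show ?case
    by (intro exI [of _ "\<lambda>x h. 0"]) (auto intro: radial_alg.const)
next
  case (coord i)
  then show ?case
    by (intro exI [of _ "\<lambda>x h. complex_of_real (h $ i)"])
       (auto intro: radial_alg.const has_derivative_coord)
next
  case (inner_flat p)
  let ?f' = "\<lambda>x h::real^'n. complex_of_real (flat_exp (flat_exp_deriv_poly p) (x \<bullet> x - a))
      * complex_of_real 1 * 2 * of_real (x \<bullet> h)"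
  have "((\<lambda>x::real^'n. complex_of_real (flat_exp p (x \<bullet> x - a))) has_derivative ?f' x) (at x)" for x
    using has_derivative_radial [of "flat_exp p" _ 1 x "-a"] flat_exp_has_derivative [of p "x \<bullet> x - a"]
    by simp
  moreover have "(\<lambda>x::real^'n. complex_of_real (flat_exp (flat_exp_deriv_poly p) (x \<bullet> x - a))
      * 2 * of_real (x $ i)) \<in> radial_alg G a b" for i
    by (intro radial_alg.intros)
  ultimately show ?case
    by (intro exI [of _ ?f']) (simp add: inner_axis)
next
  case (outer_flat p)
  let ?f' = "\<lambda>x h::real^'n. complex_of_real (flat_exp (flat_exp_deriv_poly p) (b - x \<bullet> x))
      * complex_of_real (-1) * 2 * of_real (x \<bullet> h)"
  have "((\<lambda>x::real^'n. complex_of_real (flat_exp p (b - x \<bullet> x))) has_derivative ?f' x) (at x)" for x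
    using has_derivative_radial [of "flat_exp p" _ "-1" x b] flat_exp_has_derivative [of p "b - x \<bullet> x"]
    by simp
  moreover have "(\<lambda>x::real^'n. complex_of_real (flat_exp (flat_exp_deriv_poly p) (b - x \<bullet> x))
      * complex_of_real (-1) * 2 * of_real (x $ i)) \<in> radial_alg G a b" for i
    by (intro radial_alg.intros)
  ultimately show ?case
    by (intro exI [of _ ?f']) (simp add: inner_axis)
next
  case (add f g)
  then obtain f' g' where "\<And>x. (f has_derivative f' x) (at x)" "\<And>x. (g has_derivative g' x) (at x)"
    and "\<And>i. (\<lambda>x. f' x (axis i 1)) \<in> radial_alg G a b" "\<And>i. (\<lambda>x. g' x (axis i 1)) \<in> radial_alg G a b"
    by blast
  then show ?case
    by (intro exI [of _ "\<lambda>x h. f' x h + g' x h"] conjI allI has_derivative_add radial_alg.add)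
next
  case (mult f g)
  then obtain f' g' where "\<And>x. (f has_derivative f' x) (at x)" "\<And>x. (g has_derivative g' x) (at x)"
    and "\<And>i. (\<lambda>x. f' x (axis i 1)) \<in> radial_alg G a b" "\<And>i. (\<lambda>x. g' x (axis i 1)) \<in> radial_alg G a b"
    by blast
  with mult show ?case
    by (intro exI [of _ "\<lambda>x h. f x * g' x h + f' x h * g x"] conjI allI has_derivative_mult
        radial_alg.add radial_alg.mult)
qed

text \<open>A bump on [a, b] is the product of a flat function that vanishes up to \<open>a\<close>
  and one that vanishes from \<open>b\<close> on. \<open>G\<close> is 1 minus its normalised
  primitive, so \<open>c\<close> is minus the reciprocal of the total integral.\<close>

lemma exists_smooth_profile:
  fixes a b :: real
  assumes "0 < a" "a < b"
  obtains G c where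
    "\<And>t. 0 \<le> t \<Longrightarrow> (G has_real_derivative (c * flat_exp 1 (t - a) * flat_exp 1 (b - t))) (at t)"
    "\<And>t. 0 \<le> t \<Longrightarrow> t \<le> a \<Longrightarrow> G t = 1" "\<And>t. t \<ge> b \<Longrightarrow> G t = 0" "\<And>t. 0 \<le> t \<Longrightarrow> G t \<in> {0..1::real}"
proof -
  define B where "B = (\<lambda>t. flat_exp 1 (t - a) * flat_exp 1 (b - t))"
  \<comment> \<open>Integration starts at -1 so that every t \<ge> 0, and 0 in particular, is an
    interior point at which the primitive has a two-sided derivative.\<close>
  define I where "I = integral {-1..b} B"
  have B_nn: "B t \<ge> 0" for t
    by (simp add: B_def flat_exp_one)
  have B_0: "B t = 0" if "t \<le> a \<or> b \<le> t" for t
    using that by (auto simp: B_def flat_exp_one)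
  have cont: "continuous_on S B" for S
    unfolding B_def
    by (intro continuous_intros continuous_on_compose2 [OF flat_exp_continuous [of UNIV]]) auto
  then have int: "B integrable_on {u..v}" for u v
    by (rule integrable_continuous_real)
  have mono: "integral {-1..u} B \<le> integral {-1..v} B" if "u \<le> v" for u v
    by (rule integral_subset_le) (use that B_nn int in auto)
  have "I > 0"
  proof -
    let ?m = "(a + b) / 2"
    have "B ?m > 0"
      using assms by (simp add: B_def flat_exp_one field_simps)
    moreover have "I = 0 \<Longrightarrow> B ?m = 0"
      unfolding I_def using cont B_nn assms
      by (subst (asm) integral_eq_0_iff) auto
    moreover have "I \<ge> 0"
      unfolding I_def by (rule integral_nonneg [OF int B_nn])
    ultimately show ?thesis
      by force
  qed
  have zero: "integral {-1..t} B = 0" if "t \<le> a" for t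
    using Henstock_Kurzweil_Integration.integral_cong [of "{-1..t}" B "\<lambda>_. 0"] that B_0 by auto
  have full: "integral {-1..t} B = I" if "t \<ge> b" for t
  proof -
    have "integral {-1..b} B + integral {b..t} B = integral {-1..t} B"
      by (rule Henstock_Kurzweil_Integration.integral_combine) (use that assms int in auto)
    moreover have "integral {b..t} B = 0"
      using Henstock_Kurzweil_Integration.integral_cong [of "{b..t}" B "\<lambda>_. 0"] B_0 by auto
    ultimately show ?thesis
      by (simp add: I_def)
  qed
  show ?thesis
  proof (rule that [of "\<lambda>t. 1 - integral {-1..t} B / I" "- (1 / I)"])
    fix t :: real assume t: "0 \<le> t"
    have "((\<lambda>t. integral {-1..t} B) has_real_derivative B t) (at t within {-1..t+1})"
      by (rule integral_has_real_derivative [OF cont]) (use t in auto)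
    then have "((\<lambda>t. integral {-1..t} B) has_real_derivative B t) (at t)"
      using at_within_interior [of t "{-1..t+1}"] t by auto
    then show "((\<lambda>t. 1 - integral {-1..t} B / I) has_real_derivative
        - (1 / I) * flat_exp 1 (t - a) * flat_exp 1 (b - t)) (at t)"
      using \<open>I > 0\<close> by (auto intro!: derivative_eq_intros simp: B_def)
    have "integral {-1..t} B \<le> I"
    proof (cases "t \<le> b")
      case True
      then show ?thesis using mono [of t b] by (simp add: I_def)
    qed (simp add: full)
    moreover have "integral {-1..t} B \<ge> 0"
      by (rule integral_nonneg [OF int B_nn])
    ultimately show "1 - integral {-1..t} B / I \<in> {0..1}"
      using \<open>I > 0\<close> by (auto simp: field_simps)
  qed (use zero full \<open>I > 0\<close> in auto)
qed

text \<open>The profile is composed with \<open>x \<bullet> x\<close>, which is smooth at the origin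
  where the norm is not; the radii therefore enter squared.\<close>

lemma exists_plateau:
  fixes s t :: real
  assumes "0 < s" "s < t"
  obtains \<theta> :: "real^'n::finite \<Rightarrow> complex" where "smooth_fun \<theta>"
    "\<And>x. norm x \<le> s \<Longrightarrow> \<theta> x = 1" "\<And>x. norm x \<ge> t \<Longrightarrow> \<theta> x = 0" "\<And>x. \<exists>r\<in>{0..1}. \<theta> x = of_real r"
proof -
  have "s\<^sup>2 < t\<^sup>2" "0 < s\<^sup>2"
    using assms by (auto intro: power_strict_mono)
  then obtain G c where G:
    "\<And>r. 0 \<le> r \<Longrightarrow> (G has_real_derivative (c * flat_exp 1 (r - s\<^sup>2) * flat_exp 1 (t\<^sup>2 - r))) (at r)"
    "\<And>r. 0 \<le> r \<Longrightarrow> r \<le> s\<^sup>2 \<Longrightarrow> G r = 1" "\<And>r. r \<ge> t\<^sup>2 \<Longrightarrow> G r = 0" "\<And>r. 0 \<le> r \<Longrightarrow> G r \<in> {0..1}"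
    using exists_smooth_profile [of "s\<^sup>2" "t\<^sup>2"] by metis
  show ?thesis
  proof (rule that [of "\<lambda>x. of_real (G (x \<bullet> x))"])
    show "smooth_fun (\<lambda>x::real^'n. complex_of_real (G (x \<bullet> x)))"
    proof (rule smooth_fun_coinduct [OF radial_alg.profile [of G "s\<^sup>2" "t\<^sup>2"]])
      fix f :: "real^'n \<Rightarrow> complex"
      assume "f \<in> radial_alg G (s\<^sup>2) (t\<^sup>2)"
      from radial_alg_derivative [OF this G(1)]
      obtain f' where f': "\<And>x. (f has_derivative f' x) (at x)"
        "\<And>i. (\<lambda>x. f' x (axis i 1)) \<in> radial_alg G (s\<^sup>2) (t\<^sup>2)"
        by blast
      show "f differentiable (at x)" for x
        using f'(1) by (rule differentiableI)
      show "(\<lambda>x. frechet_derivative f (at x) (axis i 1)) \<in> radial_alg G (s\<^sup>2) (t\<^sup>2)" for i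
        using f'(2) by (simp add: frechet_derivative_eqI [OF f'(1)])
    qed
    fix x :: "real^'n"
    show "complex_of_real (G (x \<bullet> x)) = 1" if "norm x \<le> s"
      using G(2) [of "x \<bullet> x"] that power_mono [OF that, of 2] by (simp add: power2_norm_eq_inner)
    show "complex_of_real (G (x \<bullet> x)) = 0" if "t \<le> norm x"
      using G(3) [of "x \<bullet> x"] that power_mono [OF that, of 2] assms by (simp add: power2_norm_eq_inner)
    show "\<exists>r\<in>{0..1}. complex_of_real (G (x \<bullet> x)) = of_real r"
      using G(4) [of "x \<bullet> x"] by auto
  qed
qed

section \<open>Compactly supported and rescaled Schwartz functions\<close>

lemma pderivs_zero_outside:
  fixes f :: "real^'n::finite \<Rightarrow> complex"
  assumes "smooth_fun f" "\<And>x. norm x \<ge> t \<Longrightarrow> f x = 0" "norm x > t"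
  shows "pderivs is f x = 0"
  using assms(3)
proof (induction "is" arbitrary: x)
  case Nil
  then show ?case
    using assms(2) by simp
next
  case (Cons i "is")
  have "(pderivs is f has_derivative (\<lambda>h. 0)) (at x)"
  proof (rule has_derivative_transform_within_open)
    show "((\<lambda>x. 0) has_derivative (\<lambda>h. 0)) (at x)"
      by simp
    show "open {x::real^'n. t < norm x}"
      by (intro open_Collect_less continuous_intros)
  qed (use Cons in auto)
  then show ?case
    by (simp add: frechet_derivative_eqI)
qed

lemma compact_support_schwartz:
  assumes "smooth_fun f" "\<And>x. norm x \<ge> t \<Longrightarrow> f x = 0"
  shows "f \<in> schwartz"
  unfolding schwartz_def mem_Collect_eq
proof (intro conjI allI)
  fix m "is"
  let ?g = "\<lambda>x. norm x ^ m * norm (pderivs is f x)"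
  have "compact (?g ` cball 0 t)"
    by (intro compact_continuous_image continuous_intros smooth_fun_continuous assms) auto
  moreover have "range ?g \<subseteq> insert 0 (?g ` cball 0 t)"
  proof clarify
    fix x
    assume "?g x \<notin> ?g ` cball 0 t"
    then have "norm x > t"
      by (force simp: image_iff)
    then show "?g x = 0"
      using pderivs_zero_outside [OF assms] by simp
  qed
  ultimately show "bounded (range ?g)"
    by (meson bounded_insert bounded_subset compact_imp_bounded)
qed (rule assms(1))

lemma schwartz_affine:
  assumes "f \<in> schwartz" "c \<noteq> 0"
  shows "(\<lambda>x. f (c *\<^sub>R x + a)) \<in> schwartz"
  unfolding schwartz_iff
proof (intro conjI allI)
  show "smooth_fun (\<lambda>x. f (c *\<^sub>R x + a))"
    by (rule smooth_fun_affine [OF schwartz_smooth [OF assms(1)]])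
  fix N
  obtain B where B: "schwartz_le N f B"
    using schwartz_le_exists [OF assms(1)] by blast
  \<comment> \<open>The weights at \<open>x\<close> and at \<open>c *\<^sub>R x + a\<close> are
    comparable up to a constant depending on \<open>a\<close> and \<open>c\<close>; the derivatives
    contribute only powers of \<open>c\<close>.\<close>
  have k: "1 + norm x \<le> (1 + (1 + norm a) / \<bar>c\<bar>) * (1 + norm (c *\<^sub>R x + a))" for x
  proof -
    have "\<bar>c\<bar> * norm x \<le> norm (c *\<^sub>R x + a) + norm a"
      using norm_triangle_ineq4 [of "c *\<^sub>R x + a" a] by simp
    also have "\<dots> \<le> (1 + norm a) * (1 + norm (c *\<^sub>R x + a))"
      by (simp add: algebra_simps)
    finally have "norm x \<le> (1 + norm a) / \<bar>c\<bar> * (1 + norm (c *\<^sub>R x + a))"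
      using assms by (simp add: field_simps)
    then show ?thesis
      using norm_ge_zero [of "c *\<^sub>R x + a"] unfolding distrib_right mult_1 by linarith
  qed
  let ?k = "1 + (1 + norm a) / \<bar>c\<bar>"
  have "schwartz_le N (\<lambda>x. f (c *\<^sub>R x + a)) (?k ^ N * max 1 \<bar>c\<bar> ^ N * B)"
    unfolding schwartz_le_def
  proof (intro allI impI)
    fix "is" :: "'a list" and x :: "real^'a"
    assume len: "length is \<le> N"
    have "(1 + norm x) ^ N \<le> (?k * (1 + norm (c *\<^sub>R x + a))) ^ N"
      using k by (intro power_mono) auto
    moreover have "\<bar>c\<bar> ^ length is \<le> max 1 \<bar>c\<bar> ^ length is"
      by (intro power_mono) auto
    then have "\<bar>c\<bar> ^ length is \<le> max 1 \<bar>c\<bar> ^ N"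
      using power_increasing [OF len, of "max 1 \<bar>c\<bar>"] by linarith
    ultimately have "(1 + norm x) ^ N * (\<bar>c\<bar> ^ length is * norm (pderivs is f (c *\<^sub>R x + a)))
      \<le> (?k * (1 + norm (c *\<^sub>R x + a))) ^ N * (max 1 \<bar>c\<bar> ^ N * norm (pderivs is f (c *\<^sub>R x + a)))"
      by (intro mult_mono) (auto intro!: mult_nonneg_nonneg)
    also have "\<dots> = ?k ^ N * max 1 \<bar>c\<bar> ^ N * ((1 + norm (c *\<^sub>R x + a)) ^ N * norm (pderivs is f (c *\<^sub>R x + a)))"
      by (simp only: power_mult_distrib mult_ac)
    also have "\<dots> \<le> ?k ^ N * max 1 \<bar>c\<bar> ^ N * B"
      by (intro mult_left_mono schwartz_leD [OF B len]) auto
    finally show "(1 + norm x) ^ N * norm (pderivs is (\<lambda>x. f (c *\<^sub>R x + a)) x)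
        \<le> ?k ^ N * max 1 \<bar>c\<bar> ^ N * B"
      by (simp add: pderivs_affine [OF schwartz_smooth [OF assms(1)]] norm_mult norm_power)
  qed
  then show "\<exists>B. schwartz_le N (\<lambda>x. f (c *\<^sub>R x + a)) B" ..
qed

section \<open>The Fourier transform on Schwartz functions\<close>

lemma continuous_lebesgue_measurable:
  "continuous_on UNIV f \<Longrightarrow> f \<in> borel_measurable (lebesgue :: 'a::euclidean_space measure)"
  by (intro measurable_completion) (simp add: borel_measurable_continuous_onI)

text \<open>Coordinates are bounded by the norm, so (1 + |x|)^(2n) dominates the product of all 1 +
  x_b^2. The integral of the reciprocal product factorises into one-dimensional arctangent
  integrals; this is the origin of the exponent 2n used later.\<close>

lemma integrable_decay:
  assumes "2 * CARD('n::finite) \<le> K"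
  shows "integrable lebesgue (\<lambda>x::real^'n. 1 / (1 + norm x) ^ K)"
proof -
  let ?g = "\<lambda>t::real. ennreal (inverse (1 + t\<^sup>2))"
  have "integrable lborel (\<lambda>t::real. inverse (1 + t\<^sup>2))"
    using integrable_inverse_1_plus_square by (simp add: set_integrable_def)
  then have fin: "(\<integral>\<^sup>+t. ?g t \<partial>lborel) < \<infinity>"
    by (simp add: integrable_iff_bounded)
  have "(\<integral>\<^sup>+(x::real^'n). ennreal (1 / (1 + norm x) ^ K) \<partial>lborel) \<le> (\<integral>\<^sup>+(x::real^'n). (\<Prod>b\<in>Basis. ?g (x \<bullet> b)) \<partial>lborel)"
  proof (rule nn_integral_mono)
    fix x :: "real^'n"
    have "(\<Prod>b\<in>Basis. 1 + (x \<bullet> b)\<^sup>2) \<le> (\<Prod>b\<in>(Basis::(real^'n) set). (1 + norm x)\<^sup>2)"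
    proof (rule prod_mono)
      fix b :: "real^'n" assume "b \<in> Basis"
      then have "\<bar>x \<bullet> b\<bar> \<le> norm x"
        by (rule Basis_le_norm)
      then have "(x \<bullet> b)\<^sup>2 \<le> (norm x)\<^sup>2"
        using abs_le_square_iff [of "x \<bullet> b" "norm x"] by simp
      then show "0 \<le> 1 + (x \<bullet> b)\<^sup>2 \<and> 1 + (x \<bullet> b)\<^sup>2 \<le> (1 + norm x)\<^sup>2"
        using norm_ge_zero [of x] by (simp add: power2_sum add_increasing2)
    qed
    also have "\<dots> = (1 + norm x) ^ (2 * CARD('n))"
      by (simp add: power_mult)
    also have "\<dots> \<le> (1 + norm x) ^ K"
      using assms by (intro power_increasing) auto
    finally have "1 / (1 + norm x) ^ K \<le> 1 / (\<Prod>b\<in>Basis. 1 + (x \<bullet> b)\<^sup>2)"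
      by (intro divide_left_mono mult_pos_pos prod_pos) (auto simp: add_pos_nonneg)
    also have "\<dots> = (\<Prod>b\<in>Basis. inverse (1 + (x \<bullet> b)\<^sup>2))"
      by (simp add: prod_inversef [symmetric] o_def divide_inverse)
    finally show "ennreal (1 / (1 + norm x) ^ K) \<le> (\<Prod>b\<in>Basis. ?g (x \<bullet> b))"
      by (subst prod_ennreal) (auto intro!: ennreal_leI)
  qed
  also have "\<dots> = (\<Prod>b\<in>(Basis::(real^'n) set). (\<integral>\<^sup>+t. ?g t \<partial>lborel))"
    by (rule nn_integral_lborel_prod) auto
  also have "\<dots> < \<infinity>"
    using fin by (simp add: power_less_top_ennreal)
  finally have "integrable lborel (\<lambda>x::real^'n. 1 / (1 + norm x) ^ K)"
    by (intro integrableI_bounded) auto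
  then show ?thesis
    by (subst integrable_completion) auto
qed

lemma integrable_decay_bound:
  fixes f :: "real^'n::finite \<Rightarrow> 'b::{banach,second_countable_topology}"
  assumes "f \<in> borel_measurable lebesgue" "2 * CARD('n) \<le> K" "\<And>x. (1 + norm x) ^ K * norm (f x) \<le> B"
  shows "integrable lebesgue f"
    and "(LINT x|lebesgue. norm (f x)) \<le> B * (LINT x|lebesgue. 1 / (1 + norm (x::real^'n)) ^ K)"
proof -
  have *: "norm (f x) \<le> B * (1 / (1 + norm x) ^ K)" for x
    using assms(3) [of x] by (simp add: field_simps add_pos_nonneg)
  have B: "integrable lebesgue (\<lambda>x::real^'n. B * (1 / (1 + norm x) ^ K))"
    by (intro integrable_mult_right integrable_decay assms)
  have "norm (f x) \<le> norm (B * (1 / (1 + norm x) ^ K))" for x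
    using * [of x] abs_ge_self [of "B * (1 / (1 + norm x) ^ K)"] unfolding real_norm_def by linarith
  then show "integrable lebesgue f"
    by (intro Bochner_Integration.integrable_bound [OF B assms(1)] AE_I2)
  then have "(LINT x|lebesgue. norm (f x)) \<le> (LINT x|lebesgue. B * (1 / (1 + norm (x::real^'n)) ^ K))"
    by (intro integral_mono B integrable_norm *)
  then show "(LINT x|lebesgue. norm (f x)) \<le> B * (LINT x|lebesgue. 1 / (1 + norm (x::real^'n)) ^ K)"
    by (simp only: integral_mult_right_zero)
qed

lemma schwartz_continuous: "f \<in> schwartz \<Longrightarrow> continuous_on S f"
  using smooth_fun_continuous [OF schwartz_smooth, of f S "[]"] by simp

lemma schwartz_measurable: "f \<in> schwartz \<Longrightarrow> f \<in> borel_measurable lebesgue"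
  by (rule continuous_lebesgue_measurable) (rule schwartz_continuous)

lemma schwartz_moment_integrable:
  fixes f :: "real^'n::finite \<Rightarrow> complex"
  assumes "f \<in> schwartz"
  shows "integrable lebesgue (\<lambda>x. (1 + norm x) ^ k * norm (f x))"
proof -
  obtain B where B: "schwartz_le (k + 2 * CARD('n)) f B"
    using schwartz_le_exists [OF assms] by blast
  have "(1 + norm x) ^ (2 * CARD('n)) * norm ((1 + norm x) ^ k * norm (f x)) \<le> B" for x
    using schwartz_leD [OF B, of "[]" x] by (simp add: power_add mult_ac)
  then show ?thesis
    by (intro integrable_decay_bound(1) [where K = "2 * CARD('n)" and B = B] continuous_lebesgue_measurable
      continuous_intros schwartz_continuous assms) auto
qed

lemma schwartz_integrable: "f \<in> schwartz \<Longrightarrow> integrable lebesgue f"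
  using schwartz_moment_integrable [of f 0] schwartz_measurable [of f]
  by (simp add: integrable_norm_iff)

lemma integrable_mult_bounded:
  fixes f g :: "real^'n::finite \<Rightarrow> complex"
  assumes "integrable lebesgue f" "g \<in> borel_measurable lebesgue" "\<And>x. norm (g x) \<le> C"
  shows "integrable lebesgue (\<lambda>x. f x * g x)"
proof (rule Bochner_Integration.integrable_bound)
  show "integrable lebesgue (\<lambda>x. C * norm (f x))"
    using assms by auto
  show "(\<lambda>x. f x * g x) \<in> borel_measurable lebesgue"
    using assms by auto
  have "norm (f x) * norm (g x) \<le> norm (f x) * C" for x
    by (intro mult_left_mono assms) auto
  moreover have "0 \<le> C"
    using assms(3) norm_ge_zero order_trans by blast
  ultimately show "AE x in lebesgue. norm (f x * g x) \<le> norm (C * norm (f x))"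
    by (auto simp: norm_mult mult.commute)
qed

lemma cis_measurable: "(\<lambda>x. cis (x \<bullet> \<xi>)) \<in> borel_measurable (lebesgue :: (real^'n::finite) measure)"
  by (intro continuous_lebesgue_measurable continuous_intros)

lemma integrable_mult_cis:
  fixes f :: "real^'n::finite \<Rightarrow> complex"
  shows "integrable lebesgue f \<Longrightarrow> integrable lebesgue (\<lambda>x. f x * cis (x \<bullet> \<xi>))"
  by (rule integrable_mult_bounded [where C = 1]) (auto intro: cis_measurable)

text \<open>The characteristic-function normalisation: \<open>fourier\<close> and \<open>ifourier\<close> are, up to reflection and
  a constant, both equal to it.\<close>

definition cft :: "(real^'n::finite \<Rightarrow> complex) \<Rightarrow> real^'n \<Rightarrow> complex" where
  "cft f = (\<lambda>\<xi>. LINT x|lebesgue. f x * cis (x \<bullet> \<xi>))"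

lemma fourier_eq_cft: "fourier f = (\<lambda>\<xi>. cft f (- \<xi>))"
  by (simp add: fourier_def cft_def)

lemma ifourier_eq_cft:
  "ifourier f = (\<lambda>x. complex_of_real (1 / (2 * pi) ^ CARD('n)) * cft (f :: real^'n::finite \<Rightarrow> complex) x)"
  by (simp add: ifourier_def cft_def inner_commute)

lemma cft_add: "f \<in> schwartz \<Longrightarrow> g \<in> schwartz \<Longrightarrow> cft (\<lambda>x. f x + g x) = (\<lambda>\<xi>. cft f \<xi> + cft g \<xi>)"
  by (simp add: cft_def distrib_right integrable_mult_cis schwartz_integrable)

lemma cft_cmult: "cft (\<lambda>x. c * f x) = (\<lambda>\<xi>. c * cft f \<xi>)"
  by (simp add: cft_def mult.assoc)

lemma norm_cft_le: "norm (cft f \<xi>) \<le> (LINT x|lebesgue. norm (f x))"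
  unfolding cft_def
  by (rule order_trans [OF integral_norm_bound]) (simp add: norm_mult)

lemma norm_cis_minus_one_minus: "norm (cis t - 1 - \<i> * of_real t) \<le> t\<^sup>2 / 2"
  using iexp_approx1 [of t 1] by (simp add: cis_conv_exp algebra_simps power2_eq_square)

text \<open>The second-order Taylor error of the exponential is at most |h|^2 (1 + |x|)^2, which is
  integrable against \<open>f\<close>. This explicit error bound yields the derivative without a
  limit theorem for integrals.\<close>

lemma has_derivative_cft:
  fixes f :: "real^'n::finite \<Rightarrow> complex"
  assumes "f \<in> schwartz"
  shows "(cft f has_derivative (\<lambda>h. LINT x|lebesgue. f x * (\<i> * of_real (x \<bullet> h)) * cis (x \<bullet> \<xi>))) (at \<xi>)"
proof -
  let ?L = "\<lambda>h. LINT x|lebesgue. f x * (\<i> * of_real (x \<bullet> h)) * cis (x \<bullet> \<xi>)"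
  let ?C = "LINT x|lebesgue. (1 + norm x) ^ 2 * norm (f x)"
  note cont = continuous_lebesgue_measurable continuous_intros schwartz_continuous [OF assms]
  have C: "integrable lebesgue (\<lambda>x. (1 + norm x) ^ 2 * norm (f x))"
    by (rule schwartz_moment_integrable [OF assms])
  have sq: "norm x \<le> (1 + norm x) ^ 2" for x :: "real^'n"
    by (simp add: power2_eq_square algebra_simps add_nonneg_nonneg)
  have le: "norm (f x * (\<i> * of_real (x \<bullet> h)) * cis (x \<bullet> \<xi>)) \<le> norm h * ((1 + norm x) ^ 2 * norm (f x))" for x h
  proof -
    have "\<bar>x \<bullet> h\<bar> \<le> norm h * (1 + norm x) ^ 2"
      using Cauchy_Schwarz_ineq2 [of x h] mult_left_mono [OF sq [of x] norm_ge_zero [of h]]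
      by (simp add: mult.commute)
    from mult_left_mono [OF this norm_ge_zero [of "f x"]] show ?thesis
      by (simp add: norm_mult mult_ac)
  qed
  have int: "integrable lebesgue (\<lambda>x. f x * (\<i> * of_real (x \<bullet> h)) * cis (x \<bullet> \<xi>))" for h
    by (rule Bochner_Integration.integrable_bound [OF integrable_mult_right [OF C, of "norm h"]])
       (use le in \<open>auto intro!: cont simp: abs_mult\<close>)
  have bl: "bounded_linear ?L"
  proof (rule bounded_linear_intro)
    show "?L (h + k) = ?L h + ?L k" for h k
      by (subst Bochner_Integration.integral_add [OF int int, symmetric]) (simp add: inner_add_right algebra_simps)
    show "?L (r *\<^sub>R h) = r *\<^sub>R ?L h" for r h
      by (subst integral_scaleR_right [symmetric])
         (simp add: scaleR_conv_of_real [where 'a = complex] mult_ac)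
    show "norm (?L h) \<le> norm h * ?C" for h
    proof -
      have "norm (?L h) \<le> (LINT x|lebesgue. norm h * ((1 + norm x) ^ 2 * norm (f x)))"
        by (rule order_trans [OF integral_norm_bound])
           (intro integral_mono integrable_norm int integrable_mult_right C le)
      then show ?thesis
        by simp
    qed
  qed
  show ?thesis
  proof (rule has_derivativeI_sandwich [OF zero_less_one bl])
    fix y assume "y \<noteq> \<xi>"
    define h where "h = y - \<xi>"
    have h: "h \<noteq> 0" "y = \<xi> + h"
      using \<open>y \<noteq> \<xi>\<close> by (auto simp: h_def)
    have "cft f y - cft f \<xi> - ?L h =
        (LINT x|lebesgue. f x * cis (x \<bullet> y) - f x * cis (x \<bullet> \<xi>) - f x * (\<i> * of_real (x \<bullet> h)) * cis (x \<bullet> \<xi>))"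
      unfolding cft_def
      by (simp add: int Bochner_Integration.integrable_diff integrable_mult_cis schwartz_integrable [OF assms])
    also have "\<dots> = (LINT x|lebesgue. f x * cis (x \<bullet> \<xi>) * (cis (x \<bullet> h) - 1 - \<i> * of_real (x \<bullet> h)))"
      by (intro Bochner_Integration.integral_cong refl)
         (simp add: h(2) inner_add_right cis_mult [symmetric] algebra_simps)
    also have "norm \<dots> \<le> (LINT x|lebesgue. (norm h)\<^sup>2 * ((1 + norm x) ^ 2 * norm (f x)))"
    proof -
      have le2: "norm (f x * cis (x \<bullet> \<xi>) * (cis (x \<bullet> h) - 1 - \<i> * of_real (x \<bullet> h)))
          \<le> (norm h)\<^sup>2 * ((1 + norm x) ^ 2 * norm (f x))" for x
      proof -
        have "norm (cis (x \<bullet> h) - 1 - \<i> * of_real (x \<bullet> h)) \<le> (x \<bullet> h)\<^sup>2"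
          using norm_cis_minus_one_minus [of "x \<bullet> h"] zero_le_power2 [of "x \<bullet> h"] by linarith
        also have "\<dots> \<le> (norm x * norm h)\<^sup>2"
          by (simp add: Cauchy_Schwarz_ineq2 abs_le_square_iff [symmetric])
        also have "\<dots> \<le> (1 + norm x)\<^sup>2 * (norm h)\<^sup>2"
          unfolding power_mult_distrib by (intro mult_right_mono power_mono) auto
        finally have "norm (f x) * norm (cis (x \<bullet> h) - 1 - \<i> * of_real (x \<bullet> h))
          \<le> norm (f x) * ((1 + norm x)\<^sup>2 * (norm h)\<^sup>2)"
          by (rule mult_left_mono) auto
        then show ?thesis
          by (simp add: norm_mult mult_ac)
      qed
      have "integrable lebesgue (\<lambda>x. f x * cis (x \<bullet> \<xi>) * (cis (x \<bullet> h) - 1 - \<i> * of_real (x \<bullet> h)))"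
        by (rule Bochner_Integration.integrable_bound [OF integrable_mult_right [OF C, of "(norm h)\<^sup>2"]])
           (use le2 in \<open>auto intro!: cont simp: abs_mult\<close>)
      then show ?thesis
        by (intro order_trans [OF integral_norm_bound] integral_mono integrable_norm le2 integrable_mult_right C)
    qed
    finally have "norm (cft f y - cft f \<xi> - ?L h) \<le> (norm h)\<^sup>2 * ?C"
      by simp
    then show "norm ((cft f y - cft f \<xi>) - ?L (y - \<xi>)) / norm (y - \<xi>) \<le> norm (y - \<xi>) * ?C"
      using h by (simp add: field_simps power2_eq_square)
  next
    show "((\<lambda>y. norm (y - \<xi>) * ?C) \<longlongrightarrow> 0) (at \<xi>)"
      by (auto intro!: tendsto_eq_intros)
  qed
qed

lemma pderivs_cft_single:
  assumes "f \<in> schwartz"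
  shows "pderivs [i] (cft f) = cft (\<lambda>x. \<i> * (f x * of_real (x $ i)))"
  unfolding pderivs.simps frechet_derivative_eqI [OF has_derivative_cft [OF assms]]
  by (simp add: cft_def inner_axis mult_ac)

lemma schwartz_mult_icoord:
  "f \<in> schwartz \<Longrightarrow> (\<lambda>x. \<i> * (f x * of_real (x $ i))) \<in> schwartz"
  by (intro schwartz_cmult schwartz_mult_coord)

text \<open>A partial derivative of a transform is the transform of a coordinate multiple, so
  transforms of Schwartz functions form a class closed under differentiation.\<close>

lemma smooth_cft:
  assumes "f \<in> schwartz"
  shows "smooth_fun (cft f)"
proof (rule smooth_fun_coinduct [of _ "cft ` schwartz"])
  fix g :: "real^'a \<Rightarrow> complex" and x i
  assume "g \<in> cft ` schwartz"
  then obtain f where f: "f \<in> schwartz" "g = cft f"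
    by blast
  show "g differentiable (at x)"
    unfolding f(2) by (rule differentiableI [OF has_derivative_cft [OF f(1)]])
  show "(\<lambda>x. frechet_derivative g (at x) (axis i 1)) \<in> cft ` schwartz"
    using pderivs_cft_single [OF f(1), of i] schwartz_mult_icoord [OF f(1), of i] f(2) by auto
qed (use assms in auto)

section \<open>Integration by parts and decay of transforms\<close>

lemma integral_translate:
  fixes f :: "real^'n::finite \<Rightarrow> complex"
  assumes "continuous_on UNIV f"
  shows "(LINT x|lebesgue. f (x + a)) = (LINT x|lebesgue. f x)"
proof -
  have f: "f \<in> borel_measurable borel"
    using assms by (rule borel_measurable_continuous_onI)
  have "(LINT x|lborel. f x) = (LINT x|distr lborel borel ((+) a). f x)"
    by (simp only: lborel_distr_plus)
  also have "\<dots> = (LINT x|lborel. f (a + x))"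
    using f by (intro integral_distr) auto
  finally show ?thesis
    using f by (subst (1 2) integral_completion) (auto simp: add.commute)
qed

lemma integrable_translate:
  fixes f :: "real^'n::finite \<Rightarrow> complex"
  assumes "continuous_on UNIV f" "integrable lebesgue f"
  shows "integrable lebesgue (\<lambda>x. f (x + a))"
proof -
  have f: "f \<in> borel_measurable borel"
    using assms(1) by (rule borel_measurable_continuous_onI)
  then have "integrable (distr lborel borel ((+) a)) f"
    using assms(2) by (simp add: lborel_distr_plus integrable_completion)
  then have "integrable lborel (\<lambda>x. f (a + x))"
    using f by (subst (asm) integrable_distr_eq) auto
  then show ?thesis
    using f by (subst integrable_completion) (auto simp: add.commute)
qed

text \<open>The mean value inequality along a segment of length at most 1, on which the weight is at
  least half its value at \<open>x\<close>. It supplies the integrable majorant of difference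
  quotients.\<close>

lemma schwartz_difference_bound:
  fixes f :: "real^'n::finite \<Rightarrow> complex"
  assumes f: "f \<in> schwartz" and B: "schwartz_le K f B" and K: "1 \<le> K" and h: "0 \<le> h" "h \<le> 1"
  shows "norm (f (x + h *\<^sub>R axis i 1) - f x) \<le> h * (2 ^ K * B / (1 + norm x) ^ K)"
proof -
  let ?e = "axis i 1 :: real^'n"
  have "norm (f (x + h *\<^sub>R ?e) - f (x + 0 *\<^sub>R ?e)) \<le> (2 ^ K * B / (1 + norm x) ^ K) * norm (h - 0)"
  proof (rule differentiable_bound [where f = "\<lambda>s. f (x + s *\<^sub>R ?e)" and S = "{0..h}"
        and f' = "\<lambda>s t. frechet_derivative f (at (x + s *\<^sub>R ?e)) (t *\<^sub>R ?e)"])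
    fix s assume s: "s \<in> {0..h}"
    note D = smooth_fun_has_derivative [OF schwartz_smooth [OF f], of "[]", simplified]
    have "((\<lambda>s. x + s *\<^sub>R ?e) has_derivative (\<lambda>t. t *\<^sub>R ?e)) (at s within {0..h})"
      by (auto intro!: derivative_eq_intros)
    then show "((\<lambda>s. f (x + s *\<^sub>R ?e)) has_derivative
        (\<lambda>t. frechet_derivative f (at (x + s *\<^sub>R ?e)) (t *\<^sub>R ?e))) (at s within {0..h})"
      by (rule has_derivative_compose) (rule D)
    have "norm (frechet_derivative f (at (x + s *\<^sub>R ?e)) ?e) \<le> B / (1 + norm (x + s *\<^sub>R ?e)) ^ K"
      using schwartz_le_decay [OF B, of "[i]"] K by simp
    also have "\<dots> \<le> B / ((1 + norm x) / 2) ^ K"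
    proof (intro divide_left_mono power_mono mult_pos_pos zero_less_power)
      have "norm x \<le> norm (x + s *\<^sub>R ?e) + norm (s *\<^sub>R ?e)"
        using norm_triangle_ineq4 [of "x + s *\<^sub>R ?e" "s *\<^sub>R ?e"] by simp
      moreover have "norm (s *\<^sub>R ?e) \<le> 1"
        using s h by (simp add: norm_axis_1)
      moreover have "(1 + a) / 2 \<le> 1 + b" if "a \<le> b + c" "c \<le> 1" "0 \<le> b" for a b c :: real
        using that by simp
      ultimately show "(1 + norm x) / 2 \<le> 1 + norm (x + s *\<^sub>R ?e)"
        by (metis norm_ge_zero)
    qed (use schwartz_le_nonneg [OF B] in \<open>auto simp: add_pos_nonneg\<close>)
    also have "\<dots> = 2 ^ K * B / (1 + norm x) ^ K"
      by (simp add: power_divide)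
    finally have le: "norm (frechet_derivative f (at (x + s *\<^sub>R ?e)) ?e) \<le> 2 ^ K * B / (1 + norm x) ^ K" .
    show "onorm (\<lambda>t. frechet_derivative f (at (x + s *\<^sub>R ?e)) (t *\<^sub>R ?e)) \<le> 2 ^ K * B / (1 + norm x) ^ K"
    proof (rule onorm_bound)
      show "norm (frechet_derivative f (at (x + s *\<^sub>R ?e)) (t *\<^sub>R ?e)) \<le> 2 ^ K * B / (1 + norm x) ^ K * norm t" for t
        using mult_left_mono [OF le, of "\<bar>t\<bar>"]
        by (simp add: linear_scale [OF has_derivative_linear [OF D]] mult.commute)
    qed (use schwartz_le_nonneg [OF B] in auto)
  qed (use h in auto)
  then show ?thesis
    using h by (simp add: mult.commute)
qed

text \<open>Difference quotients have integral 0 by translation invariance and converge dominatedly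
  to the partial derivative. No iterated integral over a single coordinate is involved.\<close>

lemma integral_pderiv_eq_0:
  fixes f :: "real^'n::finite \<Rightarrow> complex"
  assumes f: "f \<in> schwartz"
  shows "(LINT x|lebesgue. pderivs [i] f x) = 0"
proof -
  let ?e = "axis i 1 :: real^'n"
  let ?K = "2 * CARD('n)"
  obtain B where B: "schwartz_le ?K f B"
    using schwartz_le_exists [OF f] by blast
  define s where "s = (\<lambda>k x. (f (x + (1 / real (Suc k)) *\<^sub>R ?e) - f x) * complex_of_real (real (Suc k)))"
  have cont: "continuous_on UNIV (\<lambda>x. f (x + a))" for a
    by (intro continuous_on_compose2 [OF schwartz_continuous [OF f, of UNIV]] continuous_intros) auto
  have "(\<lambda>k. LINT x|lebesgue. s k x) \<longlonglongrightarrow> (LINT x|lebesgue. pderivs [i] f x)"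
  proof (rule integral_dominated_convergence)
    show "pderivs [i] f \<in> borel_measurable lebesgue"
      by (intro schwartz_measurable schwartz_pderivs f)
    show "s k \<in> borel_measurable lebesgue" for k
      unfolding s_def
      by (intro continuous_lebesgue_measurable continuous_intros cont schwartz_continuous f)
    show "integrable lebesgue (\<lambda>x::real^'n. 2 ^ ?K * B * (1 / (1 + norm x) ^ ?K))"
      by (intro integrable_mult_right integrable_decay) auto
    show "AE x in lebesgue. (\<lambda>k. s k x) \<longlonglongrightarrow> pderivs [i] f x"
    proof (rule AE_I2)
      fix x
      have "((\<lambda>t. f (x + t *\<^sub>R ?e)) has_vector_derivative pderivs [i] f x) (at 0)"
      proof -
        note D = smooth_fun_has_derivative [OF schwartz_smooth [OF f], of "[]", simplified]
        have "((\<lambda>t. x + t *\<^sub>R ?e) has_derivative (\<lambda>t. t *\<^sub>R ?e)) (at 0)"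
          by (auto intro!: derivative_eq_intros)
        then have "((\<lambda>t. f (x + t *\<^sub>R ?e)) has_derivative
            (\<lambda>t. frechet_derivative f (at (x + 0 *\<^sub>R ?e)) (t *\<^sub>R ?e))) (at 0)"
          by (rule has_derivative_compose) (rule D)
        then show ?thesis
          by (simp add: has_vector_derivative_def linear_scale [OF has_derivative_linear [OF D]])
      qed
      then have "((\<lambda>t. norm (f (x + t *\<^sub>R ?e) - f x - t *\<^sub>R pderivs [i] f x) / norm t) \<longlongrightarrow> 0) (at 0)"
        unfolding has_vector_derivative_def has_derivative_at by simp
      then have "((\<lambda>t. norm ((f (x + t *\<^sub>R ?e) - f x) /\<^sub>R t - pderivs [i] f x)) \<longlongrightarrow> 0) (at 0)"
      proof (rule Lim_transform_eventually)
        show "\<forall>\<^sub>F t in at 0. norm (f (x + t *\<^sub>R ?e) - f x - t *\<^sub>R pderivs [i] f x) / norm t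
            = norm ((f (x + t *\<^sub>R ?e) - f x) /\<^sub>R t - pderivs [i] f x)"
        proof (rule eventually_at_filter [THEN iffD2], rule always_eventually, intro allI impI)
          fix t :: real assume "t \<noteq> 0"
          then have "(f (x + t *\<^sub>R ?e) - f x) /\<^sub>R t - pderivs [i] f x
             = (f (x + t *\<^sub>R ?e) - f x - t *\<^sub>R pderivs [i] f x) /\<^sub>R t"
            by (simp add: scaleR_diff_right del: pderivs.simps)
          then show "norm (f (x + t *\<^sub>R ?e) - f x - t *\<^sub>R pderivs [i] f x) / norm t
            = norm ((f (x + t *\<^sub>R ?e) - f x) /\<^sub>R t - pderivs [i] f x)"
            by (simp add: divide_inverse mult.commute del: pderivs.simps)
        qed
      qed
      then have "((\<lambda>t. (f (x + t *\<^sub>R ?e) - f x) /\<^sub>R t) \<longlongrightarrow> pderivs [i] f x) (at 0)"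
        by (simp only: tendsto_norm_zero_iff LIM_zero_iff)
      moreover have "filterlim (\<lambda>k. 1 / real (Suc k)) (at 0) sequentially"
        unfolding filterlim_at using LIMSEQ_Suc [OF lim_1_over_n] by auto
      ultimately have "(\<lambda>k. (f (x + (1 / real (Suc k)) *\<^sub>R ?e) - f x) /\<^sub>R (1 / real (Suc k))) \<longlonglongrightarrow> pderivs [i] f x"
        by (rule filterlim_compose)
      then show "(\<lambda>k. s k x) \<longlonglongrightarrow> pderivs [i] f x"
        by (simp add: s_def scaleR_conv_of_real mult.commute)
    qed
    show "AE x in lebesgue. norm (s k x) \<le> 2 ^ ?K * B * (1 / (1 + norm x) ^ ?K)" for k
    proof (rule AE_I2)
      fix x
      show "norm (s k x) \<le> 2 ^ ?K * B * (1 / (1 + norm x) ^ ?K)"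
        using mult_right_mono [OF schwartz_difference_bound [OF f B, of "1 / real (Suc k)" x i], of "real (Suc k)"]
        by (simp add: s_def norm_mult del: of_nat_Suc)
    qed
  qed
  moreover have "(LINT x|lebesgue. s k x) = 0" for k
  proof -
    have "(LINT x|lebesgue. f (x + (1 / real (Suc k)) *\<^sub>R ?e) - f x) = 0"
      using schwartz_integrable [OF f] schwartz_continuous [OF f]
      by (simp add: integral_translate integrable_translate)
    then show ?thesis
      by (simp add: s_def)
  qed
  ultimately show ?thesis
    using LIMSEQ_unique [OF _ tendsto_const] by fastforce
qed

text \<open>Integration by parts: the vanishing integral is that of the derivative of
  \<open>f\<close> times the exponential.\<close>

lemma cft_pderiv:
  fixes f :: "real^'n::finite \<Rightarrow> complex"
  assumes f: "f \<in> schwartz"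
  shows "cft (pderivs [i] f) \<xi> = - (\<i> * of_real (\<xi> $ i)) * cft f \<xi>"
proof -
  have eq: "pderivs [i] (\<lambda>x. f x * cis (\<xi> \<bullet> x)) =
     (\<lambda>x. pderivs [i] f x * cis (\<xi> \<bullet> x) + \<i> * of_real (\<xi> $ i) * (f x * cis (\<xi> \<bullet> x)))"
    unfolding pderivs_mult [OF schwartz_smooth [OF f] smooth_fun_cis]
    by (simp add: pderivs_cis mult_ac del: pderivs.simps(2))
  have "(LINT x|lebesgue. pderivs [i] (\<lambda>x. f x * cis (\<xi> \<bullet> x)) x) = 0"
    by (intro integral_pderiv_eq_0 schwartz_mult_cis f)
  then have "(LINT x|lebesgue. pderivs [i] f x * cis (\<xi> \<bullet> x) + \<i> * of_real (\<xi> $ i) * (f x * cis (\<xi> \<bullet> x))) = 0"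
    by (simp only: eq)
  then show ?thesis
    unfolding inner_commute [of \<xi>] using schwartz_integrable [OF schwartz_pderivs [OF f, of "[i]"]] schwartz_integrable [OF f]
    by (simp add: cft_def integrable_mult_cis eq_neg_iff_add_eq_0 del: pderivs.simps)
qed

text \<open>1 + |\<xi>| is at most 1 plus the sum of the |\<xi>_i|, and multiplication by a
  coordinate is, up to a unimodular factor, the transform of a derivative; each power thus costs one
  order. The 2n extra weights make the transform bounded. \<open>C\<close> does not depend on
  \<open>f\<close>, as continuity of the transform demands.\<close>

lemma cft_decay:
  "\<exists>C\<ge>0. \<forall>f\<in>schwartz. \<forall>B. schwartz_le (2 * CARD('n) + N) f B \<longrightarrow>
     (\<forall>\<xi>. (1 + norm \<xi>) ^ N * norm (cft f (\<xi>::real^'n::finite)) \<le> C * B)"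
proof (induction N)
  case 0
  let ?W = "LINT x|lebesgue. 1 / (1 + norm (x::real^'n)) ^ (2 * CARD('n))"
  have "norm (cft f \<xi>) \<le> ?W * B" if "f \<in> schwartz" "schwartz_le (2 * CARD('n)) f B" for f B and \<xi> :: "real^'n"
    using integrable_decay_bound(2) [OF schwartz_measurable [OF that(1)] order_refl, of B]
      schwartz_leD [OF that(2), of "[]"] norm_cft_le [of f \<xi>]
    by (simp add: mult.commute)
  then show ?case
    by (intro exI [of _ ?W]) (auto intro!: Bochner_Integration.integral_nonneg)
next
  case (Suc N)
  then obtain C where C: "0 \<le> C" "\<And>f B \<xi>. f \<in> schwartz \<Longrightarrow> schwartz_le (2 * CARD('n) + N) f B \<Longrightarrow>
     (1 + norm \<xi>) ^ N * norm (cft f (\<xi>::real^'n)) \<le> C * B"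
    by blast
  show ?case
  proof (intro exI [of _ "C * (1 + real CARD('n))"] conjI ballI allI impI)
    fix f :: "real^'n \<Rightarrow> complex" and B \<xi>
    assume f: "f \<in> schwartz" and B: "schwartz_le (2 * CARD('n) + Suc N) f B"
    have d: "norm (cft (pderivs [i] f) \<xi>) = \<bar>\<xi> $ i\<bar> * norm (cft f \<xi>)" for i
      by (simp add: cft_pderiv [OF f] norm_mult del: pderivs.simps)
    have "(1 + norm \<xi>) ^ Suc N * norm (cft f \<xi>)
        \<le> (1 + norm \<xi>) ^ N * ((1 + (\<Sum>i\<in>UNIV. \<bar>\<xi> $ i\<bar>)) * norm (cft f \<xi>))"
      using norm_le_l1_cart [of \<xi>]
      by (simp add: mult.assoc [symmetric] mult.commute [of "1 + norm \<xi>"] mult_left_mono mult_right_mono)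
    also have "\<dots> = (1 + norm \<xi>) ^ N * norm (cft f \<xi>) + (\<Sum>i\<in>UNIV. (1 + norm \<xi>) ^ N * norm (cft (pderivs [i] f) \<xi>))"
      unfolding d by (simp add: algebra_simps sum_distrib_left)
    also have "\<dots> \<le> C * B + (\<Sum>i\<in>(UNIV::'n set). C * B)"
      using B schwartz_le_mono [OF B, of "2 * CARD('n) + N" B] schwartz_le_pderivs [of "2 * CARD('n) + N" "[_]" f B]
      by (intro add_mono sum_mono C(2) f schwartz_pderivs) auto
    finally show "(1 + norm \<xi>) ^ Suc N * norm (cft f \<xi>) \<le> C * (1 + real CARD('n)) * B"
      by (simp add: algebra_simps)
  qed (use C in auto)
qed

text \<open>Induction on the number of derivatives: the one taken first becomes multiplication by a
  coordinate inside the transform, at the cost of one weight.\<close>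

lemma cft_pderivs_decay:
  "\<exists>C\<ge>0. \<exists>M. \<forall>f\<in>schwartz. \<forall>B. schwartz_le M f B \<longrightarrow>
     (\<forall>is \<xi>. length is \<le> k \<longrightarrow> (1 + norm \<xi>) ^ N * norm (pderivs is (cft f) (\<xi>::real^'n::finite)) \<le> C * B)"
proof (induction k)
  case 0
  then show ?case
    using cft_decay [of N, where 'n = 'n] by auto
next
  case (Suc k)
  then obtain C M where C: "0 \<le> C" and IH: "\<And>f B is \<xi>. f \<in> schwartz \<Longrightarrow> schwartz_le M f B \<Longrightarrow> length is \<le> k \<Longrightarrow>
      (1 + norm \<xi>) ^ N * norm (pderivs is (cft f) (\<xi>::real^'n)) \<le> C * B"
    by blast
  show ?case
  proof (rule exI [of _ "C * 2 ^ M"], intro conjI exI [of _ "M + 1"] ballI allI impI)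
    fix f :: "real^'n \<Rightarrow> complex" and B and "is" :: "'n list" and \<xi> :: "real^'n"
    assume f: "f \<in> schwartz" and B: "schwartz_le (M + 1) f B" and len: "length is \<le> Suc k"
    have B': "schwartz_le M f (2 ^ M * B)"
      using mult_right_mono [of 1 "2 ^ M" B] schwartz_le_nonneg [OF B] by (intro schwartz_le_mono [OF B]) auto
    show "(1 + norm \<xi>) ^ N * norm (pderivs is (cft f) \<xi>) \<le> C * 2 ^ M * B"
    proof (cases "length is \<le> k")
      case True
      with IH [OF f B' True, of \<xi>] show ?thesis
        by (simp add: mult.assoc)
    next
      case False
      then obtain js i where "is": "is = js @ [i]" "length js \<le> k"
        using len by (cases "is" rule: rev_cases) auto
      have "schwartz_le M (\<lambda>x. f x * complex_of_real (x $ i)) (2 ^ M * B * 1)"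
        by (rule schwartz_le_mult [OF schwartz_smooth [OF f] smooth_fun_coord B growth_le_coord]) simp
      from schwartz_le_cmult [OF schwartz_smooth [OF schwartz_mult_coord [OF f]] this, of \<i>]
      have "schwartz_le M (\<lambda>x. \<i> * (f x * complex_of_real (x $ i))) (2 ^ M * B)"
        by simp
      from IH [OF schwartz_mult_icoord [OF f] this "is"(2), of \<xi>] show ?thesis
        by (simp add: "is"(1) pderivs_append pderivs_cft_single [OF f] mult.assoc del: pderivs.simps)
    qed
  qed (use C in auto)
qed

lemma schwartz_le_cft:
  obtains C M where "0 \<le> C"
    "\<And>f B. f \<in> schwartz \<Longrightarrow> schwartz_le M f B \<Longrightarrow> schwartz_le N (cft (f :: real^'n::finite \<Rightarrow> complex)) (C * B)"
  using cft_pderivs_decay [of N N, where 'n = 'n] unfolding schwartz_le_def [of N] by metis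

lemma schwartz_cft: "f \<in> schwartz \<Longrightarrow> cft f \<in> schwartz"
  unfolding schwartz_iff [of "cft f"]
  by (metis schwartz_le_cft schwartz_le_exists smooth_cft)

text \<open>The transform is continuous on Schwartz functions. The later estimates are applied to
  \<open>a\<close> composed with \<open>cft\<close>, where the translates and modulations of the
  plateau appear undisguised.\<close>

lemma tempered_cft:
  assumes "tempered T"
  shows "tempered (\<lambda>f. T (cft f))"
proof -
  obtain C N where C: "0 \<le> C" "\<And>f B. f \<in> schwartz \<Longrightarrow> schwartz_le N f B \<Longrightarrow> norm (T f) \<le> C * B"
    using tempered_boundE [OF assms] by blast
  obtain D M where "0 \<le> D" "\<And>f B. f \<in> schwartz \<Longrightarrow> schwartz_le M f B \<Longrightarrow> schwartz_le N (cft (f :: real^'a \<Rightarrow> complex)) (D * B)"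
    using schwartz_le_cft [where N = N and 'n = 'a] by blast
  then have "norm (T (cft f)) \<le> (C * D) * B" if "f \<in> schwartz" "schwartz_le M f B" for f B
    using C(2) [OF schwartz_cft [OF that(1)]] that by (simp add: mult.assoc)
  then show ?thesis
    by (intro temperedI [where N = M and C = "C * D"])
       (simp_all add: cft_add cft_cmult tempered_add [OF assms] tempered_cmult [OF assms] schwartz_cft)
qed

section \<open>Fourier inversion\<close>

text \<open>The characteristic function of the standard normal distribution, freed of the
  normalising factor of its density.\<close>

lemma gauss_char:
  "complex_integrable lborel (\<lambda>s. complex_of_real (exp (- s\<^sup>2 / 2)) * cis (s * t))"
  "(CLINT s|lborel. complex_of_real (exp (- s\<^sup>2 / 2)) * cis (s * t)) = of_real (sqrt (2 * pi) * exp (- t\<^sup>2 / 2))"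
proof -
  have *: "complex_of_real (exp (- s\<^sup>2 / 2)) * cis (s * t)
     = of_real (sqrt (2 * pi)) * (std_normal_density s *\<^sub>R iexp (t * s))" for s
    by (simp add: normal_density_def cis_conv_exp scaleR_conv_of_real mult_ac)
  have "complex_integrable std_normal_distribution (\<lambda>s. iexp (t * s))"
    by (rule finite_measure.integrable_const_bound [OF prob_space.finite_measure [OF prob_space_normal_density], where B = 1]) auto
  then have int: "complex_integrable lborel (\<lambda>s. std_normal_density s *\<^sub>R iexp (t * s))"
    by (subst (asm) integrable_density) auto
  then show "complex_integrable lborel (\<lambda>s. complex_of_real (exp (- s\<^sup>2 / 2)) * cis (s * t))"
    unfolding * by (rule integrable_mult_right)
  have "(CLINT s|lborel. std_normal_density s *\<^sub>R iexp (t * s)) = char std_normal_distribution t"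
    unfolding char_def by (subst integral_density) auto
  then show "(CLINT s|lborel. complex_of_real (exp (- s\<^sup>2 / 2)) * cis (s * t))
      = of_real (sqrt (2 * pi) * exp (- t\<^sup>2 / 2))"
    unfolding * integral_mult_right_zero by (simp add: char_std_normal_distribution)
qed

section \<open>Gaussian regularisation of the inversion integral\<close>

definition gaussian :: "real^'n::finite \<Rightarrow> real" where
  "gaussian x = exp (- (x \<bullet> x) / 2)"

lemma continuous_gaussian: "continuous_on S gaussian"
  unfolding gaussian_def by (intro continuous_intros) auto

lemma continuous_gaussian_compose [continuous_intros]:
  "continuous_on S f \<Longrightarrow> continuous_on S (\<lambda>x. gaussian (f x))"
  by (rule continuous_on_compose2 [OF continuous_gaussian [of UNIV]]) auto

lemma gaussian_le_1: "gaussian x \<le> 1" and gaussian_pos: "0 < gaussian x"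
  by (simp_all add: gaussian_def)

text \<open>The Gaussian and the exponential both factorise over the coordinates, so the integral is
  a product of one-dimensional ones.\<close>

lemma gaussian_integral:
  fixes t :: "real^'n::finite"
  shows "integrable lebesgue (\<lambda>x. complex_of_real (gaussian x) * cis (x \<bullet> t))"
    and "cft (\<lambda>x. complex_of_real (gaussian x)) t = of_real (sqrt (2 * pi) ^ CARD('n) * gaussian t)"
proof -
  interpret product_sigma_finite "\<lambda>b::real^'n. lborel :: real measure"
    by standard
  let ?P = "\<Pi>\<^sub>M b\<in>(Basis::(real^'n) set). (lborel :: real measure)"
  let ?s = "\<lambda>f. \<Sum>b\<in>(Basis::(real^'n) set). f b *\<^sub>R b"
  let ?h = "\<lambda>x. complex_of_real (gaussian x) * cis (x \<bullet> t)"
  have meas: "?h \<in> borel_measurable borel"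
    by (intro borel_measurable_continuous_onI continuous_intros)
  have h: "?h (?s f) = (\<Prod>b\<in>Basis. complex_of_real (exp (- (f b)\<^sup>2 / 2)) * cis (f b * (t \<bullet> b)))" for f
  proof -
    have b: "?s f \<bullet> b = f b" if "b \<in> Basis" for b
      using that by simp
    have "?s f \<bullet> ?s f = (\<Sum>b\<in>Basis. (f b)\<^sup>2)"
      using euclidean_inner [of "?s f" "?s f"] b by (simp add: power2_eq_square)
    then have "gaussian (?s f) = (\<Prod>b\<in>(Basis::(real^'n) set). exp (- (f b)\<^sup>2 / 2))"
      unfolding gaussian_def exp_sum [OF finite_Basis, symmetric]
      by (simp add: sum_divide_distrib sum_negf)
    moreover have "?s f \<bullet> t = (\<Sum>b\<in>Basis. f b * (t \<bullet> b))"
      by (simp add: inner_sum_left) (simp add: inner_commute)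
    then have "cis (?s f \<bullet> t) = (\<Prod>b\<in>Basis. cis (f b * (t \<bullet> b)))"
      by (simp add: cis_conv_exp exp_sum [symmetric] sum_distrib_left)
    ultimately show ?thesis
      by (simp add: prod.distrib)
  qed
  have intP: "integrable ?P (\<lambda>f. ?h (?s f))"
    unfolding h by (intro product_integrable_prod finite_Basis gauss_char(1))
  have "integrable lborel ?h"
    unfolding lborel_eq [where 'a = "real^'n"] by (subst integrable_distr_eq) (use intP meas in auto)
  then show "integrable lebesgue ?h"
    by (subst integrable_completion) (use meas in auto)
  have "(LINT x|lborel. ?h x) = (LINT f|?P. ?h (?s f))"
    unfolding lborel_eq [where 'a = "real^'n"] by (subst integral_distr) (use meas in auto)
  also have "\<dots> = (\<Prod>b\<in>Basis. CLINT s|lborel. complex_of_real (exp (- s\<^sup>2 / 2)) * cis (s * (t \<bullet> b)))"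
    unfolding h by (intro product_integral_prod finite_Basis gauss_char(1))
  also have "\<dots> = of_real (sqrt (2 * pi) ^ CARD('n) * (\<Prod>b\<in>Basis. exp (- (t \<bullet> b)\<^sup>2 / 2)))"
    unfolding gauss_char by (simp add: prod.distrib)
  also have "(\<Prod>b\<in>Basis. exp (- (t \<bullet> b)\<^sup>2 / 2)) = gaussian t"
    unfolding gaussian_def exp_sum [OF finite_Basis, symmetric] euclidean_inner [of t t]
    by (simp add: sum_divide_distrib sum_negf power2_eq_square)
  finally show "cft (\<lambda>x. complex_of_real (gaussian x)) t = of_real (sqrt (2 * pi) ^ CARD('n) * gaussian t)"
    unfolding cft_def by (subst integral_completion) (use meas in auto)
qed

lemma integral_affine:
  fixes h :: "real^'n::finite \<Rightarrow> complex"
  assumes "continuous_on UNIV h" "c \<noteq> 0"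
  shows "(LINT x|lebesgue. h x) = of_real (\<bar>c\<bar> ^ CARD('n)) * (LINT x|lebesgue. h (t + c *\<^sub>R x))"
proof -
  have [measurable]: "h \<in> borel_measurable borel"
    using assms(1) by (rule borel_measurable_continuous_onI)
  have "(LINT x|lborel. h x) = (LINT x|density (distr lborel borel (\<lambda>x. t + c *\<^sub>R x)) (\<lambda>_. \<bar>c\<bar> ^ DIM(real^'n)). h x)"
    using lborel_affine [OF assms(2), of t] by simp
  also have "\<dots> = (LINT x|lborel. (\<bar>c\<bar> ^ CARD('n)) *\<^sub>R h (t + c *\<^sub>R x))"
    by (subst integral_density) (auto simp: integral_distr)
  also have "\<dots> = of_real (\<bar>c\<bar> ^ CARD('n)) * (LINT x|lborel. h (t + c *\<^sub>R x))"
    by (simp add: scaleR_conv_of_real)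
  finally show ?thesis
    by (subst (1 2) integral_completion) auto
qed

lemma integrable_affine:
  fixes h :: "real^'n::finite \<Rightarrow> complex"
  assumes "continuous_on UNIV h" "integrable lebesgue h" "c \<noteq> 0"
  shows "integrable lebesgue (\<lambda>x. h (t + c *\<^sub>R x))"
proof -
  have [measurable]: "h \<in> borel_measurable borel"
    using assms(1) by (rule borel_measurable_continuous_onI)
  have "integrable (density (distr lborel borel (\<lambda>x. t + c *\<^sub>R x)) (\<lambda>_. \<bar>c\<bar> ^ DIM(real^'n))) h"
    using lborel_affine [OF assms(3), of t] assms(2) by (simp add: integrable_completion)
  then have "integrable (distr lborel borel (\<lambda>x. t + c *\<^sub>R x)) (\<lambda>x. (\<bar>c\<bar> ^ CARD('n)) *\<^sub>R h x)"
    by (subst (asm) integrable_density) auto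
  then have "integrable (distr lborel borel (\<lambda>x. t + c *\<^sub>R x)) (\<lambda>x. (1 / \<bar>c\<bar> ^ CARD('n)) *\<^sub>R (\<bar>c\<bar> ^ CARD('n)) *\<^sub>R h x)"
    by (rule integrable_scaleR_right)
  then have "integrable (distr lborel borel (\<lambda>x. t + c *\<^sub>R x)) h"
    using assms(3) by simp
  then have "integrable lborel (\<lambda>x. h (t + c *\<^sub>R x))"
    by (subst (asm) integrable_distr_eq) auto
  then show ?thesis
    by (subst integrable_completion) auto
qed

text \<open>Fubini is applied to \<open>lborel\<close>, where continuity provides product
  measurability, and the iterated integrals are then carried over to the completion. A general
  kernel bounded by 1 covers both signs of the exponential.\<close>

lemma fubini_kernel:
  fixes f g :: "real^'n::finite \<Rightarrow> complex"
  assumes f: "continuous_on UNIV f" "integrable lebesgue f"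
    and g: "continuous_on UNIV g" "integrable lebesgue g"
    and k: "continuous_on UNIV (\<lambda>p. k (fst p) (snd p))" "\<And>x y. norm (k x y) \<le> (1::real)"
  shows "(LINT y|lebesgue. (LINT x|lebesgue. f x * k x y) * g y) =
         (LINT x|lebesgue. f x * (LINT y|lebesgue. g y * k x y))"
proof -
  have [measurable]: "f \<in> borel_measurable borel" "g \<in> borel_measurable borel"
    using f g by (auto intro: borel_measurable_continuous_onI)
  have k' [measurable]: "(\<lambda>p. k (fst p) (snd p)) \<in> borel_measurable (borel \<Otimes>\<^sub>M borel)"
    unfolding borel_prod by (rule borel_measurable_continuous_onI [OF k(1)])
  have k'' [measurable]: "(\<lambda>p. k (snd p) (fst p)) \<in> borel_measurable (borel \<Otimes>\<^sub>M borel)"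
    using measurable_compose [OF measurable_pair_swap' k'] by (simp add: case_prod_beta')
  have [measurable]: "(\<lambda>x. k x y) \<in> borel_measurable borel" for y
    using measurable_compose [OF measurable_Pair2' [of y borel borel] k'] by simp
  have [measurable]: "(\<lambda>y. k x y) \<in> borel_measurable borel" for x
    using measurable_compose [OF measurable_Pair1' [of x borel borel] k'] by simp
  have fi: "integrable lborel f" "integrable lborel g"
    using f g by (auto simp: integrable_completion)
  let ?F = "\<lambda>x y. f x * k x y * g y"
  have meas: "(\<lambda>p. ?F (fst p) (snd p)) \<in> borel_measurable (lborel \<Otimes>\<^sub>M lborel)"
    by measurable
  have le: "norm (?F x y) \<le> norm (f x) * norm (g y)" for x y
    using mult_left_mono [OF k(2) [of x y], of "norm (f x) * norm (g y)"] by (simp add: norm_mult mult_ac)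
  have int: "integrable lborel (\<lambda>y. ?F x y)" for x
    by (rule Bochner_Integration.integrable_bound [OF integrable_mult_right [OF integrable_norm [OF fi(2)], of "norm (f x)"]])
       (use le in auto)
  have prod: "integrable (lborel \<Otimes>\<^sub>M lborel) (\<lambda>(x, y). ?F x y)"
  proof (rule lborel_pair.Fubini_integrable)
    show "(\<lambda>(x, y). ?F x y) \<in> borel_measurable (lborel \<Otimes>\<^sub>M lborel)"
      using meas by (simp add: case_prod_beta')
    have "(LINT y|lborel. norm (?F x y)) \<le> norm (f x) * (LINT y|lborel. norm (g y))" for x
    proof -
      have "(LINT y|lborel. norm (?F x y)) \<le> (LINT y|lborel. norm (f x) * norm (g y))"
        by (intro integral_mono integrable_norm int integrable_mult_right fi le)
      then show ?thesis
        by simp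
    qed
    moreover have "(\<lambda>x. LINT y|lborel. norm (?F x y)) \<in> borel_measurable lborel"
      using meas by (intro lborel.borel_measurable_lebesgue_integral) (simp add: case_prod_beta')
    ultimately show "integrable lborel (\<lambda>x. LINT y|lborel. norm (case (x, y) of (x, y) \<Rightarrow> ?F x y))"
      by (intro Bochner_Integration.integrable_bound [OF integrable_mult_left [OF integrable_norm [OF fi(1)], of "LINT y|lborel. norm (g y)"]])
         (auto simp: Bochner_Integration.integral_nonneg)
  qed (use int in auto)
  have "(LINT y|lborel. (LINT x|lborel. ?F x y)) = (LINT x|lborel. (LINT y|lborel. ?F x y))"
    by (rule lborel_pair.Fubini_integral [OF prod])
  moreover have "(LINT x|lborel. ?F x y) = (LINT x|lborel. f x * k x y) * g y" for y
    by simp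
  moreover have "(LINT y|lborel. ?F x y) = f x * (LINT y|lborel. g y * k x y)" for x
    by (subst integral_mult_right_zero [symmetric]) (simp add: mult_ac)
  ultimately have *: "(LINT y|lborel. (LINT x|lborel. f x * k x y) * g y) = (LINT x|lborel. f x * (LINT y|lborel. g y * k x y))"
    by simp
  have m1: "(\<lambda>y. (LINT x|lborel. f x * k x y) * g y) \<in> borel_measurable lborel"
    by (intro borel_measurable_times lborel.borel_measurable_lebesgue_integral) (simp_all add: case_prod_beta')
  have m2: "(\<lambda>x. f x * (LINT y|lborel. g y * k x y)) \<in> borel_measurable lborel"
    by (intro borel_measurable_times lborel.borel_measurable_lebesgue_integral) (simp_all add: case_prod_beta')
  have "(LINT x|lebesgue. f x * k x y) = (LINT x|lborel. f x * k x y)" for y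
    by (rule integral_completion) auto
  moreover have "(LINT y|lebesgue. g y * k x y) = (LINT y|lborel. g y * k x y)" for x
    by (rule integral_completion) auto
  ultimately show ?thesis
    using * by (simp add: integral_completion [OF m1] integral_completion [OF m2])
qed

lemma gaussian_integrable: "integrable lebesgue (\<lambda>x. complex_of_real (gaussian (x::real^'n::finite)))"
  using gaussian_integral(1) [of 0] by simp

lemma schwartz_bounded: "f \<in> schwartz \<Longrightarrow> \<exists>B. \<forall>x. norm (f x) \<le> B"
  using schwartz_le_exists [of f 0] schwartz_leD [of 0 f _ "[]"] by fastforce

text \<open>Both sides come from the multiplication formula \<open>\<integral> cft u * v = \<integral> u * cft v\<close> for a modulated
  Gaussian \<open>v\<close> of width \<open>1 / e\<close>.\<close>

lemma regularised_inversion: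
  fixes u :: "real^'n::finite \<Rightarrow> complex"
  assumes u: "u \<in> schwartz" and e: "0 < e"
  shows "(LINT \<xi>|lebesgue. cft u \<xi> * (cis (\<xi> \<bullet> - x) * of_real (gaussian (e *\<^sub>R \<xi>)))) =
         of_real (sqrt (2 * pi) ^ CARD('n)) * (LINT z|lebesgue. u (x + e *\<^sub>R z) * of_real (gaussian z))"
proof -
  let ?c = "complex_of_real (sqrt (2 * pi) ^ CARD('n))"
  let ?en = "complex_of_real (e ^ CARD('n))"
  let ?v = "\<lambda>\<xi>. cis (\<xi> \<bullet> - x) * complex_of_real (gaussian (e *\<^sub>R \<xi>))"
  have en: "?en \<noteq> 0"
    using e by simp
  have cv: "continuous_on UNIV ?v"
    by (intro continuous_intros)
  have iv: "integrable lebesgue ?v"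
  proof -
    have "integrable lebesgue (\<lambda>x. complex_of_real (gaussian (0 + e *\<^sub>R (x::real^'n))))"
      using e by (intro integrable_affine gaussian_integrable continuous_intros) auto
    then show ?thesis
      using integrable_mult_cis [of "\<lambda>x. complex_of_real (gaussian (e *\<^sub>R x))" "-x"] by (simp add: mult.commute)
  qed
  \<comment> \<open>The transform of \<open>?v\<close> is a Gaussian of width \<open>e\<close>
    centred at \<open>x\<close>; its factor \<open>1 / ?en\<close> is cancelled below by the
    substitution y = x + e z.\<close>
  have cftv: "cft ?v y = ?c / ?en * of_real (gaussian ((1 / e) *\<^sub>R (y - x)))" for y
  proof -
    let ?h = "\<lambda>\<xi>. complex_of_real (gaussian \<xi>) * cis (\<xi> \<bullet> ((1 / e) *\<^sub>R (y - x)))"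
    have "cft ?v y = (LINT \<xi>|lebesgue. ?h (0 + e *\<^sub>R \<xi>))"
      unfolding cft_def
    proof (rule Bochner_Integration.integral_cong [OF refl])
      fix \<xi> :: "real^'n"
      have "(e *\<^sub>R \<xi>) \<bullet> ((1 / e) *\<^sub>R (y - x)) = \<xi> \<bullet> (y - x)"
        using e by (simp only: inner_scaleR_left inner_scaleR_right) simp
      moreover have "?v \<xi> * cis (\<xi> \<bullet> y) = complex_of_real (gaussian (e *\<^sub>R \<xi>)) * cis (\<xi> \<bullet> (y - x))"
        by (simp add: cis_mult inner_diff_right mult_ac)
      ultimately show "?v \<xi> * cis (\<xi> \<bullet> y) = ?h (0 + e *\<^sub>R \<xi>)"
        by (simp only: add_0)
    qed
    also have "\<dots> = (LINT \<xi>|lebesgue. ?h \<xi>) / ?en"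
      using integral_affine [of ?h e 0] e en by (simp add: continuous_intros field_simps)
    also have "(LINT \<xi>|lebesgue. ?h \<xi>) = ?c * of_real (gaussian ((1 / e) *\<^sub>R (y - x)))"
      using gaussian_integral(2) [of "(1 / e) *\<^sub>R (y - x)"] by (simp add: cft_def)
    finally show ?thesis
      by simp
  qed
  have "(LINT \<xi>|lebesgue. cft u \<xi> * ?v \<xi>) = (LINT y|lebesgue. u y * (LINT \<xi>|lebesgue. ?v \<xi> * cis (y \<bullet> \<xi>)))"
    unfolding cft_def
    by (rule fubini_kernel [OF schwartz_continuous [OF u] schwartz_integrable [OF u] cv iv])
       (auto intro!: continuous_intros)
  also have "\<dots> = (LINT y|lebesgue. u y * (?c / ?en * of_real (gaussian ((1 / e) *\<^sub>R (y - x)))))"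
    unfolding cftv [symmetric] by (simp add: cft_def inner_commute)
  also have "\<dots> = ?en * (LINT z|lebesgue. u (x + e *\<^sub>R z) * (?c / ?en * of_real (gaussian z)))"
    using integral_affine [of "\<lambda>y. u y * (?c / ?en * of_real (gaussian ((1 / e) *\<^sub>R (y - x))))" e x] e
    by (simp add: continuous_intros schwartz_continuous [OF u])
  also have "\<dots> = ?en * (LINT z|lebesgue. (?c / ?en) * (u (x + e *\<^sub>R z) * of_real (gaussian z)))"
    by (simp add: mult_ac)
  also have "\<dots> = ?c * (LINT z|lebesgue. u (x + e *\<^sub>R z) * of_real (gaussian z))"
    using en unfolding integral_mult_right_zero by simp
  finally show ?thesis .
qed

text \<open>The regularisation parameter tends to 0 on both sides of the regularised formula. One
  factor sqrt(2 pi)^n comes from the transform of the regularising Gaussian, the other from the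
  integral of the Gaussian left in the limit; together they make (2 pi)^n.\<close>

theorem cft_inversion:
  fixes u :: "real^'n::finite \<Rightarrow> complex"
  assumes u: "u \<in> schwartz"
  shows "cft (cft u) (- x) = of_real ((2 * pi) ^ CARD('n)) * u x"
proof -
  let ?c = "complex_of_real (sqrt (2 * pi) ^ CARD('n))"
  let ?e = "\<lambda>k. 1 / real (Suc k)"
  have e0: "?e \<longlonglongrightarrow> 0"
    using LIMSEQ_Suc [OF lim_1_over_n] .
  obtain B where B: "\<And>x. norm (u x) \<le> B"
    using schwartz_bounded [OF u] by blast
  have u_cont: "continuous_on UNIV (\<lambda>z. u (x + c *\<^sub>R z))" for c
    by (intro continuous_on_compose2 [OF schwartz_continuous [OF u, of UNIV]] continuous_intros) auto
  have "(\<lambda>k. LINT \<xi>|lebesgue. cft u \<xi> * (cis (\<xi> \<bullet> - x) * of_real (gaussian (?e k *\<^sub>R \<xi>))))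
      \<longlonglongrightarrow> (LINT \<xi>|lebesgue. cft u \<xi> * (cis (\<xi> \<bullet> - x) * of_real (gaussian (0 *\<^sub>R \<xi>))))"
  proof (rule integral_dominated_convergence [where w = "\<lambda>\<xi>. norm (cft u \<xi>)"])
    show "integrable lebesgue (\<lambda>\<xi>. norm (cft u \<xi>))"
      by (intro integrable_norm schwartz_integrable schwartz_cft u)
    show "AE \<xi> in lebesgue. (\<lambda>k. cft u \<xi> * (cis (\<xi> \<bullet> - x) * of_real (gaussian (?e k *\<^sub>R \<xi>))))
        \<longlonglongrightarrow> cft u \<xi> * (cis (\<xi> \<bullet> - x) * of_real (gaussian (0 *\<^sub>R \<xi>)))"
      unfolding gaussian_def by (intro AE_I2 tendsto_intros e0) auto
    show "AE \<xi> in lebesgue. norm (cft u \<xi> * (cis (\<xi> \<bullet> - x) * of_real (gaussian (?e k *\<^sub>R \<xi>)))) \<le> norm (cft u \<xi>)" for k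
    proof (rule AE_I2)
      fix \<xi> :: "real^'n"
      have "\<bar>gaussian (?e k *\<^sub>R \<xi>)\<bar> \<le> 1"
        using gaussian_le_1 [of "?e k *\<^sub>R \<xi>"] gaussian_pos [of "?e k *\<^sub>R \<xi>"] by linarith
      from mult_left_mono [OF this norm_ge_zero [of "cft u \<xi>"]]
      show "norm (cft u \<xi> * (cis (\<xi> \<bullet> - x) * of_real (gaussian (?e k *\<^sub>R \<xi>)))) \<le> norm (cft u \<xi>)"
        by (simp add: norm_mult)
    qed
  qed (intro continuous_lebesgue_measurable continuous_intros schwartz_continuous schwartz_cft u)+
  moreover have "(\<lambda>k. ?c * (LINT z|lebesgue. u (x + ?e k *\<^sub>R z) * of_real (gaussian z)))
      \<longlonglongrightarrow> ?c * (LINT z|lebesgue. u (x + 0 *\<^sub>R z) * of_real (gaussian z))"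
  proof (intro tendsto_mult tendsto_const integral_dominated_convergence [where w = "\<lambda>z. B * norm (complex_of_real (gaussian z))"])
    show "integrable lebesgue (\<lambda>z::real^'n. B * norm (complex_of_real (gaussian z)))"
      by (intro integrable_mult_right integrable_norm gaussian_integrable)
    show "AE z in lebesgue. (\<lambda>k. u (x + ?e k *\<^sub>R z) * of_real (gaussian z))
        \<longlonglongrightarrow> u (x + 0 *\<^sub>R z) * of_real (gaussian z)"
    proof (intro AE_I2 tendsto_mult tendsto_const)
      fix z :: "real^'n"
      have "(\<lambda>k. x + ?e k *\<^sub>R z) \<longlonglongrightarrow> x + 0 *\<^sub>R z"
        by (intro tendsto_intros e0)
      then show "(\<lambda>k. u (x + ?e k *\<^sub>R z)) \<longlonglongrightarrow> u (x + 0 *\<^sub>R z)"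
        by (rule continuous_on_tendsto_compose [OF schwartz_continuous [OF u, of UNIV]]) auto
    qed
    show "AE z in lebesgue. norm (u (x + ?e k *\<^sub>R z) * complex_of_real (gaussian z))
        \<le> B * norm (complex_of_real (gaussian z))" for k
      using B by (intro AE_I2) (simp add: norm_mult mult_right_mono)
  qed (intro continuous_lebesgue_measurable continuous_intros u_cont)+
  moreover have "(LINT \<xi>|lebesgue. cft u \<xi> * (cis (\<xi> \<bullet> - x) * of_real (gaussian (?e k *\<^sub>R \<xi>))))
      = ?c * (LINT z|lebesgue. u (x + ?e k *\<^sub>R z) * of_real (gaussian z))" for k
    by (rule regularised_inversion [OF u]) simp
  ultimately have "(LINT \<xi>|lebesgue. cft u \<xi> * (cis (\<xi> \<bullet> - x) * of_real (gaussian (0 *\<^sub>R \<xi>))))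
      = ?c * (LINT z|lebesgue. u (x + 0 *\<^sub>R z) * of_real (gaussian z))"
    by (simp only: LIMSEQ_unique)
  then have "cft (cft u) (- x) = ?c * (u x * (LINT z|lebesgue. complex_of_real (gaussian (z::real^'n))))"
    by (simp add: cft_def [of "cft u"] gaussian_def)
  also have "(LINT z|lebesgue. complex_of_real (gaussian (z::real^'n))) = ?c"
    using gaussian_integral(2) [of "0::real^'n"] by (simp add: cft_def gaussian_def)
  also have "?c * (u x * ?c) = of_real ((2 * pi) ^ CARD('n)) * u x"
  proof -
    have "sqrt (2 * pi) ^ CARD('n) * sqrt (2 * pi) ^ CARD('n) = (2 * pi) ^ CARD('n)"
      unfolding power_mult_distrib [symmetric] by simp
    then have "?c * ?c = of_real ((2 * pi) ^ CARD('n))"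
      by (metis of_real_mult)
    then show ?thesis
      by (metis mult.assoc mult.commute)
  qed
  finally show ?thesis .
qed

section \<open>Tempered distributions under integrals of exponentials\<close>

text \<open>The multipliers of the Schwartz space, usually denoted O_M: the growth exponent may
  depend on the order of differentiation.\<close>

definition slow_growth :: "(real^'n::finite \<Rightarrow> complex) \<Rightarrow> bool" where
  "slow_growth G \<longleftrightarrow> smooth_fun G \<and> (\<forall>N. \<exists>K e. 0 \<le> e \<and> growth_le N K G e)"

lemma slow_growth_smooth: "slow_growth G \<Longrightarrow> smooth_fun G"
  by (simp add: slow_growth_def)

lemma schwartz_mult_slow_growth: "f \<in> schwartz \<Longrightarrow> slow_growth G \<Longrightarrow> (\<lambda>x. f x * G x) \<in> schwartz"
  unfolding slow_growth_def by (rule schwartz_mult) auto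

lemma growth_le_mono:
  assumes "growth_le N K G e" "0 \<le> e" "K \<le> K'" "e \<le> e'"
  shows "growth_le N K' G e'"
  unfolding growth_le_def
proof (intro allI impI)
  fix "is" :: "'a list" and x :: "real^'a"
  assume "length is \<le> N"
  then have "norm (pderivs is G x) \<le> e * (1 + norm x) ^ K"
    using assms(1) by (simp add: growth_le_def)
  also have "\<dots> \<le> e' * (1 + norm x) ^ K'"
    using assms by (intro mult_mono power_increasing) auto
  finally show "norm (pderivs is G x) \<le> e' * (1 + norm x) ^ K'" .
qed

lemma growth_le_add:
  assumes "smooth_fun f" "smooth_fun g" "growth_le N K f d" "growth_le N K g e"
  shows "growth_le N K (\<lambda>x. f x + g x) (d + e)"
  using assms(3,4) unfolding growth_le_def pderivs_add [OF assms(1,2)]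
  by (auto simp: distrib_right intro!: norm_triangle_le add_mono)

lemma growth_le_cmult:
  assumes "smooth_fun f" "growth_le N K f d"
  shows "growth_le N K (\<lambda>x. c * f x) (norm c * d)"
  using assms(2) unfolding growth_le_def pderivs_cmult [OF assms(1)]
  by (auto simp: norm_mult mult.assoc intro!: mult_left_mono)

lemma slow_growth_add:
  assumes "slow_growth f" "slow_growth g"
  shows "slow_growth (\<lambda>x. f x + g x)"
  unfolding slow_growth_def
proof (intro conjI allI)
  show "smooth_fun (\<lambda>x. f x + g x)"
    using assms by (intro smooth_fun_add) (auto simp: slow_growth_def)
  fix N
  obtain K d K' e where *: "0 \<le> d" "growth_le N K f d" "0 \<le> e" "growth_le N K' g e"
    using assms unfolding slow_growth_def by meson
  have "growth_le N (max K K') (\<lambda>x. f x + g x) (d + e)"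
    using * assms by (intro growth_le_add slow_growth_smooth) (auto intro: growth_le_mono)
  then show "\<exists>K e. 0 \<le> e \<and> growth_le N K (\<lambda>x. f x + g x) e"
    using * by (meson add_nonneg_nonneg)
qed

lemma slow_growth_cmult: "slow_growth f \<Longrightarrow> slow_growth (\<lambda>x. c * f x)"
  unfolding slow_growth_def using smooth_fun_cmult growth_le_cmult [of f _ _ _ c] mult_nonneg_nonneg [OF norm_ge_zero [of c]]
  by fast

lemma slow_growth_diff: "slow_growth f \<Longrightarrow> slow_growth g \<Longrightarrow> slow_growth (\<lambda>x. f x - g x)"
  using slow_growth_add [OF _ slow_growth_cmult [of g "-1"], of f] by simp

lemma slow_growth_const: "slow_growth (\<lambda>x. c)"
  unfolding slow_growth_def growth_le_def pderivs_const
  by (auto simp: smooth_fun_const intro!: exI [of _ 0] exI [of _ "norm c"])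

lemma slow_growth_sum: "finite A \<Longrightarrow> (\<And>a. a \<in> A \<Longrightarrow> slow_growth (f a)) \<Longrightarrow> slow_growth (\<lambda>x. \<Sum>a\<in>A. f a x)"
  by (induction A rule: finite_induct) (auto intro: slow_growth_const slow_growth_add)

lemma slow_growth_cis: "slow_growth (\<lambda>\<xi>. cis (x \<bullet> \<xi>))"
  unfolding slow_growth_def
  by (intro conjI allI smooth_fun_cis exI, rule_tac [2] growth_le_cis) simp

lemma schwartz_slow_growth:
  assumes "f \<in> schwartz"
  shows "slow_growth f"
  unfolding slow_growth_def
proof (intro conjI allI)
  fix N
  obtain B where B: "schwartz_le N f B"
    using schwartz_le_exists [OF assms] by blast
  have "norm (pderivs is f x) \<le> B * (1 + norm x) ^ 0" if "length is \<le> N" for "is" x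
  proof -
    have "1 * norm (pderivs is f x) \<le> (1 + norm x) ^ N * norm (pderivs is f x)"
      by (intro mult_right_mono) auto
    with schwartz_leD [OF B that, of x] show ?thesis
      by simp
  qed
  then show "\<exists>K e. 0 \<le> e \<and> growth_le N K f e"
    using schwartz_le_nonneg [OF B] unfolding growth_le_def by blast
qed (rule schwartz_smooth [OF assms])

text \<open>The exponent \<open>1\<close> of the growth bound pays for the factor \<open>norm \<xi>\<close> in
  \<open>norm (cis (x \<bullet> \<xi>) - cis (y \<bullet> \<xi>)) \<le> norm (x - y) * norm \<xi>\<close>.\<close>

lemma tempered_mult_boundE:
  assumes "tempered T" "v \<in> schwartz"
  obtains C N where "0 \<le> C"
    "\<And>G e. slow_growth G \<Longrightarrow> growth_le N 1 G e \<Longrightarrow> 0 \<le> e \<Longrightarrow> norm (T (\<lambda>\<xi>. v \<xi> * G \<xi>)) \<le> C * e"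
proof -
  obtain C N where C: "0 \<le> C" "\<And>f B. f \<in> schwartz \<Longrightarrow> schwartz_le N f B \<Longrightarrow> norm (T f) \<le> C * B"
    using tempered_boundE [OF assms(1)] by blast
  obtain B where B: "schwartz_le (N + 1) v B"
    using schwartz_le_exists [OF assms(2)] by blast
  show ?thesis
  proof (rule that [of "C * (2 ^ N * B)" N])
    show "0 \<le> C * (2 ^ N * B)"
      using C(1) schwartz_le_nonneg [OF B] by simp
    fix G :: "real^'a \<Rightarrow> complex" and e :: real
    assume "slow_growth G" "growth_le N 1 G e" "0 \<le> e"
    then show "norm (T (\<lambda>\<xi>. v \<xi> * G \<xi>)) \<le> C * (2 ^ N * B) * e"
      using C(2) [OF schwartz_mult_slow_growth [OF assms(2)] schwartz_le_mult [OF schwartz_smooth [OF assms(2)] _ B]]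
      by (simp add: slow_growth_smooth mult.assoc)
  qed
qed

section \<open>Exponentials depending on a frequency parameter\<close>

lemma norm_cis_diff_le: "norm (cis a - cis b) \<le> \<bar>a - b\<bar>"
proof -
  have "cis a - cis b = cis b * (cis (a - b) - 1)"
    by (simp add: algebra_simps cis_mult)
  then show ?thesis
    using iexp_approx1 [of "a - b" 0] by (simp add: norm_mult cis_conv_exp)
qed

text \<open>A difference of products is split one factor at a time: either the leading coordinates
  differ or the remaining derivatives do. Each step adds one term of the same size, hence the factor
  \<open>length is + 1\<close>.\<close>

lemma pderivs_cis_diff:
  fixes x y \<xi> :: "real^'n::finite"
  assumes "1 + norm x \<le> R" "1 + norm y \<le> R"
  shows "norm (pderivs is (\<lambda>\<xi>. cis (x \<bullet> \<xi>)) \<xi> - pderivs is (\<lambda>\<xi>. cis (y \<bullet> \<xi>)) \<xi>)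
     \<le> real (length is + 1) * R ^ length is * norm (x - y) * (1 + norm \<xi>)"
proof (induction "is")
  case Nil
  have "norm (cis (x \<bullet> \<xi>) - cis (y \<bullet> \<xi>)) \<le> \<bar>(x - y) \<bullet> \<xi>\<bar>"
    using norm_cis_diff_le [of "x \<bullet> \<xi>" "y \<bullet> \<xi>"] by (simp add: inner_diff_left)
  also have "\<dots> \<le> norm (x - y) * norm \<xi>"
    by (rule Cauchy_Schwarz_ineq2)
  finally show ?case
    by (simp add: algebra_simps add_increasing)
next
  case (Cons i "is")
  let ?A = "\<lambda>x. pderivs is (\<lambda>\<xi>. cis (x \<bullet> \<xi>)) \<xi>"
  have R: "1 \<le> R"
    using assms norm_ge_zero [of x] by linarith
  have A: "pderivs (i # is) (\<lambda>\<xi>. cis (x \<bullet> \<xi>)) \<xi> = \<i> * of_real (x $ i) * ?A x" for x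
    by (simp add: pderivs_cis mult.assoc del: pderivs.simps)
  have nA: "norm (?A y) \<le> R ^ length is"
    using norm_prod_list_coord_le [of y "is"] power_mono [OF assms(2), of "length is"]
    by (simp add: pderivs_cis norm_mult)
  have "\<i> * of_real (x $ i) * ?A x - \<i> * of_real (y $ i) * ?A y
      = \<i> * of_real (x $ i) * (?A x - ?A y) + \<i> * of_real ((x - y) $ i) * ?A y"
    by (simp add: algebra_simps)
  then have "norm (\<i> * of_real (x $ i) * ?A x - \<i> * of_real (y $ i) * ?A y)
      \<le> \<bar>x $ i\<bar> * norm (?A x - ?A y) + \<bar>(x - y) $ i\<bar> * norm (?A y)"
    by (simp only:) (rule norm_triangle_le, simp add: norm_mult del: vector_minus_component)
  also have "\<dots> \<le> R * (real (length is + 1) * R ^ length is * norm (x - y) * (1 + norm \<xi>))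
      + norm (x - y) * R ^ length is"
    using component_le_norm_cart [of x i] component_le_norm_cart [of "x - y" i] assms R
    by (intro add_mono mult_mono Cons nA) auto
  also have "norm (x - y) * R ^ length is \<le> R ^ length (i # is) * norm (x - y) * (1 + norm \<xi>)"
  proof -
    have "R ^ length is * 1 \<le> R ^ length (i # is) * (1 + norm \<xi>)"
      using R by (intro mult_mono power_increasing) auto
    from mult_left_mono [OF this norm_ge_zero [of "x - y"]] show ?thesis
      by (simp add: mult_ac)
  qed
  finally show ?case
    unfolding A by (simp add: algebra_simps)
qed

lemma growth_le_cis_diff:
  fixes x y :: "real^'n::finite"
  shows "growth_le N 1 (\<lambda>\<xi>. cis (x \<bullet> \<xi>) - cis (y \<bullet> \<xi>)) (real (N + 1) * (1 + norm x + norm y) ^ N * norm (x - y))"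
  unfolding growth_le_def pderivs_diff [OF smooth_fun_cis smooth_fun_cis] power_one_right
proof (intro allI impI)
  fix "is" :: "'n list" and \<xi> :: "real^'n"
  let ?R = "1 + norm x + norm y"
  assume "length is \<le> N"
  then have "real (length is + 1) * ?R ^ length is * norm (x - y) * (1 + norm \<xi>)
     \<le> real (N + 1) * ?R ^ N * norm (x - y) * (1 + norm \<xi>)"
    by (intro mult_right_mono mult_mono power_increasing) auto
  then show "norm (pderivs is (\<lambda>\<xi>. cis (x \<bullet> \<xi>)) \<xi> - pderivs is (\<lambda>\<xi>. cis (y \<bullet> \<xi>)) \<xi>)
     \<le> real (N + 1) * ?R ^ N * norm (x - y) * (1 + norm \<xi>)"
    using pderivs_cis_diff [of x ?R y "is" \<xi>] by simp
qed

text \<open>Local Lipschitz continuity in the frequency. It provides the measurability of the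
  function that represents F^-1 a F u.\<close>

lemma tempered_cis_continuous:
  assumes "tempered T" "v \<in> schwartz"
  shows "continuous_on UNIV (\<lambda>x. T (\<lambda>\<xi>. v \<xi> * cis (x \<bullet> \<xi>)))"
proof -
  obtain C N where C: "0 \<le> C"
    "\<And>G e. slow_growth G \<Longrightarrow> growth_le N 1 G e \<Longrightarrow> 0 \<le> e \<Longrightarrow> norm (T (\<lambda>\<xi>. v \<xi> * G \<xi>)) \<le> C * e"
    using tempered_mult_boundE [OF assms] by blast
  let ?H = "\<lambda>x. T (\<lambda>\<xi>. v \<xi> * cis (x \<bullet> \<xi>))"
  have le: "norm (?H y - ?H x) \<le> C * (real (N + 1) * (1 + norm y + norm x) ^ N * norm (y - x))" for x y
  proof -
    have "?H y - ?H x = T (\<lambda>\<xi>. v \<xi> * (cis (y \<bullet> \<xi>) - cis (x \<bullet> \<xi>)))"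
      using tempered_diff [OF assms(1) schwartz_mult_cis [OF assms(2), of y] schwartz_mult_cis [OF assms(2), of x]]
      by (simp add: right_diff_distrib)
    then show ?thesis
      using C(2) [OF slow_growth_diff [OF slow_growth_cis slow_growth_cis] growth_le_cis_diff, of y x] by simp
  qed
  have "(?H \<longlongrightarrow> ?H x) (at x)" for x
  proof (rule LIM_zero_cancel, rule Lim_null_comparison)
    show "\<forall>\<^sub>F y in at x. norm (?H y - ?H x) \<le> C * (real (N + 1) * (1 + norm y + norm x) ^ N * norm (y - x))"
      using le by simp
    have "((\<lambda>y. C * (real (N + 1) * (1 + norm y + norm x) ^ N * norm (y - x)))
        \<longlongrightarrow> C * (real (N + 1) * (1 + norm x + norm x) ^ N * norm (x - x))) (at x)"
      by (intro tendsto_intros)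
    then show "((\<lambda>y. C * (real (N + 1) * (1 + norm y + norm x) ^ N * norm (y - x))) \<longlongrightarrow> 0) (at x)"
      by simp
  qed
  then show ?thesis
    by (auto simp: continuous_on_def intro: tendsto_within_subset)
qed

lemma tempered_cis_growthE:
  assumes "tempered T" "v \<in> schwartz"
  obtains C N where "0 \<le> C" "\<And>x. norm (T (\<lambda>\<xi>. v \<xi> * cis (x \<bullet> \<xi>))) \<le> C * (1 + norm x) ^ N"
proof -
  obtain C N where C: "0 \<le> C"
    "\<And>G e. slow_growth G \<Longrightarrow> growth_le N 1 G e \<Longrightarrow> 0 \<le> e \<Longrightarrow> norm (T (\<lambda>\<xi>. v \<xi> * G \<xi>)) \<le> C * e"
    using tempered_mult_boundE [OF assms] by blast
  have "norm (T (\<lambda>\<xi>. v \<xi> * cis (x \<bullet> \<xi>))) \<le> C * (1 + norm x) ^ N" for x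
    by (rule C(2) [OF slow_growth_cis growth_le_mono [OF growth_le_cis]]) auto
  with C(1) show ?thesis
    by (rule that)
qed

text \<open>Composition with \<open>q k\<close> leaves only finitely many frequencies, so linearity
  alone moves a distribution through the integral. The bound by \<open>2 * norm x\<close> makes the
  majorants independent of \<open>k\<close>.\<close>

lemma simple_approx_identity:
  obtains q :: "nat \<Rightarrow> real^'n::finite \<Rightarrow> real^'n" where
    "\<And>k. simple_function lebesgue (q k)" "\<And>x. (\<lambda>k. q k x) \<longlonglongrightarrow> x" "\<And>k x. norm (q k x) \<le> 2 * norm x"
proof -
  have "(\<lambda>x::real^'n. x) \<in> borel_measurable lebesgue"
    by (intro continuous_lebesgue_measurable continuous_intros)
  from borel_measurable_implies_sequence_metric [OF this, of 0] show ?thesis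
    using that by auto
qed

lemma space_lebesgue_UNIV: "space (lebesgue :: 'a::euclidean_space measure) = UNIV"
  by simp

text \<open>The integrand splits over the finitely many level sets of \<open>q\<close>; the
  coefficients are the integrals of \<phi> over them.\<close>

lemma integral_simple_compose:
  fixes \<phi> :: "'a \<Rightarrow> 'b::{real_normed_field,banach,second_countable_topology}"
  assumes q: "simple_function M q" and \<phi>: "integrable M \<phi>" and sp: "space M = UNIV"
  shows "integrable M (\<lambda>x. \<phi> x * H (q x))"
    and "(LINT x|M. \<phi> x * H (q x)) = (\<Sum>z\<in>range q. (LINT x|M. indicator (q -` {z}) x *\<^sub>R \<phi> x) * H z)"
proof -
  have fin: "finite (range q)" and m: "q -` {z} \<in> sets M" for z
    using simple_functionD [OF q] sp by auto
  have eq: "\<phi> x * H (q x) = (\<Sum>z\<in>range q. (indicator (q -` {z}) x *\<^sub>R \<phi> x) * H z)" for x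
  proof -
    have "(\<Sum>z\<in>range q. (indicator (q -` {z}) x *\<^sub>R \<phi> x) * H z) = (\<Sum>z\<in>{q x}. (indicator (q -` {z}) x *\<^sub>R \<phi> x) * H z)"
      by (rule sum.mono_neutral_right) (use fin in \<open>auto simp: indicator_def\<close>)
    then show ?thesis
      by simp
  qed
  have i: "integrable M (\<lambda>x. indicator (q -` {z}) x *\<^sub>R \<phi> x)" for z
    using m \<phi> by (rule integrable_mult_indicator)
  show "integrable M (\<lambda>x. \<phi> x * H (q x))"
    unfolding eq by (intro Bochner_Integration.integrable_sum integrable_mult_left i)
  show "(LINT x|M. \<phi> x * H (q x)) = (\<Sum>z\<in>range q. (LINT x|M. indicator (q -` {z}) x *\<^sub>R \<phi> x) * H z)"
    unfolding eq
    by (simp only: Bochner_Integration.integral_sum [OF integrable_mult_left [OF i]] integral_mult_left_zero)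
qed

lemma pderivs_cft:
  "f \<in> schwartz \<Longrightarrow> pderivs is (cft f) = (\<lambda>\<xi>. LINT x|lebesgue. f x * pderivs is (\<lambda>\<xi>. cis (x \<bullet> \<xi>)) \<xi>)"
proof (induction "is" arbitrary: f rule: rev_induct)
  case Nil
  then show ?case
    by (simp add: cft_def)
next
  case (snoc i "is")
  then show ?case
    by (simp add: pderivs_append [of "is" "[i]" "cft f"] pderivs_cft_single schwartz_mult_icoord pderivs_cis
      mult_ac del: pderivs.simps)
qed

lemma continuous_prod_list_coord:
  "continuous_on S (\<lambda>x::real^'n::finite. \<Prod>i\<leftarrow>is. \<i> * complex_of_real (x $ i))"
  by (induction "is") (auto intro!: continuous_intros)

lemma norm_one_plus_power_le:
  fixes x y :: "'a::real_normed_vector"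
  assumes "norm y \<le> 2 * norm x"
  shows "(1 + norm x + norm y) ^ N * norm (x - y) \<le> 3 ^ (N + 1) * (1 + norm x) ^ (N + 1)"
proof -
  have "1 + norm x + norm y \<le> 3 * (1 + norm x)"
    using assms by simp
  moreover have "norm (x - y) \<le> 3 * (1 + norm x)"
    using norm_triangle_ineq4 [of x y] assms by simp
  ultimately have "(1 + norm x + norm y) ^ N * norm (x - y) \<le> (3 * (1 + norm x)) ^ N * (3 * (1 + norm x))"
    by (intro mult_mono power_mono) auto
  then show ?thesis
    by (simp only: power_mult_distrib power_add power_one_right mult_ac)
qed

text \<open>The pairing of \<open>T\<close> with \<open>v\<close> times an exponential is continuous
  and polynomially bounded in the frequency, and doubling the frequency changes that bound only by a
  constant. Rapid decay of \<phi> then gives the majorant.\<close>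

lemma tempered_simple_limit:
  fixes v \<phi> :: "real^'n::finite \<Rightarrow> complex" and q :: "nat \<Rightarrow> real^'n \<Rightarrow> real^'n"
  assumes T: "tempered T" and v: "v \<in> schwartz" and \<phi>: "\<phi> \<in> schwartz"
    and q: "\<And>k. simple_function lebesgue (q k)" "\<And>x. (\<lambda>k. q k x) \<longlonglongrightarrow> x" "\<And>k x. norm (q k x) \<le> 2 * norm x"
  shows "integrable lebesgue (\<lambda>x. \<phi> x * T (\<lambda>\<xi>. v \<xi> * cis (x \<bullet> \<xi>)))"
    and "(\<lambda>k. LINT x|lebesgue. \<phi> x * T (\<lambda>\<xi>. v \<xi> * cis (q k x \<bullet> \<xi>)))
      \<longlonglongrightarrow> (LINT x|lebesgue. \<phi> x * T (\<lambda>\<xi>. v \<xi> * cis (x \<bullet> \<xi>)))"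
proof -
  let ?H = "\<lambda>x. T (\<lambda>\<xi>. v \<xi> * cis (x \<bullet> \<xi>))"
  note sc = integral_simple_compose [OF q(1) schwartz_integrable [OF \<phi>] space_lebesgue_UNIV]
  obtain C' N' where C': "0 \<le> C'" "\<And>x. norm (?H x) \<le> C' * (1 + norm x) ^ N'"
    using tempered_cis_growthE [OF T v] by blast
  have H_cont: "continuous_on UNIV ?H"
    by (rule tempered_cis_continuous [OF T v])
  have mom: "integrable lebesgue (\<lambda>x. (1 + norm x) ^ k * norm (\<phi> x))" for k
    by (rule schwartz_moment_integrable [OF \<phi>])
  have H2: "norm (?H y) \<le> C' * 2 ^ N' * (1 + norm x) ^ N'" if "norm y \<le> 2 * norm x" for x y
  proof -
    have "(1 + norm y) ^ N' \<le> (2 * (1 + norm x)) ^ N'"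
      using that by (intro power_mono) auto
    from mult_left_mono [OF this C'(1)] C'(2) [of y] show ?thesis
      unfolding power_mult_distrib mult.assoc by linarith
  qed
  have bnd: "norm (\<phi> x * ?H y) \<le> C' * 2 ^ N' * ((1 + norm x) ^ N' * norm (\<phi> x))" if "norm y \<le> 2 * norm x" for x y
    using mult_left_mono [OF H2 [OF that] norm_ge_zero [of "\<phi> x"]] by (simp add: norm_mult mult_ac)
  have H_meas: "(\<lambda>x. \<phi> x * ?H x) \<in> borel_measurable lebesgue"
    by (intro continuous_lebesgue_measurable continuous_intros H_cont schwartz_continuous \<phi>)
  show "(\<lambda>k. LINT x|lebesgue. \<phi> x * ?H (q k x)) \<longlonglongrightarrow> (LINT x|lebesgue. \<phi> x * ?H x)"
  proof (rule integral_dominated_convergence [OF H_meas])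
    show "integrable lebesgue (\<lambda>x. C' * 2 ^ N' * ((1 + norm x) ^ N' * norm (\<phi> x)))"
      by (intro integrable_mult_right mom)
    show "AE x in lebesgue. (\<lambda>k. \<phi> x * ?H (q k x)) \<longlonglongrightarrow> \<phi> x * ?H x"
      by (intro AE_I2 tendsto_intros continuous_on_tendsto_compose [OF H_cont q(2)]) auto
    show "AE x in lebesgue. norm (\<phi> x * ?H (q k x)) \<le> C' * 2 ^ N' * ((1 + norm x) ^ N' * norm (\<phi> x))" for k
      by (intro AE_I2 bnd q)
    show "(\<lambda>x. \<phi> x * ?H (q k x)) \<in> borel_measurable lebesgue" for k
      by (rule borel_measurable_integrable [OF sc(1)])
  qed
  show "integrable lebesgue (\<lambda>x. \<phi> x * ?H x)"
    by (rule Bochner_Integration.integrable_bound [OF integrable_mult_right [OF mom, of "C' * 2 ^ N'" N'] H_meas])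
       (use bnd C' in \<open>auto simp: abs_mult\<close>)
qed

text \<open>The Riemann-type sums \<open>\<integral> \<phi> x * cis (q k x \<bullet> \<xi>) dx\<close> over a simple approximation \<open>q\<close> of the
  identity converge to \<open>cft \<phi>\<close> in every Schwartz seminorm once multiplied by \<open>v\<close>.\<close>

lemma tempered_integral_exchange:
  fixes v \<phi> :: "real^'n::finite \<Rightarrow> complex"
  assumes T: "tempered T" and v: "v \<in> schwartz" and \<phi>: "\<phi> \<in> schwartz"
  shows "integrable lebesgue (\<lambda>x. \<phi> x * T (\<lambda>\<xi>. v \<xi> * cis (x \<bullet> \<xi>)))"
    and "T (\<lambda>\<xi>. v \<xi> * cft \<phi> \<xi>) = (LINT x|lebesgue. \<phi> x * T (\<lambda>\<xi>. v \<xi> * cis (x \<bullet> \<xi>)))"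
proof -
  let ?H = "\<lambda>x. T (\<lambda>\<xi>. v \<xi> * cis (x \<bullet> \<xi>))"
  obtain q :: "nat \<Rightarrow> real^'n \<Rightarrow> real^'n" where q: "\<And>k. simple_function lebesgue (q k)"
      "\<And>x. (\<lambda>k. q k x) \<longlonglongrightarrow> x" "\<And>k x. norm (q k x) \<le> 2 * norm x"
    using simple_approx_identity by blast
  have q_meas: "q k \<in> borel_measurable lebesgue" for k
    by (rule borel_measurable_simple_function [OF q(1)])
  have q_fin: "finite (range (q k))" for k
    using simple_functionD(1) [OF q(1), of k] by simp
  note \<phi>i = schwartz_integrable [OF \<phi>]
  note sc = integral_simple_compose [OF q(1) \<phi>i space_lebesgue_UNIV]
  define c where "c = (\<lambda>k z. LINT x|lebesgue. indicator (q k -` {z}) x *\<^sub>R \<phi> x)"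
  obtain C N where C: "0 \<le> C"
    "\<And>G e. slow_growth G \<Longrightarrow> growth_le N 1 G e \<Longrightarrow> 0 \<le> e \<Longrightarrow> norm (T (\<lambda>\<xi>. v \<xi> * G \<xi>)) \<le> C * e"
    using tempered_mult_boundE [OF T v] by blast
  have mom: "integrable lebesgue (\<lambda>x. (1 + norm x) ^ k * norm (\<phi> x))" for k
    by (rule schwartz_moment_integrable [OF \<phi>])
  note lim1 = tempered_simple_limit(2) [OF T v \<phi> q]
  show "integrable lebesgue (\<lambda>x. \<phi> x * ?H x)"
    by (rule tempered_simple_limit(1) [OF T v \<phi> q])
  \<comment> \<open>The error of the discretised transform; \<open>T\<close> applied to
    \<open>v\<close> times this error is the difference between the exact value and the discretised
    integral.\<close>
  define D where "D = (\<lambda>k \<xi>. cft \<phi> \<xi> - (\<Sum>z\<in>range (q k). c k z * cis (z \<bullet> \<xi>)))"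
  have sl: "slow_growth (\<lambda>\<xi>. \<Sum>z\<in>range (q k). c k z * cis (z \<bullet> \<xi>))" for k
    by (intro slow_growth_sum q_fin slow_growth_cmult slow_growth_cis)
  have D_slow: "slow_growth (D k)" for k
    unfolding D_def by (intro slow_growth_diff sl schwartz_slow_growth schwartz_cft \<phi>)
  have D_T: "T (\<lambda>\<xi>. v \<xi> * cft \<phi> \<xi>) - (LINT x|lebesgue. \<phi> x * ?H (q k x)) = T (\<lambda>\<xi>. v \<xi> * D k \<xi>)" for k
  proof -
    have "(LINT x|lebesgue. \<phi> x * ?H (q k x)) = (\<Sum>z\<in>range (q k). c k z * ?H z)"
      unfolding c_def by (rule sc(2))
    also have "\<dots> = T (\<lambda>\<xi>. \<Sum>z\<in>range (q k). c k z * (v \<xi> * cis (z \<bullet> \<xi>)))"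
      by (subst tempered_sum [OF T q_fin])
         (simp_all add: tempered_cmult [OF T] schwartz_cmult schwartz_mult_cis v)
    also have "(\<lambda>\<xi>. \<Sum>z\<in>range (q k). c k z * (v \<xi> * cis (z \<bullet> \<xi>))) = (\<lambda>\<xi>. v \<xi> * (\<Sum>z\<in>range (q k). c k z * cis (z \<bullet> \<xi>)))"
      by (simp add: sum_distrib_left mult_ac)
    finally show ?thesis
      unfolding D_def right_diff_distrib
      by (simp add: tempered_diff [OF T] schwartz_mult_slow_growth [OF v] sl schwartz_slow_growth schwartz_cft \<phi>)
  qed
  \<comment> \<open>A growth constant for \<open>D k\<close>: the Lipschitz bounds for the
    exponentials with frequencies \<open>x\<close> and \<open>q k x\<close>, integrated against
    |\<phi>|. It tends to 0 because \<open>x - q k x\<close> does.\<close>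
  define e where "e = (\<lambda>k. LINT x|lebesgue. norm (\<phi> x) * (real (N + 1) * (1 + norm x + norm (q k x)) ^ N * norm (x - q k x)))"
  have e_bnd: "norm (norm (\<phi> x) * (real (N + 1) * (1 + norm x + norm (q k x)) ^ N * norm (x - q k x)))
      \<le> real (N + 1) * 3 ^ (N + 1) * ((1 + norm x) ^ (N + 1) * norm (\<phi> x))" for x k
    using mult_left_mono [OF norm_one_plus_power_le [OF q(3) [of k x], of N], of "real (N + 1) * norm (\<phi> x)"]
    by (simp add: mult_ac abs_mult)
  have e_meas: "(\<lambda>x. norm (\<phi> x) * (real (N + 1) * (1 + norm x + norm (q k x)) ^ N * norm (x - q k x))) \<in> borel_measurable lebesgue" for k
  proof -
    note [measurable] = q_meas [of k] schwartz_measurable [OF \<phi>]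
    have [measurable]: "(\<lambda>x::real^'n. x) \<in> borel_measurable lebesgue"
      by (intro continuous_lebesgue_measurable continuous_intros)
    show ?thesis
      by measurable
  qed
  have e_int: "integrable lebesgue (\<lambda>x. norm (\<phi> x) * (real (N + 1) * (1 + norm x + norm (q k x)) ^ N * norm (x - q k x)))" for k
    by (rule Bochner_Integration.integrable_bound [OF integrable_mult_right [OF mom, of "real (N + 1) * 3 ^ (N + 1)" "N + 1"] e_meas])
       (use e_bnd order_trans abs_ge_self in \<open>fastforce intro!: AE_I2\<close>)
  have "e \<longlonglongrightarrow> (LINT x|lebesgue. norm (\<phi> x) * (real (N + 1) * (1 + norm x + norm x) ^ N * norm (x - x)))"
    unfolding e_def
  proof (rule integral_dominated_convergence)
    show "integrable lebesgue (\<lambda>x. real (N + 1) * 3 ^ (N + 1) * ((1 + norm x) ^ (N + 1) * norm (\<phi> x)))"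
      by (intro integrable_mult_right mom)
    show "AE x in lebesgue. (\<lambda>k. norm (\<phi> x) * (real (N + 1) * (1 + norm x + norm (q k x)) ^ N * norm (x - q k x)))
        \<longlonglongrightarrow> norm (\<phi> x) * (real (N + 1) * (1 + norm x + norm x) ^ N * norm (x - x))"
      by (intro AE_I2 tendsto_intros q)
  qed (use e_meas e_bnd in auto)
  then have e0: "e \<longlonglongrightarrow> 0"
    by simp
  have e_nn: "0 \<le> e k" for k
    unfolding e_def by (intro Bochner_Integration.integral_nonneg) simp
  have D_grow: "growth_le N 1 (D k) (e k)" for k
    unfolding growth_le_def
  proof (intro allI impI)
    fix "is" :: "'n list" and \<xi> :: "real^'n"
    assume len: "length is \<le> N"
    let ?A = "\<lambda>x. pderivs is (\<lambda>\<xi>. cis (x \<bullet> \<xi>)) \<xi>"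
    have "pderivs is (\<lambda>\<xi>. \<Sum>z\<in>range (q k). c k z * cis (z \<bullet> \<xi>)) \<xi> = (\<Sum>z\<in>range (q k). c k z * ?A z)"
      using pderivs_sum [OF q_fin [of k], of "\<lambda>z \<xi>. c k z * cis (z \<bullet> \<xi>)" "is"]
      by (simp add: smooth_fun_cmult smooth_fun_cis pderivs_cmult [OF smooth_fun_cis])
    then have "pderivs is (D k) \<xi> = pderivs is (cft \<phi>) \<xi> - (\<Sum>z\<in>range (q k). c k z * ?A z)"
      unfolding D_def
      by (simp add: pderivs_diff [OF smooth_cft [OF \<phi>] slow_growth_smooth [OF sl]])
    also have "(\<Sum>z\<in>range (q k). c k z * ?A z) = (LINT x|lebesgue. \<phi> x * ?A (q k x))"
      unfolding c_def by (rule sc(2) [symmetric])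
    also have "pderivs is (cft \<phi>) \<xi> = (LINT x|lebesgue. \<phi> x * ?A x)"
      by (simp add: pderivs_cft [OF \<phi>])
    also have "(LINT x|lebesgue. \<phi> x * ?A x) - (LINT x|lebesgue. \<phi> x * ?A (q k x))
        = (LINT x|lebesgue. \<phi> x * ?A x - \<phi> x * ?A (q k x))"
    proof (rule Bochner_Integration.integral_diff [symmetric])
      show "integrable lebesgue (\<lambda>x. \<phi> x * ?A x)"
      proof (rule Bochner_Integration.integrable_bound [OF mom [of "length is"]])
        show "(\<lambda>x. \<phi> x * ?A x) \<in> borel_measurable lebesgue"
          unfolding pderivs_cis
          by (intro continuous_lebesgue_measurable continuous_intros schwartz_continuous \<phi> continuous_prod_list_coord)
        show "AE x in lebesgue. norm (\<phi> x * ?A x) \<le> norm ((1 + norm x) ^ length is * norm (\<phi> x))"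
          using mult_left_mono [OF norm_prod_list_coord_le norm_ge_zero]
          by (auto simp: pderivs_cis norm_mult mult.commute)
      qed
    qed (rule sc)
    also have "norm \<dots> \<le> (LINT x|lebesgue. (norm (\<phi> x) * (real (N + 1) * (1 + norm x + norm (q k x)) ^ N * norm (x - q k x))) * (1 + norm \<xi>))"
    proof (rule order_trans [OF integral_norm_bound], rule integral_mono')
      show "integrable lebesgue (\<lambda>x. (norm (\<phi> x) * (real (N + 1) * (1 + norm x + norm (q k x)) ^ N * norm (x - q k x))) * (1 + norm \<xi>))"
        by (intro integrable_mult_left e_int)
      fix x
      have "norm (?A x - ?A (q k x)) \<le> real (N + 1) * (1 + norm x + norm (q k x)) ^ N * norm (x - q k x) * (1 + norm \<xi>)"
        using growth_le_cis_diff [of N x "q k x"] len unfolding growth_le_def pderivs_diff [OF smooth_fun_cis smooth_fun_cis]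
        by (metis power_one_right)
      from mult_left_mono [OF this norm_ge_zero [of "\<phi> x"]]
      show "norm (\<phi> x * ?A x - \<phi> x * ?A (q k x)) \<le> (norm (\<phi> x) * (real (N + 1) * (1 + norm x + norm (q k x)) ^ N * norm (x - q k x))) * (1 + norm \<xi>)"
        by (simp add: right_diff_distrib [symmetric] norm_mult mult.assoc)
    qed auto
    also have "\<dots> = e k * (1 + norm \<xi>)"
      by (simp add: e_def)
    finally show "norm (pderivs is (D k) \<xi>) \<le> e k * (1 + norm \<xi>) ^ 1"
      by simp
  qed
  have "(\<lambda>k. T (\<lambda>\<xi>. v \<xi> * cft \<phi> \<xi>) - (LINT x|lebesgue. \<phi> x * ?H (q k x))) \<longlonglongrightarrow> 0"
    unfolding D_T
  proof (rule Lim_null_comparison)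
    show "\<forall>\<^sub>F k in sequentially. norm (T (\<lambda>\<xi>. v \<xi> * D k \<xi>)) \<le> C * e k"
      by (intro always_eventually allI C(2) D_slow D_grow e_nn)
    show "(\<lambda>k. C * e k) \<longlonglongrightarrow> 0"
      using tendsto_mult_left [OF e0, of C] by simp
  qed
  moreover have "(\<lambda>k. T (\<lambda>\<xi>. v \<xi> * cft \<phi> \<xi>) - (LINT x|lebesgue. \<phi> x * ?H (q k x)))
      \<longlonglongrightarrow> T (\<lambda>\<xi>. v \<xi> * cft \<phi> \<xi>) - (LINT x|lebesgue. \<phi> x * ?H x)"
    by (intro tendsto_intros lim1)
  ultimately show "T (\<lambda>\<xi>. v \<xi> * cft \<phi> \<xi>) = (LINT x|lebesgue. \<phi> x * ?H x)"
    using LIMSEQ_unique by fastforce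
qed

section \<open>The multiplier operator as a function\<close>

lemma schwartz_fourier: "u \<in> schwartz \<Longrightarrow> fourier u \<in> schwartz"
  using schwartz_affine [OF schwartz_cft, of u "-1" 0] by (simp add: fourier_eq_cft)

text \<open>Testing against \<phi> and pulling \<open>T\<close> through the integral exhibits F^-1 T
  F u as an explicit function, so the choice made by \<open>multiplier_op\<close> is from a nonempty
  class.\<close>

lemma represents_multiplier:
  fixes u :: "real^'n::finite \<Rightarrow> complex"
  assumes "tempered T" "u \<in> schwartz"
  shows "represents (dist_ifourier (dist_mult T (fourier u)))
    (\<lambda>x. of_real (1 / (2 * pi) ^ CARD('n)) * T (\<lambda>\<xi>. fourier u \<xi> * cis (x \<bullet> \<xi>)))"
  unfolding represents_def
proof (intro conjI ballI)
  let ?c = "complex_of_real (1 / (2 * pi) ^ CARD('n))"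
  note Fu = schwartz_fourier [OF assms(2)]
  show "(\<lambda>x. ?c * T (\<lambda>\<xi>. fourier u \<xi> * cis (x \<bullet> \<xi>))) \<in> borel_measurable lebesgue"
    by (intro continuous_lebesgue_measurable continuous_intros tempered_cis_continuous assms Fu)
  fix \<phi> :: "real^'n \<Rightarrow> complex"
  assume \<phi>: "\<phi> \<in> schwartz"
  have eq: "?c * T (\<lambda>\<xi>. fourier u \<xi> * cis (x \<bullet> \<xi>)) * \<phi> x = ?c * (\<phi> x * T (\<lambda>\<xi>. fourier u \<xi> * cis (x \<bullet> \<xi>)))" for x
    by (simp add: mult_ac)
  show "integrable lebesgue (\<lambda>x. ?c * T (\<lambda>\<xi>. fourier u \<xi> * cis (x \<bullet> \<xi>)) * \<phi> x)"
    unfolding eq by (intro integrable_mult_right tempered_integral_exchange assms Fu \<phi>)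
  have "dist_ifourier (dist_mult T (fourier u)) \<phi> = T (\<lambda>\<xi>. ?c * (fourier u \<xi> * cft \<phi> \<xi>))"
    by (simp add: dist_ifourier_def dist_mult_def ifourier_eq_cft mult_ac)
  also have "\<dots> = ?c * (LINT x|lebesgue. \<phi> x * T (\<lambda>\<xi>. fourier u \<xi> * cis (x \<bullet> \<xi>)))"
    by (subst tempered_cmult [OF assms(1)])
       (auto intro: schwartz_mult_slow_growth schwartz_slow_growth schwartz_cft Fu \<phi>
        simp: tempered_integral_exchange [OF assms(1) Fu \<phi>])
  finally show "dist_ifourier (dist_mult T (fourier u)) \<phi> =
      (LINT x|lebesgue. ?c * T (\<lambda>\<xi>. fourier u \<xi> * cis (x \<bullet> \<xi>)) * \<phi> x)"
    unfolding eq by (simp only: integral_mult_right_zero)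
qed

section \<open>Density of Schwartz functions and uniqueness of representing functions\<close>

lemma sigma_finite_measure_lebesgue: "sigma_finite_measure (lebesgue :: 'a::euclidean_space measure)"
proof
  show "\<exists>A. countable A \<and> A \<subseteq> sets lebesgue \<and> \<Union>A = space lebesgue \<and>
    (\<forall>a\<in>A. emeasure (lebesgue :: 'a measure) a \<noteq> \<infinity>)"
  proof (intro exI [of _ "range (\<lambda>k::nat. cball 0 (real k))"] conjI ballI)
    show "\<Union>(range (\<lambda>k::nat. cball (0::'a) (real k))) = space lebesgue"
      by (auto simp: real_arch_simple)
    show "emeasure (lebesgue :: 'a measure) a \<noteq> \<infinity>" if "a \<in> range (\<lambda>k::nat. cball 0 (real k))" for a
      using that lmeasurable_cball [of "0::'a"] by (auto simp: fmeasurable_def less_top)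
  qed auto
qed

lemma plateau_at:
  fixes x :: "real^'n::finite"
  assumes "0 < s" "s < t"
  obtains \<theta> where "\<theta> \<in> schwartz" "\<And>y. dist y x \<le> s \<Longrightarrow> \<theta> y = 1" "\<And>y. t \<le> dist y x \<Longrightarrow> \<theta> y = 0"
    "\<And>y. \<exists>r\<in>{0..1}. \<theta> y = complex_of_real r"
proof -
  obtain \<theta> :: "real^'n \<Rightarrow> complex" where \<theta>: "smooth_fun \<theta>"
    "\<And>x. norm x \<le> s \<Longrightarrow> \<theta> x = 1" "\<And>x. norm x \<ge> t \<Longrightarrow> \<theta> x = 0" "\<And>x. \<exists>r\<in>{0..1}. \<theta> x = of_real r"
    using exists_plateau [OF assms] by blast
  have "\<theta> \<in> schwartz"
    by (rule compact_support_schwartz [OF \<theta>(1,3)])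
  from schwartz_affine [OF this, of 1 "-x"] show ?thesis
    by (intro that [of "\<lambda>y. \<theta> (y - x)"]) (use \<theta> in \<open>auto simp: dist_norm\<close>)
qed

text \<open>Finitely many balls of half the admissible radius cover \<open>K\<close>. Plateaus are
  joined by 1 - (1 - \<phi>)(1 - \<theta>), which stays in [0, 1] and equals 1 wherever one of the
  two does.\<close>

lemma smooth_urysohn:
  fixes K U :: "(real^'n::finite) set"
  assumes "compact K" "open U" "K \<subseteq> U"
  obtains \<phi> where "\<phi> \<in> schwartz" "\<And>x. x \<in> K \<Longrightarrow> \<phi> x = 1" "\<And>x. x \<notin> U \<Longrightarrow> \<phi> x = 0"
    "\<And>x. \<exists>r\<in>{0..1}. \<phi> x = complex_of_real r"
proof -
  have "\<forall>x\<in>K. \<exists>e>0. ball x e \<subseteq> U"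
    using assms by (meson open_contains_ball subsetD)
  then obtain e where e: "\<And>x. x \<in> K \<Longrightarrow> 0 < e x" "\<And>x. x \<in> K \<Longrightarrow> ball x (e x) \<subseteq> U"
    by metis
  obtain F where F: "F \<subseteq> K" "finite F" "K \<subseteq> (\<Union>x\<in>F. ball x (e x / 2))"
    by (rule compactE_image [OF assms(1), of K "\<lambda>x. ball x (e x / 2)"]) (use e in auto)
  have "\<exists>\<phi>\<in>schwartz. (\<forall>x\<in>(\<Union>x\<in>F. ball x (e x / 2)). \<phi> x = 1) \<and> (\<forall>x. x \<notin> U \<longrightarrow> \<phi> x = 0) \<and>
      (\<forall>x. \<exists>r\<in>{0..1}. \<phi> x = complex_of_real r)"
    using F(2,1)
  proof (induction F rule: finite_induct)
    case empty
    then show ?case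
      by (intro bexI [of _ "\<lambda>x. 0"]) (auto simp: schwartz_zero)
  next
    case (insert z F)
    then have "F \<subseteq> K"
      by simp
    from insert.IH [OF this]
    obtain \<phi> where \<phi>: "\<phi> \<in> schwartz" "\<And>x. x \<in> (\<Union>x\<in>F. ball x (e x / 2)) \<Longrightarrow> \<phi> x = 1"
      "\<And>x. x \<notin> U \<Longrightarrow> \<phi> x = 0" "\<And>x. \<exists>r\<in>{0..1}. \<phi> x = complex_of_real r"
      by blast
    have z: "z \<in> K"
      using insert by auto
    obtain \<theta> where \<theta>: "\<theta> \<in> schwartz" "\<And>y. dist y z \<le> e z / 2 \<Longrightarrow> \<theta> y = 1" "\<And>y. e z \<le> dist y z \<Longrightarrow> \<theta> y = 0"
      "\<And>y. \<exists>r\<in>{0..1}. \<theta> y = complex_of_real r"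
      using plateau_at [of "e z / 2" "e z" z] e(1) [OF z] by (metis half_gt_zero field_sum_of_halves less_add_same_cancel1)
    let ?\<psi> = "\<lambda>x. \<phi> x + \<theta> x - \<phi> x * \<theta> x"
    show ?case
    proof (intro bexI [of _ ?\<psi>] conjI allI ballI impI)
      show "?\<psi> \<in> schwartz"
        by (intro schwartz_diff schwartz_add schwartz_mult_slow_growth schwartz_slow_growth \<phi> \<theta>)
      show "?\<psi> x = 1" if "x \<in> (\<Union>x\<in>insert z F. ball x (e x / 2))" for x
      proof -
        from that have "x \<in> ball z (e z / 2) \<or> x \<in> (\<Union>x\<in>F. ball x (e x / 2))"
          by blast
        then have "\<theta> x = 1 \<or> \<phi> x = 1"
          using \<phi>(2) [of x] \<theta>(2) [of x] by (elim disjE) (simp_all add: dist_commute)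
        then show ?thesis
          by auto
      qed
      show "?\<psi> x = 0" if "x \<notin> U" for x
      proof -
        have "e z \<le> dist x z"
          using that e(2) [OF z] by (metis dist_commute mem_ball not_le subsetD)
        then show ?thesis
          using that by (simp add: \<phi>(3) \<theta>(3))
      qed
      show "\<exists>r\<in>{0..1}. ?\<psi> x = complex_of_real r" for x
      proof -
        obtain r s where rs: "r \<in> {0..1}" "s \<in> {0..1}" "\<phi> x = complex_of_real r" "\<theta> x = complex_of_real s"
          using \<phi>(4) [of x] \<theta>(4) [of x] by auto
        have "r + s - r * s = 1 - (1 - r) * (1 - s)"
          by (simp add: algebra_simps)
        moreover have "0 \<le> (1 - r) * (1 - s)" "(1 - r) * (1 - s) \<le> 1 * 1"
          using rs by (simp, intro mult_mono) auto
        ultimately have "r + s - r * s \<in> {0..1}"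
          by simp
        then show ?thesis
          by (rule bexI [rotated]) (simp add: rs(3,4))
      qed
    qed
  qed
  then obtain \<phi> where \<phi>: "\<phi> \<in> schwartz" "\<forall>x\<in>(\<Union>x\<in>F. ball x (e x / 2)). \<phi> x = 1"
    "\<forall>x. x \<notin> U \<longrightarrow> \<phi> x = 0" "\<forall>x. \<exists>r\<in>{0..1}. \<phi> x = complex_of_real r"
    by (elim bexE conjE)
  show ?thesis
  proof (rule that [OF \<phi>(1)])
    show "\<phi> x = 1" if "x \<in> K" for x
      using \<phi>(2) F(3) that by blast
    show "\<phi> x = 0" if "x \<notin> U" for x
      using \<phi>(3) that by blast
    show "\<exists>r\<in>{0..1}. \<phi> x = complex_of_real r" for x
      using \<phi>(4) by blast
  qed
qed

text \<open>Smooth cut-offs supported in shrinking neighbourhoods tend to the indicator of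
  \<open>K\<close>. Integrability of \<open>g\<close> is known only against Schwartz functions, so
  the majorant is \<open>g\<close> times one plateau that equals 1 on all these
  neighbourhoods.\<close>

lemma set_integral_null_compact:
  fixes g :: "real^'n::finite \<Rightarrow> complex"
  assumes g: "\<And>\<phi>. \<phi> \<in> schwartz \<Longrightarrow> integrable lebesgue (\<lambda>x. g x * \<phi> x)"
    "\<And>\<phi>. \<phi> \<in> schwartz \<Longrightarrow> (LINT x|lebesgue. g x * \<phi> x) = 0"
    and meas: "g \<in> borel_measurable lebesgue" and K: "compact K"
  shows "integrable lebesgue (\<lambda>x. indicator K x *\<^sub>R g x)" "(LINT x|lebesgue. indicator K x *\<^sub>R g x) = 0"
proof -
  obtain R where R: "0 < R" "K \<subseteq> ball 0 R"
    using compact_imp_bounded [OF K] bounded_subset_ballD [of K 0] by auto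
  obtain \<phi>0 where \<phi>0: "\<phi>0 \<in> schwartz" "\<And>y. dist y (0::real^'n) \<le> R \<Longrightarrow> \<phi>0 y = 1"
    by (rule plateau_at [of R "2 * R" "0::real^'n"]) (use R in auto)
  define V where "V = (\<lambda>k. ball 0 R \<inter> (\<Union>y\<in>K. ball y (1 / real (Suc k))))"
  have "\<exists>\<phi>. \<phi> \<in> schwartz \<and> (\<forall>x\<in>K. \<phi> x = 1) \<and> (\<forall>x. x \<notin> V k \<longrightarrow> \<phi> x = 0) \<and>
      (\<forall>x. \<exists>r\<in>{0..1}. \<phi> x = complex_of_real r)" for k
  proof -
    have "open (V k)" "K \<subseteq> V k"
      using R by (auto simp: V_def)
    then show ?thesis
      using smooth_urysohn [OF K] by metis
  qed
  then obtain \<phi> where \<phi>: "\<And>k. \<phi> k \<in> schwartz" "\<And>k x. x \<in> K \<Longrightarrow> \<phi> k x = 1" "\<And>k x. x \<notin> V k \<Longrightarrow> \<phi> k x = 0"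
      "\<And>k x. \<exists>r\<in>{0..1}. \<phi> k x = complex_of_real r"
    by metis
  have dom: "norm (g x * \<phi> k x) \<le> norm (g x * \<phi>0 x)" for k x
  proof (cases "x \<in> V k")
    case True
    then have "\<phi>0 x = 1"
      by (intro \<phi>0) (auto simp: V_def dist_commute)
    moreover have "norm (\<phi> k x) \<le> 1"
      using \<phi>(4) [of k x] by auto
    ultimately show ?thesis
      by (simp add: norm_mult mult_left_le)
  qed (simp add: \<phi>)
  have lim: "(\<lambda>k. g x * \<phi> k x) \<longlonglongrightarrow> indicator K x *\<^sub>R g x" for x
  proof (cases "x \<in> K")
    case False
    have "open (- K)"
      using K by (simp add: compact_imp_closed open_Compl)
    then obtain d where d: "0 < d" "ball x d \<subseteq> - K"
      using False open_contains_ball by blast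
    then obtain k0 where k0: "1 / real (Suc k0) < d"
      using nat_approx_posE by blast
    have "\<phi> k x = 0" if "k \<ge> k0" for k
    proof -
      have "1 / real (Suc k) \<le> 1 / real (Suc k0)"
        using that by (simp add: field_simps)
      have "x \<notin> V k"
      proof
        assume "x \<in> V k"
        then obtain y where y: "y \<in> K" "dist y x < 1 / real (Suc k)"
          by (auto simp: V_def)
        then have "y \<in> ball x d"
          using k0 \<open>1 / real (Suc k) \<le> 1 / real (Suc k0)\<close> by (simp add: dist_commute)
        with d y show False
          by blast
      qed
      then show ?thesis
        by (rule \<phi>)
    qed
    then have "\<forall>\<^sub>F k in sequentially. g x * \<phi> k x = indicator K x *\<^sub>R g x"
      using False by (auto simp: eventually_sequentially)
    then show ?thesis
      by (rule tendsto_eventually)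
  qed (simp add: \<phi>)
  have Km: "K \<in> sets lebesgue"
    using K by (simp add: borel_compact lborelD)
  have m: "(\<lambda>x. indicator K x *\<^sub>R g x) \<in> borel_measurable lebesgue"
    using meas Km by measurable
  have w: "integrable lebesgue (\<lambda>x. norm (g x * \<phi>0 x))"
    by (intro integrable_norm g \<phi>0)
  have sm: "(\<lambda>x. g x * \<phi> k x) \<in> borel_measurable lebesgue" for k
    by (intro borel_measurable_integrable g \<phi>)
  note dc = m sm w
  show "integrable lebesgue (\<lambda>x. indicator K x *\<^sub>R g x)"
    by (rule integrable_dominated_convergence [where s = "\<lambda>k x. g x * \<phi> k x", OF dc]) (use lim dom in auto)
  have "(\<lambda>k. LINT x|lebesgue. g x * \<phi> k x) \<longlonglongrightarrow> (LINT x|lebesgue. indicator K x *\<^sub>R g x)"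
    by (rule integral_dominated_convergence [where s = "\<lambda>k x. g x * \<phi> k x", OF dc]) (use lim dom in auto)
  then show "(LINT x|lebesgue. indicator K x *\<^sub>R g x) = 0"
    by (simp add: g(2) [OF \<phi>(1)] LIMSEQ_const_iff)
qed

text \<open>A Lebesgue set is, up to a null set, an increasing union of compact sets, so vanishing
  integrals over compact sets give vanishing integrals over all measurable sets. Restricting to
  balls first makes \<open>g\<close> integrable.\<close>

lemma AE_zero_if_schwartz_orthogonal:
  fixes g :: "real^'n::finite \<Rightarrow> complex"
  assumes g: "\<And>\<phi>. \<phi> \<in> schwartz \<Longrightarrow> integrable lebesgue (\<lambda>x. g x * \<phi> x)"
    "\<And>\<phi>. \<phi> \<in> schwartz \<Longrightarrow> (LINT x|lebesgue. g x * \<phi> x) = 0"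
    and meas: "g \<in> borel_measurable lebesgue"
  shows "AE x in lebesgue. g x = 0"
proof -
  note K0 = set_integral_null_compact [OF g meas]
  have "AE x in lebesgue. indicator (cball 0 (real R)) x *\<^sub>R g x = 0" for R :: nat
  proof (rule sigma_finite_measure.density_zero)
    let ?h = "\<lambda>x. indicator (cball 0 (real R)) x *\<^sub>R g x"
    show "sigma_finite_measure (lebesgue :: (real^'n) measure)"
      by (rule sigma_finite_measure_lebesgue)
    show h_int: "integrable lebesgue ?h"
      by (intro K0 compact_cball)
    fix A :: "(real^'n) set"
    assume "A \<in> sets lebesgue"
    then obtain C N where CN: "fsigma C" "N \<in> null_sets lebesgue" "C \<union> N = A" "disjnt C N"
      by (rule lebesgue_set_almost_fsigma)
    then obtain F :: "nat \<Rightarrow> (real^'n) set" where F: "range F \<subseteq> Collect compact" "C = \<Union>(range F)"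
      using fsigma_Union_compact by metis
    define G where "G = (\<lambda>k. \<Union>i\<le>k. F i)"
    have G: "compact (G k)" for k
      unfolding G_def using F by (intro compact_UN) auto
    have C_meas: "C \<in> sets lebesgue"
      using F by (auto simp: borel_compact lborelD intro!: sets.countable_UN)
    have "(\<lambda>k. LINT x|lebesgue. indicator (G k) x *\<^sub>R ?h x) \<longlonglongrightarrow> (LINT x|lebesgue. indicator C x *\<^sub>R ?h x)"
    proof (rule integral_dominated_convergence [where w = "\<lambda>x. norm (?h x)"])
      show "(\<lambda>x. indicator C x *\<^sub>R ?h x) \<in> borel_measurable lebesgue"
        using C_meas h_int by (intro borel_measurable_scaleR borel_measurable_indicator borel_measurable_integrable)
      show "(\<lambda>x. indicator (G k) x *\<^sub>R ?h x) \<in> borel_measurable lebesgue" for k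
        using G [of k] h_int by (intro borel_measurable_scaleR borel_measurable_indicator borel_measurable_integrable)
           (auto simp: borel_compact lborelD)
      show "AE x in lebesgue. (\<lambda>k. indicator (G k) x *\<^sub>R ?h x) \<longlonglongrightarrow> indicator C x *\<^sub>R ?h x"
      proof (rule AE_I2)
        fix x
        have "\<forall>\<^sub>F k in sequentially. indicator (G k) x = (indicator C x :: real)"
        proof (cases "x \<in> C")
          case True
          then obtain i where "x \<in> F i"
            using F by auto
          then have "x \<in> G k" if "k \<ge> i" for k
            using that by (auto simp: G_def)
          then show ?thesis
            using True by (auto simp: eventually_sequentially intro!: exI [of _ i])
        next
          case False
          then have "x \<notin> G k" for k
            using F by (auto simp: G_def)
          with False show ?thesis
            by simp
        qed
        then show "(\<lambda>k. indicator (G k) x *\<^sub>R ?h x) \<longlonglongrightarrow> indicator C x *\<^sub>R ?h x"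
          by (intro tendsto_intros tendsto_eventually)
      qed
      show "AE x in lebesgue. norm (indicator (G k) x *\<^sub>R ?h x) \<le> norm (?h x)" for k
        by (auto simp: indicator_def)
    qed (rule integrable_norm [OF h_int])
    moreover have "(LINT x|lebesgue. indicator (G k) x *\<^sub>R ?h x) = 0" for k
    proof -
      have eq: "indicator (G k) x *\<^sub>R ?h x = indicator (G k \<inter> cball 0 (real R)) x *\<^sub>R g x" for x
        by (simp add: indicator_inter_arith)
      show ?thesis
        unfolding eq using G [of k] by (intro K0(2) compact_Int compact_cball)
    qed
    ultimately have "(LINT x|lebesgue. indicator C x *\<^sub>R ?h x) = 0"
      by (simp add: LIMSEQ_const_iff)
    moreover have "(LINT x|lebesgue. indicator A x *\<^sub>R ?h x) = (LINT x|lebesgue. indicator C x *\<^sub>R ?h x)"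
    proof (rule integral_cong_AE)
      show "AE x in lebesgue. indicator A x *\<^sub>R ?h x = indicator C x *\<^sub>R ?h x"
        using AE_not_in [OF CN(2)] by (rule AE_mp) (use CN(3) in \<open>auto simp: indicator_def\<close>)
    qed (intro borel_measurable_scaleR borel_measurable_indicator borel_measurable_integrable
        \<open>A \<in> sets lebesgue\<close> C_meas h_int)+
    ultimately show "set_lebesgue_integral lebesgue A ?h = 0"
      by (simp add: set_lebesgue_integral_def)
  qed
  then have "AE x in lebesgue. \<forall>R::nat. indicator (cball 0 (real R)) x *\<^sub>R g x = 0"
    by (intro AE_all_countable [THEN iffD2] allI)
  then show ?thesis
  proof (rule AE_mp, intro AE_I2 impI)
    fix x :: "real^'n"
    assume *: "\<forall>R::nat. indicator (cball 0 (real R)) x *\<^sub>R g x = 0"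
    obtain R :: nat where "norm x \<le> real R"
      using real_arch_simple by blast
    with * show "g x = 0"
      by (auto dest!: spec [of _ R])
  qed
qed

text \<open>Makes the choice in \<open>multiplier_op\<close> immaterial for the norm, which does not
  distinguish functions that agree almost everywhere.\<close>

lemma represents_unique:
  assumes "represents T f" "represents T g"
  shows "AE x in lebesgue. f x = g x"
proof -
  have "AE x in lebesgue. f x - g x = 0"
  proof (rule AE_zero_if_schwartz_orthogonal)
    fix \<phi> :: "real^'a \<Rightarrow> complex"
    assume "\<phi> \<in> schwartz"
    then show "integrable lebesgue (\<lambda>x. (f x - g x) * \<phi> x)" "(LINT x|lebesgue. (f x - g x) * \<phi> x) = 0"
      using assms by (auto simp: represents_def left_diff_distrib)
  qed (use assms in \<open>auto simp: represents_def\<close>)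
  then show ?thesis
    by simp
qed

text \<open>Everything reduces to one set of finite measure, approximated by a compact set from
  inside and an open set from outside. A smooth cut-off between these two differs from the indicator
  only on their small difference.\<close>

lemma schwartz_dense_L1:
  fixes f :: "real^'n::finite \<Rightarrow> complex"
  assumes "integrable lebesgue f"
  shows "\<forall>e>0. \<exists>\<phi>\<in>schwartz. (LINT x|lebesgue. norm (f x - \<phi> x)) < e"
  using assms
proof (induction rule: integrable_induct)
  case (base A c)
  show ?case
  proof (intro allI impI)
    fix e :: real
    assume "0 < e"
    \<comment> \<open>Three exceptional sets of measure below \<open>d\<close> will be added. The 1
      next to \<open>norm c\<close> prevents division by zero and makes the final inequality
      strict.\<close>
    define d where "d = e / (3 * (norm c + 1))"
    have d: "0 < d" "3 * d * (norm c + 1) = e"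
    proof -
      have "0 < norm c + 1"
        by (simp add: add_nonneg_pos)
      with \<open>0 < e\<close> show "0 < d" "3 * d * (norm c + 1) = e"
        by (simp_all add: d_def field_simps)
    qed
    have lm: "A \<in> lmeasurable"
      using base by (auto simp: fmeasurable_def)
    obtain U where U: "open U" "A \<subseteq> U" "U - A \<in> lmeasurable" "emeasure lebesgue (U - A) < ennreal d"
      using sets_lebesgue_outer_open [OF base(1) d(1)] by blast
    obtain T where T: "closed T" "T \<subseteq> A" "A - T \<in> lmeasurable" "emeasure lebesgue (A - T) < ennreal d"
      using sets_lebesgue_inner_closed [OF base(1) d(1)] by blast
    have Tm: "T \<in> sets lebesgue"
      using T by (simp add: borel_closed lborelD)
    \<comment> \<open>The closed inner approximation may be unbounded; cutting it with a large ball
      makes it compact at the price of one more small set.\<close>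
    have "(\<lambda>k::nat. measure lebesgue (T - cball 0 (real k))) \<longlonglongrightarrow> measure lebesgue (\<Inter>k::nat. T - cball 0 (real k))"
    proof (rule Lim_measure_decseq)
      show "range (\<lambda>k::nat. T - cball 0 (real k)) \<subseteq> sets lebesgue"
        using Tm by auto
      show "decseq (\<lambda>k::nat. T - cball 0 (real k))"
        by (auto simp: decseq_def)
      show "emeasure lebesgue (T - cball 0 (real k)) \<noteq> \<infinity>" for k :: nat
      proof -
        have "emeasure lebesgue (T - cball 0 (real k)) \<le> emeasure lebesgue A"
          using T(2) base(1) by (intro emeasure_mono) auto
        with base(2) show ?thesis
          by (metis leD)
      qed
    qed
    moreover have "(\<Inter>k::nat. T - cball 0 (real k)) = {}"
      by (auto simp: real_arch_simple)
    ultimately have "(\<lambda>k::nat. measure lebesgue (T - cball 0 (real k))) \<longlonglongrightarrow> 0"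
      by (simp only: measure_empty)
    then obtain k :: nat where k: "measure lebesgue (T - cball 0 (real k)) < d"
      using order_tendstoD(2) [OF _ d(1)] eventually_happens' [OF sequentially_bot] by blast
    let ?K = "T \<inter> cball 0 (real k)"
    have K: "compact ?K"
      using T by (simp add: closed_Int_compact)
    obtain \<phi> where \<phi>: "\<phi> \<in> schwartz" "\<And>x. x \<in> ?K \<Longrightarrow> \<phi> x = 1" "\<And>x. x \<notin> U \<Longrightarrow> \<phi> x = 0"
        "\<And>x. \<exists>r\<in>{0..1}. \<phi> x = complex_of_real r"
      using smooth_urysohn [OF K U(1)] T(2) U(2) by blast
    have TK: "T - cball 0 (real k) \<in> lmeasurable"
      using Tm T(2) lm by (intro fmeasurableI2 [OF lm]) auto
    let ?B = "(U - A) \<union> (A - T) \<union> (T - cball 0 (real k))"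
    have B: "?B \<in> lmeasurable"
      using U T TK by blast
    have "measure lebesgue ?B \<le> measure lebesgue (U - A) + measure lebesgue (A - T) + measure lebesgue (T - cball 0 (real k))"
      using U(3) T(3) TK by (intro order_trans [OF measure_Un_le] add_right_mono measure_Un_le) auto
    also have "\<dots> < d + d + d"
      using U(3,4) T(3,4) d k
      by (intro add_strict_mono) (auto simp: emeasure_eq_measure2 fmeasurableD2 emeasure_eq_ennreal_measure ennreal_less_iff)
    finally have mB: "measure lebesgue ?B < 3 * d"
      by simp
    have le: "norm (indicator A x *\<^sub>R c - c * \<phi> x) \<le> norm c * indicator ?B x" for x
    proof -
      obtain r where r: "0 \<le> r" "r \<le> 1" "\<phi> x = complex_of_real r"
        using \<phi>(4) [of x] by auto
      have "norm (indicator A x *\<^sub>R c - c * \<phi> x) = norm c * \<bar>indicator A x - r\<bar>"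
      proof -
        have "indicator A x *\<^sub>R c - c * \<phi> x = c * of_real (indicator A x - r)"
          by (simp add: r(3) scaleR_conv_of_real algebra_simps)
        then show ?thesis
          by (simp only: norm_mult norm_of_real)
      qed
      also have "\<bar>indicator A x - r\<bar> \<le> indicator ?B x"
      proof (cases "x \<in> ?B")
        case True
        then show ?thesis
          using r by (auto simp: indicator_def)
      next
        case False
        then have "x \<in> ?K \<or> x \<notin> U"
          by auto
        then have "indicator A x = r"
          using \<phi>(2,3) [of x] r(3) T(2) U(2) by (auto simp: indicator_def)
        then show ?thesis
          by simp
      qed
      finally show ?thesis
        by (simp add: mult_left_mono)
    qed
    have iB: "integrable lebesgue (\<lambda>x. norm c * indicator ?B x)"
      using B by (intro integrable_mult_right) (auto simp: fmeasurable_def)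
    have "(LINT x|lebesgue. norm (indicator A x *\<^sub>R c - c * \<phi> x)) \<le> (LINT x|lebesgue. norm c * indicator ?B x)"
      by (rule integral_mono' [OF iB le]) auto
    also have "\<dots> = norm c * measure lebesgue ?B"
      using B by simp
    also have "\<dots> \<le> norm c * (3 * d)"
      using mB by (intro mult_left_mono) auto
    also have "\<dots> < e"
      using d by (simp add: algebra_simps)
    finally show "\<exists>\<phi>\<in>schwartz. (LINT x|lebesgue. norm (indicator A x *\<^sub>R c - \<phi> x)) < e"
      by (intro bexI [of _ "\<lambda>x. c * \<phi> x"] schwartz_cmult \<phi>)
  qed
next
  case (add f g)
  show ?case
  proof (intro allI impI)
    fix e :: real
    assume "0 < e"
    then obtain \<phi> \<psi> where *: "\<phi> \<in> schwartz" "(LINT x|lebesgue. norm (f x - \<phi> x)) < e / 2"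
        "\<psi> \<in> schwartz" "(LINT x|lebesgue. norm (g x - \<psi> x)) < e / 2"
      using add by (meson half_gt_zero)
    have i: "integrable lebesgue (\<lambda>x. norm (f x - \<phi> x))" "integrable lebesgue (\<lambda>x. norm (g x - \<psi> x))"
      by (intro integrable_norm Bochner_Integration.integrable_diff schwartz_integrable add *)+
    have "(LINT x|lebesgue. norm (f x + g x - (\<phi> x + \<psi> x))) \<le> (LINT x|lebesgue. norm (f x - \<phi> x) + norm (g x - \<psi> x))"
      by (rule integral_mono') (use i norm_diff_triangle_ineq in auto)
    also have "\<dots> < e"
      using i * by simp
    finally show "\<exists>\<phi>\<in>schwartz. (LINT x|lebesgue. norm (f x + g x - \<phi> x)) < e"
      using schwartz_add [OF *(1,3)] by (rule bexI)
  qed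
next
  case (lim f s)
  show ?case
  proof (intro allI impI)
    fix e :: real
    assume "0 < e"
    have "(\<lambda>i. LINT x|lebesgue. norm (f x - s i x)) \<longlonglongrightarrow> (LINT x|lebesgue. norm (f x - f x))"
    \<comment> \<open>The approximants are bounded by \<open>2 * norm (f x)\<close>, hence the
      factor 3.\<close>
    proof (rule integral_dominated_convergence [where w = "\<lambda>x. 3 * norm (f x)"])
      show "AE x in lebesgue. (\<lambda>i. norm (f x - s i x)) \<longlonglongrightarrow> norm (f x - f x)"
        using lim by (intro AE_I2 tendsto_intros) auto
      show "AE x in lebesgue. norm (norm (f x - s i x)) \<le> 3 * norm (f x)" for i
      proof (rule AE_I2)
        fix x :: "real^'n"
        show "norm (norm (f x - s i x)) \<le> 3 * norm (f x)"
          using norm_triangle_ineq4 [of "f x" "s i x"] lim.hyps(3) [of x i] by simp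
      qed
    qed (intro borel_measurable_integrable integrable_norm integrable_mult_right
        Bochner_Integration.integrable_diff lim)+
    then have "(\<lambda>i. LINT x|lebesgue. norm (f x - s i x)) \<longlonglongrightarrow> 0"
      by simp
    moreover have "0 < e / 2"
      using \<open>0 < e\<close> by simp
    ultimately obtain i where i: "(LINT x|lebesgue. norm (f x - s i x)) < e / 2"
      using order_tendstoD(2) eventually_happens' [OF sequentially_bot] by blast
    obtain \<phi> where \<phi>: "\<phi> \<in> schwartz" "(LINT x|lebesgue. norm (s i x - \<phi> x)) < e / 2"
      using lim.IH \<open>0 < e\<close> by (meson half_gt_zero)
    have ii: "integrable lebesgue (\<lambda>x. norm (f x - s i x))" "integrable lebesgue (\<lambda>x. norm (s i x - \<phi> x))"
      by (intro integrable_norm Bochner_Integration.integrable_diff schwartz_integrable lim \<phi>)+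
    have "(LINT x|lebesgue. norm (f x - \<phi> x)) \<le> (LINT x|lebesgue. norm (f x - s i x) + norm (s i x - \<phi> x))"
      by (rule integral_mono') (use ii norm_diff_triangle_le [OF order_refl order_refl] in auto)
    also have "\<dots> < e"
      using ii i \<phi>(2) by simp
    finally show "\<exists>\<phi>\<in>schwartz. (LINT x|lebesgue. norm (f x - \<phi> x)) < e"
      using \<phi>(1) by blast
  qed
qed

section \<open>Functionals bounded in the mean\<close>

text \<open>Adding \<open>C\<close> times \<open>P\<close> makes the set function nonnegative and at
  most 2C times \<open>P\<close>. This bound forces continuity at the empty set, so finite
  additivity becomes countable additivity and Radon-Nikodym applies; the shift is subtracted from
  the density at the end.\<close>

lemma real_set_function_density:
  fixes \<nu> :: "'a set \<Rightarrow> real"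
  assumes "finite_measure P"
    and add: "\<And>A B. A \<in> sets P \<Longrightarrow> B \<in> sets P \<Longrightarrow> A \<inter> B = {} \<Longrightarrow> \<nu> (A \<union> B) = \<nu> A + \<nu> B"
    and bound: "\<And>A. A \<in> sets P \<Longrightarrow> \<bar>\<nu> A\<bar> \<le> C * measure P A"
  obtains g where "integrable P g" "\<And>A. A \<in> sets P \<Longrightarrow> \<nu> A = (LINT x|P. indicator A x * g x)"
proof -
  interpret finite_measure P by fact
  define \<mu> where "\<mu> = (\<lambda>A. ennreal (\<nu> A + C * measure P A))"
  have nonneg: "0 \<le> \<nu> A + C * measure P A" and le: "\<nu> A + C * measure P A \<le> 2 * C * measure P A"
    if "A \<in> sets P" for A
    using bound [OF that] by auto
  have empty: "\<nu> {} = 0"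
    using bound [of "{}"] by simp
  have pos: "positive (sets P) \<mu>"
    by (simp add: positive_def \<mu>_def empty)
  have "countably_additive (sets P) \<mu>"
  proof (rule sets.empty_continuous_imp_countably_additive [OF pos])
    show "additive (sets P) \<mu>"
      unfolding additive_def
    proof (intro ballI impI)
      fix A B assume AB: "A \<in> sets P" "B \<in> sets P" "A \<inter> B = {}"
      then have "\<nu> (A \<union> B) + C * measure P (A \<union> B) = (\<nu> A + C * measure P A) + (\<nu> B + C * measure P B)"
        by (simp add: add finite_measure_Union algebra_simps)
      then show "\<mu> (A \<union> B) = \<mu> A + \<mu> B"
        unfolding \<mu>_def using nonneg AB by (simp only: ennreal_plus)
    qed
    fix A :: "nat \<Rightarrow> 'a set"
    assume A: "range A \<subseteq> sets P" "decseq A" "(\<Inter>i. A i) = {}"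
    have "(\<lambda>i. measure P (A i)) \<longlonglongrightarrow> measure P {}"
      using finite_Lim_measure_decseq [OF A(1,2)] A(3) by simp
    then have lim: "(\<lambda>i. 2 * C * measure P (A i)) \<longlonglongrightarrow> 0"
      using tendsto_mult_left [of "\<lambda>i. measure P (A i)" 0 sequentially "2 * C"] by simp
    have "(\<lambda>i. \<nu> (A i) + C * measure P (A i)) \<longlonglongrightarrow> 0"
      by (rule tendsto_sandwich [OF _ _ tendsto_const lim])
         (use A(1) nonneg le in \<open>auto intro!: always_eventually\<close>)
    then show "(\<lambda>i. \<mu> (A i)) \<longlonglongrightarrow> 0"
      unfolding \<mu>_def using tendsto_ennrealI by fastforce
  qed (simp add: \<mu>_def)
  note ca = sets.sigma_algebra_axioms pos this
  define N where "N = measure_of (space P) (sets P) \<mu>"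
  have N: "sets N = sets P" "\<And>A. A \<in> sets P \<Longrightarrow> emeasure N A = \<mu> A"
    by (simp_all add: N_def emeasure_measure_of_sigma [OF ca])
  have "absolutely_continuous P N"
    unfolding absolutely_continuous_def
  proof
    fix A assume A: "A \<in> null_sets P"
    then have "measure P A = 0" "A \<in> sets P"
      by (auto simp: measure_def)
    then show "A \<in> null_sets N"
      using bound [of A] N by (auto simp: null_sets_def \<mu>_def)
  qed
  from Radon_Nikodym [OF this N(1)] obtain f where f: "f \<in> borel_measurable P" "density P f = N"
    by blast
  have fA: "(\<integral>\<^sup>+x\<in>A. f x \<partial>P) = \<mu> A" if "A \<in> sets P" for A
    using N(2) [OF that] that f by (metis emeasure_density)
  have "(\<integral>\<^sup>+x. f x \<partial>P) = \<mu> (space P)"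
    using fA [of "space P"] by (simp add: nn_integral_set_ennreal cong: nn_integral_cong)
  then have fin: "(\<integral>\<^sup>+x. f x \<partial>P) < \<infinity>"
    by (simp add: \<mu>_def)
  then have "AE x in P. f x \<noteq> \<infinity>"
    using f(1) by (intro nn_integral_PInf_AE) auto
  then have f_eq: "AE x in P. ennreal (enn2real (f x)) = f x"
    by (auto simp: less_top)
  have i: "integrable P (\<lambda>x. enn2real (f x))"
    using fin f(1) nn_integral_cong_AE [OF f_eq] by (intro integrableI_nonneg) auto
  have iA: "(LINT x|P. indicator A x * enn2real (f x)) = \<nu> A + C * measure P A" if "A \<in> sets P" for A
  proof -
    have "AE x in P. ennreal (indicator A x * enn2real (f x)) = f x * indicator A x"
      using f_eq by (rule AE_mp) (auto simp: indicator_def intro!: AE_I2)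
    then have "(\<integral>\<^sup>+x. ennreal (indicator A x * enn2real (f x)) \<partial>P) = \<mu> A"
      using fA [OF that] by (subst nn_integral_cong_AE) auto
    then show ?thesis
      using that f(1) nonneg [OF that]
      by (subst integral_eq_nn_integral) (auto simp: \<mu>_def intro!: borel_measurable_times)
  qed
  show ?thesis
  proof (rule that [of "\<lambda>x. enn2real (f x) - C"])
    show "integrable P (\<lambda>x. enn2real (f x) - C)"
      using i by simp
    fix A assume A: "A \<in> sets P"
    have iI: "integrable P (indicator A :: 'a \<Rightarrow> real)"
      using A by (intro integrable_real_indicator) (auto simp: less_top [symmetric])
    have "(LINT x|P. indicator A x * (enn2real (f x) - C)) = (LINT x|P. indicator A x * enn2real (f x) - C * indicator A x)"
      by (simp add: algebra_simps)
    also have "\<dots> = (LINT x|P. indicator A x * enn2real (f x)) - C * measure P A"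
      using A i integrable_mult_indicator [OF A i] iI by (subst Bochner_Integration.integral_diff) auto
    finally show "\<nu> A = (LINT x|P. indicator A x * (enn2real (f x) - C))"
      using iA [OF A] by simp
  qed
qed

text \<open>Real and imaginary parts have densities, but bounding these separately would lose a
  constant. Instead, the averages of the complex density over sets of positive measure lie in the
  disc of radius \<open>C\<close>, hence so do almost all its values.\<close>

lemma complex_set_function_density:
  fixes \<nu> :: "'a set \<Rightarrow> complex"
  assumes P: "finite_measure P"
    and add: "\<And>A B. A \<in> sets P \<Longrightarrow> B \<in> sets P \<Longrightarrow> A \<inter> B = {} \<Longrightarrow> \<nu> (A \<union> B) = \<nu> A + \<nu> B"
    and bound: "\<And>A. A \<in> sets P \<Longrightarrow> norm (\<nu> A) \<le> C * measure P A"
  obtains g where "integrable P g" "\<And>A. A \<in> sets P \<Longrightarrow> \<nu> A = (LINT x|P. indicator A x *\<^sub>R g x)"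
    "AE x in P. norm (g x) \<le> C"
proof -
  obtain g1 where g1: "integrable P g1" "\<And>A. A \<in> sets P \<Longrightarrow> Re (\<nu> A) = (LINT x|P. indicator A x * g1 x)"
    using real_set_function_density [OF P, of "\<lambda>A. Re (\<nu> A)" C] add bound abs_Re_le_cmod order_trans
    by (smt (verit) plus_complex.sel(1))
  obtain g2 where g2: "integrable P g2" "\<And>A. A \<in> sets P \<Longrightarrow> Im (\<nu> A) = (LINT x|P. indicator A x * g2 x)"
    using real_set_function_density [OF P, of "\<lambda>A. Im (\<nu> A)" C] add bound abs_Im_le_cmod order_trans
    by (smt (verit) plus_complex.sel(2))
  let ?g = "\<lambda>x. Complex (g1 x) (g2 x)"
  have g_eq: "?g = (\<lambda>x. of_real (g1 x) + \<i> * of_real (g2 x))"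
    by (simp add: complex_eq_iff fun_eq_iff)
  have g: "integrable P ?g"
    unfolding g_eq using g1 g2 by auto
  have rep: "\<nu> A = (LINT x|P. indicator A x *\<^sub>R ?g x)" if "A \<in> sets P" for A
  proof (rule complex_eqI)
    have i: "integrable P (\<lambda>x. indicator A x *\<^sub>R ?g x)"
      by (rule integrable_mult_indicator [OF that g])
    show "Re (\<nu> A) = Re (LINT x|P. indicator A x *\<^sub>R ?g x)"
      unfolding g1(2) [OF that] integral_Re [OF i, symmetric] by simp
    show "Im (\<nu> A) = Im (LINT x|P. indicator A x *\<^sub>R ?g x)"
      unfolding g2(2) [OF that] integral_Im [OF i, symmetric] by simp
  qed
  interpret finite_measure P by fact
  have "AE x in P. ?g x \<in> cball 0 C"
  proof (rule averaging_theorem [OF g])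
    fix A assume A: "A \<in> sets P" "0 < measure P A"
    then show "(1 / measure P A) *\<^sub>R set_lebesgue_integral P A ?g \<in> cball 0 C"
      using bound [OF A(1)] by (simp add: set_lebesgue_integral_def rep [symmetric] field_simps)
  qed simp
  then show ?thesis
    using that [OF g rep] by (simp add: dist_norm)
qed

text \<open>The number \<open>z\<close> is the value at \<open>h\<close> of the continuous extension of \<open>T\<close> to \<open>L\<^sup>1\<close>.\<close>

lemma L1_extension:
  fixes T :: "(real^'n::finite \<Rightarrow> complex) \<Rightarrow> complex"
  assumes T: "tempered T" and M: "0 \<le> M"
    and bound: "\<And>\<phi>. \<phi> \<in> schwartz \<Longrightarrow> norm (T \<phi>) \<le> M * (LINT x|lebesgue. norm (\<phi> x))"
    and h: "integrable lebesgue h"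
  shows "\<exists>z. \<forall>\<phi>\<in>schwartz. norm (T \<phi> - z) \<le> M * (LINT x|lebesgue. norm (h x - \<phi> x))"
proof -
  let ?d = "\<lambda>f g. LINT x|lebesgue. norm (f x - g x :: complex)"
  have tri: "?d \<phi> \<psi> \<le> ?d h \<phi> + ?d h \<psi>" if "\<phi> \<in> schwartz" "\<psi> \<in> schwartz" for \<phi> \<psi>
  proof -
    have i: "integrable lebesgue (\<lambda>x. norm (h x - \<phi> x))" "integrable lebesgue (\<lambda>x. norm (h x - \<psi> x))"
      by (intro integrable_norm Bochner_Integration.integrable_diff h schwartz_integrable that)+
    have "norm (\<phi> x - \<psi> x) \<le> norm (h x - \<phi> x) + norm (h x - \<psi> x)" for x
      using norm_triangle_ineq4 [of "h x - \<psi> x" "h x - \<phi> x"] by (simp add: algebra_simps)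
    then have "?d \<phi> \<psi> \<le> (LINT x|lebesgue. norm (h x - \<phi> x) + norm (h x - \<psi> x))"
      using i by (intro integral_mono') auto
    also have "\<dots> = ?d h \<phi> + ?d h \<psi>"
      using i by simp
    finally show ?thesis .
  qed
  have lip: "norm (T \<phi> - T \<psi>) \<le> M * (?d h \<phi> + ?d h \<psi>)" if "\<phi> \<in> schwartz" "\<psi> \<in> schwartz" for \<phi> \<psi>
    using bound [OF schwartz_diff [OF that]] mult_left_mono [OF tri [OF that] M]
    by (simp add: tempered_diff [OF T that])
  have "\<exists>\<phi>\<in>schwartz. ?d h \<phi> < 1 / real (Suc k)" for k
    using schwartz_dense_L1 [OF h] by simp
  then obtain \<phi> where \<phi>: "\<And>k. \<phi> k \<in> schwartz" "\<And>k. ?d h (\<phi> k) < 1 / real (Suc k)"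
    by metis
  have d0: "(\<lambda>k. ?d h (\<phi> k)) \<longlonglongrightarrow> 0"
  proof (rule tendsto_sandwich [OF _ _ tendsto_const LIMSEQ_Suc [OF lim_1_over_n]])
    show "\<forall>\<^sub>F k in sequentially. ?d h (\<phi> k) \<le> 1 / real (Suc k)"
      using \<phi>(2) by (intro always_eventually allI less_imp_le)
  qed simp
  have "Cauchy (\<lambda>k. T (\<phi> k))"
  proof (rule CauchyI')
    fix e :: real assume "0 < e"
    have lim: "(\<lambda>k. M * ?d h (\<phi> k)) \<longlonglongrightarrow> 0"
      using tendsto_mult_left [OF d0, of M] by simp
    have "\<forall>\<^sub>F k in sequentially. M * ?d h (\<phi> k) < e / 2"
      by (rule order_tendstoD(2) [OF lim]) (use \<open>0 < e\<close> in simp)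
    then obtain k0 where k0: "\<And>k. k \<ge> k0 \<Longrightarrow> M * ?d h (\<phi> k) < e / 2"
      unfolding eventually_sequentially by blast
    show "\<exists>k0. \<forall>m\<ge>k0. \<forall>n>m. dist (T (\<phi> m)) (T (\<phi> n)) < e"
    proof (intro exI [of _ k0] allI impI)
      fix m n assume "k0 \<le> m" "m < n"
      then show "dist (T (\<phi> m)) (T (\<phi> n)) < e"
        using lip [OF \<phi>(1,1), of m n] k0 [of m] k0 [of n] by (simp add: dist_norm distrib_left)
    qed
  qed
  then obtain z where z: "(\<lambda>k. T (\<phi> k)) \<longlonglongrightarrow> z"
    using Cauchy_convergent by (auto simp: convergent_def)
  have "norm (T \<psi> - z) \<le> M * ?d h \<psi>" if "\<psi> \<in> schwartz" for \<psi>
  proof (rule LIMSEQ_le)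
    show "(\<lambda>k. norm (T \<psi> - T (\<phi> k))) \<longlonglongrightarrow> norm (T \<psi> - z)"
      by (intro tendsto_intros z)
    show "(\<lambda>k. M * (?d h \<psi> + ?d h (\<phi> k))) \<longlonglongrightarrow> M * ?d h \<psi>"
      using tendsto_mult_left [OF tendsto_add [OF tendsto_const d0], of M "?d h \<psi>"] by simp
    show "\<exists>N. \<forall>k\<ge>N. norm (T \<psi> - T (\<phi> k)) \<le> M * (?d h \<psi> + ?d h (\<phi> k))"
      using lip [OF that \<phi>(1)] by blast
  qed
  then show ?thesis
    by blast
qed

text \<open>\<open>T\<close> extends to L^1 by density, the extension inherits linearity from the
  approximation bound, and a set function dominated by a finite measure has a bounded density. No
  constant is lost: the density is bounded by the same \<open>M\<close>.\<close>

theorem L1_dual_schwartz: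
  fixes T :: "(real^'n::finite \<Rightarrow> complex) \<Rightarrow> complex"
  assumes T: "tempered T" and M: "0 \<le> M"
    and bound: "\<And>\<phi>. \<phi> \<in> schwartz \<Longrightarrow> norm (T \<phi>) \<le> M * (LINT x|lebesgue. norm (\<phi> x))"
  obtains f where "represents T f" "AE x in lebesgue. norm (f x) \<le> M"
proof -
  let ?d = "\<lambda>f g. LINT x|lebesgue. norm (f x - g x :: complex)"
  obtain A where A: "\<And>h \<phi>. integrable lebesgue h \<Longrightarrow> \<phi> \<in> schwartz \<Longrightarrow> norm (T \<phi> - A h) \<le> M * ?d h \<phi>"
    using L1_extension [OF T M bound] by metis
  have A_unique: "z = A h"
    if h: "integrable lebesgue h" and z: "\<And>\<phi>. \<phi> \<in> schwartz \<Longrightarrow> norm (T \<phi> - z) \<le> C * ?d h \<phi>" for z h C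
  proof -
    have "norm (z - A h) \<le> 0 + e" if "0 < e" for e
    proof -
      have "0 < e / (\<bar>C\<bar> + M + 1)"
        using that M by (intro divide_pos_pos) auto
      then obtain \<phi> where \<phi>: "\<phi> \<in> schwartz" "?d h \<phi> < e / (\<bar>C\<bar> + M + 1)"
        using schwartz_dense_L1 [OF h] by blast
      have "norm (z - A h) \<le> norm (T \<phi> - A h) + norm (T \<phi> - z)"
        using norm_triangle_ineq4 [of "T \<phi> - A h" "T \<phi> - z"] by simp
      also have "\<dots> \<le> M * ?d h \<phi> + C * ?d h \<phi>"
        by (intro add_mono A h z \<phi>)
      also have "\<dots> \<le> (\<bar>C\<bar> + M + 1) * ?d h \<phi>"
      proof -
        have D: "0 \<le> ?d h \<phi>"
          by (intro Bochner_Integration.integral_nonneg) simp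
        show ?thesis
          using mult_right_mono [OF abs_ge_self [of C] D] D unfolding distrib_right mult_1 by linarith
      qed
      also have "\<dots> \<le> (\<bar>C\<bar> + M + 1) * (e / (\<bar>C\<bar> + M + 1))"
        using \<phi>(2) M by (intro mult_left_mono) auto
      also have "\<dots> = e"
        using M by simp
      finally show ?thesis
        by simp
    qed
    then have "norm (z - A h) \<le> 0"
      by (rule field_le_epsilon)
    then show ?thesis
      by simp
  qed
  have A_T: "A \<phi> = T \<phi>" if "\<phi> \<in> schwartz" for \<phi>
    using A [OF schwartz_integrable [OF that] that] by simp
  have A_bound: "norm (A h) \<le> M * (LINT x|lebesgue. norm (h x))" if "integrable lebesgue h" for h
    using A [OF that schwartz_zero] by (simp add: tempered_zero [OF T])
  have A_cmult: "A (\<lambda>x. c * h x) = c * A h" if h: "integrable lebesgue h" for c h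
  proof (cases "c = 0")
    case True
    then show ?thesis
      using A_T [OF schwartz_zero] by (simp add: tempered_zero [OF T])
  next
    case False
    show ?thesis
    proof (rule A_unique [symmetric, of _ _ M])
      fix \<phi> :: "real^'n \<Rightarrow> complex"
      assume \<phi>: "\<phi> \<in> schwartz"
      have "T \<phi> - c * A h = c * (T (\<lambda>x. inverse c * \<phi> x) - A h)"
        using False by (simp add: tempered_cmult [OF T \<phi>] algebra_simps)
      then have "norm (T \<phi> - c * A h) \<le> norm c * (M * ?d h (\<lambda>x. inverse c * \<phi> x))"
        by (simp only: norm_mult) (intro mult_left_mono A h schwartz_cmult \<phi> norm_ge_zero)
      also have "\<dots> = M * (LINT x|lebesgue. norm c * norm (h x - inverse c * \<phi> x))"
        by simp
      also have "\<dots> = M * ?d (\<lambda>x. c * h x) \<phi>"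
        using False by (simp add: norm_mult [symmetric] right_diff_distrib mult.assoc [symmetric])
      finally show "norm (T \<phi> - c * A h) \<le> M * ?d (\<lambda>x. c * h x) \<phi>" .
    qed (use h in simp)
  qed
  have A_add: "A (\<lambda>x. g x + h x) = A g + A h" if g: "integrable lebesgue g" and h: "integrable lebesgue h" for g h
  proof -
    have "norm (A (\<lambda>x. g x + h x) - (A g + A h)) \<le> 0 + e" if "0 < e" for e
    proof -
      have "0 < e / (2 * M + 1) / 2"
        using that M by simp
      then obtain \<phi> \<psi> where \<phi>: "\<phi> \<in> schwartz" "?d g \<phi> < e / (2 * M + 1) / 2"
        and \<psi>: "\<psi> \<in> schwartz" "?d h \<psi> < e / (2 * M + 1) / 2"
        using schwartz_dense_L1 [OF g] schwartz_dense_L1 [OF h] by meson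
      have gh: "integrable lebesgue (\<lambda>x. g x + h x)"
        using g h by simp
      have i: "integrable lebesgue (\<lambda>x. norm (g x - \<phi> x))" "integrable lebesgue (\<lambda>x. norm (h x - \<psi> x))"
        by (intro integrable_norm Bochner_Integration.integrable_diff g h schwartz_integrable \<phi> \<psi>)+
      have "?d (\<lambda>x. g x + h x) (\<lambda>x. \<phi> x + \<psi> x) \<le> (LINT x|lebesgue. norm (g x - \<phi> x) + norm (h x - \<psi> x))"
        by (rule integral_mono') (use i norm_diff_triangle_ineq in auto)
      then have d: "?d (\<lambda>x. g x + h x) (\<lambda>x. \<phi> x + \<psi> x) \<le> ?d g \<phi> + ?d h \<psi>"
        using i by simp
      have "A (\<lambda>x. g x + h x) - (A g + A h) =
         (T \<phi> - A g) + (T \<psi> - A h) - (T (\<lambda>x. \<phi> x + \<psi> x) - A (\<lambda>x. g x + h x))"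
        by (simp add: tempered_add [OF T \<phi>(1) \<psi>(1)])
      also have "norm \<dots> \<le> norm (T \<phi> - A g) + norm (T \<psi> - A h) + norm (T (\<lambda>x. \<phi> x + \<psi> x) - A (\<lambda>x. g x + h x))"
        by (intro order_trans [OF norm_triangle_ineq4] add_right_mono norm_triangle_ineq)
      also have "\<dots> \<le> M * ?d g \<phi> + M * ?d h \<psi> + M * ?d (\<lambda>x. g x + h x) (\<lambda>x. \<phi> x + \<psi> x)"
        by (intro add_mono A g h gh schwartz_add \<phi> \<psi>)
      also have "\<dots> \<le> 2 * M * (?d g \<phi> + ?d h \<psi>)"
        using mult_left_mono [OF d M] by (simp add: algebra_simps)
      also have "\<dots> \<le> 2 * M * (e / (2 * M + 1))"
        using add_strict_mono [OF \<phi>(2) \<psi>(2)] M unfolding field_sum_of_halves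
        by (intro mult_left_mono) simp_all
      also have "\<dots> \<le> e"
        using that M by (simp add: field_simps)
      finally show ?thesis
        by simp
    qed
    then have "norm (A (\<lambda>x. g x + h x) - (A g + A h)) \<le> 0"
      by (rule field_le_epsilon)
    then show ?thesis
      by simp
  qed
  \<comment> \<open>A positive integrable weight turns Lebesgue measure into a finite measure with
    the same null sets. Every measurable set can then be tested through its indicator times
    \<open>w\<close>; the weight is divided out at the end.\<close>
  define w where "w = (\<lambda>x::real^'n. 1 / (1 + norm x) ^ (2 * CARD('n)))"
  have w_pos: "0 < w x" for x
    by (simp add: w_def add_pos_nonneg)
  have w_int: "integrable lebesgue w"
    unfolding w_def by (rule integrable_decay) simp
  have w_meas [measurable]: "w \<in> borel_measurable lebesgue"
    using w_int by (rule borel_measurable_integrable)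
  define P where "P = density lebesgue (\<lambda>x. ennreal (w x))"
  have P_sets [simp]: "sets P = sets lebesgue"
    by (simp add: P_def)
  have P_int: "integrable P h \<longleftrightarrow> integrable lebesgue (\<lambda>x. w x *\<^sub>R h x)"
    if "h \<in> borel_measurable lebesgue" for h :: "real^'n \<Rightarrow> complex"
    unfolding P_def using that w_pos by (intro integrable_density) (auto simp: less_imp_le)
  have P_integral: "(LINT x|P. h x) = (LINT x|lebesgue. w x *\<^sub>R h x)"
    if "h \<in> borel_measurable lebesgue" for h :: "real^'n \<Rightarrow> complex"
    unfolding P_def using that w_pos by (intro integral_density) (auto simp: less_imp_le)
  have P_meas: "h \<in> borel_measurable P \<longleftrightarrow> h \<in> borel_measurable lebesgue" for h :: "real^'n \<Rightarrow> complex"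
    by (simp add: P_def)
  have P_fin: "finite_measure P"
  proof
    have "(\<integral>\<^sup>+x. ennreal (w x) \<partial>lebesgue) < \<infinity>"
      using w_int w_pos by (simp add: integrable_iff_bounded less_imp_le)
    then show "emeasure P (space P) \<noteq> \<infinity>"
      by (simp add: P_def emeasure_density)
  qed
  interpret P: finite_measure P by (rule P_fin)
  have m_P: "measure P E = (LINT x|lebesgue. norm (indicator E x *\<^sub>R complex_of_real (w x)))" if "E \<in> sets lebesgue" for E
  proof -
    have "emeasure P E = (\<integral>\<^sup>+x. ennreal (norm (indicator E x *\<^sub>R complex_of_real (w x))) \<partial>lebesgue)"
      using that w_pos by (simp add: P_def emeasure_density)
         (intro nn_integral_cong, auto simp: indicator_def less_imp_le)
    then show ?thesis
      using that w_pos by (subst integral_eq_nn_integral) (auto simp: measure_def)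
  qed
  have iE: "integrable lebesgue (\<lambda>x. indicator E x *\<^sub>R complex_of_real (w x))" if "E \<in> sets lebesgue" for E
    using w_int by (intro integrable_mult_indicator that integrable_of_real)
  let ?\<nu> = "\<lambda>E. A (\<lambda>x. indicator E x *\<^sub>R complex_of_real (w x))"
  obtain g where g: "integrable P g" "\<And>E. E \<in> sets P \<Longrightarrow> ?\<nu> E = (LINT x|P. indicator E x *\<^sub>R g x)"
    "AE x in P. norm (g x) \<le> M"
  proof (rule complex_set_function_density [OF P_fin, of ?\<nu> M])
    fix E F assume EF: "E \<in> sets P" "F \<in> sets P" "E \<inter> F = {}"
    have "(\<lambda>x. indicator (E \<union> F) x *\<^sub>R complex_of_real (w x)) =
        (\<lambda>x. indicator E x *\<^sub>R complex_of_real (w x) + indicator F x *\<^sub>R complex_of_real (w x))"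
      using EF(3) by (auto simp: fun_eq_iff indicator_def)
    then show "?\<nu> (E \<union> F) = ?\<nu> E + ?\<nu> F"
      using EF by (simp only: A_add [OF iE iE] P_sets)
  next
    fix E assume "E \<in> sets P"
    then show "norm (?\<nu> E) \<le> M * measure P E"
      using A_bound [OF iE, of E] m_P [of E] by simp
  qed (use that in blast)
  have g_meas [measurable]: "g \<in> borel_measurable lebesgue"
    using borel_measurable_integrable [OF g(1)] P_meas by blast
  have g_le: "AE x in lebesgue. norm (g x) \<le> M"
  proof -
    have "AE x in lebesgue. 0 < ennreal (w x) \<longrightarrow> norm (g x) \<le> M"
      using g(3) unfolding P_def by (subst (asm) AE_density) auto
    then show ?thesis
      by (simp add: w_pos)
  qed
  have g_bnd: "integrable lebesgue (\<lambda>x. g x * h x)" "norm (LINT x|lebesgue. g x * h x) \<le> M * (LINT x|lebesgue. norm (h x))"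
    if h: "integrable lebesgue h" for h
  proof -
    have Mh: "integrable lebesgue (\<lambda>x. M * norm (h x))"
      using h by (intro integrable_mult_right integrable_norm)
    have le: "AE x in lebesgue. norm (g x * h x) \<le> M * norm (h x)"
      using g_le by (rule AE_mp) (auto simp: norm_mult intro!: mult_right_mono AE_I2)
    show i: "integrable lebesgue (\<lambda>x. g x * h x)"
      by (rule Bochner_Integration.integrable_bound [OF Mh])
         (use borel_measurable_integrable [OF h] le M in \<open>auto simp: abs_mult\<close>)
    have "norm (LINT x|lebesgue. g x * h x) \<le> (LINT x|lebesgue. norm (g x * h x))"
      by (rule integral_norm_bound)
    also have "\<dots> \<le> (LINT x|lebesgue. M * norm (h x))"
      by (intro integral_mono_AE integrable_norm i Mh le)
    finally show "norm (LINT x|lebesgue. g x * h x) \<le> M * (LINT x|lebesgue. norm (h x))"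
      by simp
  qed
  \<comment> \<open>For indicators this is the defining property of \<open>g\<close>. Both sides are
    linear and continuous in \<open>h\<close> for the L^1 norm of \<open>P\<close>, so it extends to
    all integrable functions.\<close>
  have main: "A (\<lambda>x. h x * complex_of_real (w x)) = (LINT x|lebesgue. g x * (h x * complex_of_real (w x)))"
    if "integrable P h" for h
    using that
  proof (induction rule: integrable_induct)
    case (base E c)
    then have E: "E \<in> sets lebesgue"
      by simp
    have "A (\<lambda>x. indicator E x *\<^sub>R c * complex_of_real (w x)) = A (\<lambda>x. c * (indicator E x *\<^sub>R complex_of_real (w x)))"
      by (simp add: mult.commute)
    also have "\<dots> = c * (LINT x|P. indicator E x *\<^sub>R g x)"
      by (simp only: A_cmult [OF iE [OF E]] g(2) [OF base(1)])
    also have "\<dots> = c * (LINT x|lebesgue. w x *\<^sub>R (indicator E x *\<^sub>R g x))"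
      using E by (subst P_integral) auto
    also have "\<dots> = (LINT x|lebesgue. c * (w x *\<^sub>R (indicator E x *\<^sub>R g x)))"
      by (simp only: integral_mult_right_zero)
    also have "\<dots> = (LINT x|lebesgue. g x * (indicator E x *\<^sub>R c * complex_of_real (w x)))"
      by (simp add: scaleR_conv_of_real mult_ac)
    finally show ?case .
  next
    case (add f h)
    then have "f \<in> borel_measurable lebesgue" "h \<in> borel_measurable lebesgue"
      using P_meas borel_measurable_integrable by blast+
    with add have i: "integrable lebesgue (\<lambda>x. f x * complex_of_real (w x))" "integrable lebesgue (\<lambda>x. h x * complex_of_real (w x))"
      by (auto simp: P_int scaleR_conv_of_real mult.commute)
    show ?case
      using add g_bnd(1) [OF i(1)] g_bnd(1) [OF i(2)] by (simp add: distrib_left distrib_right A_add i)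
  next
    case (lim h s)
    have meas: "h \<in> borel_measurable lebesgue" "\<And>k. s k \<in> borel_measurable lebesgue"
      using lim P_meas borel_measurable_integrable by blast+
    with lim have i: "integrable lebesgue (\<lambda>x. h x * complex_of_real (w x))" "\<And>k. integrable lebesgue (\<lambda>x. s k x * complex_of_real (w x))"
      by (auto simp: P_int scaleR_conv_of_real mult.commute)
    let ?D = "\<lambda>k. LINT x|lebesgue. norm (h x * complex_of_real (w x) - s k x * complex_of_real (w x))"
    have "?D \<longlonglongrightarrow> (LINT x|lebesgue. norm (h x * complex_of_real (w x) - h x * complex_of_real (w x)))"
    proof (rule integral_dominated_convergence [where w = "\<lambda>x. 3 * norm (h x * complex_of_real (w x))"])
      show "AE x in lebesgue. (\<lambda>k. norm (h x * complex_of_real (w x) - s k x * complex_of_real (w x)))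
          \<longlonglongrightarrow> norm (h x * complex_of_real (w x) - h x * complex_of_real (w x))"
        using lim.hyps(2) by (intro AE_I2 tendsto_intros) (auto simp: P_def)
      show "AE x in lebesgue. norm (norm (h x * complex_of_real (w x) - s k x * complex_of_real (w x)))
          \<le> 3 * norm (h x * complex_of_real (w x))" for k
      proof (rule AE_I2)
        fix x
        have "norm (h x - s k x) \<le> 3 * norm (h x)"
          using norm_triangle_ineq4 [of "h x" "s k x"] lim.hyps(3) [of x k] by (simp add: P_def)
        from mult_right_mono [OF this, of "w x"] w_pos [of x]
        show "norm (norm (h x * complex_of_real (w x) - s k x * complex_of_real (w x)))
          \<le> 3 * norm (h x * complex_of_real (w x))"
          by (simp add: left_diff_distrib [symmetric] norm_mult)
      qed
    qed (intro borel_measurable_integrable integrable_norm integrable_mult_right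
        Bochner_Integration.integrable_diff i)+
    then have D: "?D \<longlonglongrightarrow> 0"
      by simp
    let ?B = "\<lambda>h. A (\<lambda>x. h x * complex_of_real (w x)) - (LINT x|lebesgue. g x * (h x * complex_of_real (w x)))"
    have "norm (?B h) \<le> 2 * M * ?D k" for k
    proof -
      let ?u = "\<lambda>x. h x * complex_of_real (w x) - s k x * complex_of_real (w x)"
      have iu: "integrable lebesgue ?u"
        by (intro Bochner_Integration.integrable_diff i)
      have "(\<lambda>x. h x * complex_of_real (w x)) = (\<lambda>x. ?u x + s k x * complex_of_real (w x))"
        by simp
      then have "A (\<lambda>x. h x * complex_of_real (w x)) = A ?u + A (\<lambda>x. s k x * complex_of_real (w x))"
        by (simp only: A_add [OF iu i(2)])
      moreover have "(LINT x|lebesgue. g x * (h x * complex_of_real (w x)))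
          = (LINT x|lebesgue. g x * ?u x) + (LINT x|lebesgue. g x * (s k x * complex_of_real (w x)))"
        using g_bnd(1) [OF i(1)] g_bnd(1) [OF i(2)] by (simp add: right_diff_distrib)
      ultimately have "?B h = A ?u - (LINT x|lebesgue. g x * ?u x)"
        using lim.IH [of k] by simp
      also have "norm \<dots> \<le> M * ?D k + M * ?D k"
        by (intro order_trans [OF norm_triangle_ineq4] add_mono A_bound g_bnd iu)
      finally show ?thesis
        by simp
    qed
    moreover have lim0: "(\<lambda>k. 2 * M * ?D k) \<longlonglongrightarrow> 0"
      using tendsto_mult_left [OF D, of "2 * M"] by simp
    ultimately have "norm (?B h) \<le> 0"
      by (intro LIMSEQ_le_const [OF lim0] exI allI impI)
    then show ?case
      by simp
  qed
  show ?thesis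
  proof (rule that [OF _ g_le])
    show "represents T g"
      unfolding represents_def
    proof (intro conjI ballI)
      fix \<phi> :: "real^'n \<Rightarrow> complex"
      assume \<phi>: "\<phi> \<in> schwartz"
      note i = schwartz_integrable [OF \<phi>]
      show "integrable lebesgue (\<lambda>x. g x * \<phi> x)"
        by (rule g_bnd(1) [OF i])
      have eq: "\<phi> x / complex_of_real (w x) * complex_of_real (w x) = \<phi> x" for x
        using w_pos [of x] by simp
      have "integrable P (\<lambda>x. \<phi> x / complex_of_real (w x))"
        using i borel_measurable_integrable [OF i] eq
        by (subst P_int) (auto simp: scaleR_conv_of_real mult.commute)
      from main [OF this] show "T \<phi> = (LINT x|lebesgue. g x * \<phi> x)"
        unfolding eq by (simp add: A_T [OF \<phi>])
    qed (rule g_meas)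
  qed
qed

section \<open>Banach function norms and weak doubling\<close>

locale banach_function_space =
  fixes \<rho> :: "(real^'n::finite \<Rightarrow> ennreal) \<Rightarrow> ennreal"
  assumes norm_axioms: "banach_function_norm \<rho>"
begin

lemma eq_0_iff: "f \<in> borel_measurable lebesgue \<Longrightarrow> \<rho> f = 0 \<longleftrightarrow> (AE x in lebesgue. f x = 0)"
  using norm_axioms unfolding banach_function_norm_def by blast

lemma scale: "f \<in> borel_measurable lebesgue \<Longrightarrow> 0 \<le> a \<Longrightarrow> \<rho> (\<lambda>x. ennreal a * f x) = ennreal a * \<rho> f"
  using norm_axioms unfolding banach_function_norm_def by blast

lemma subadditive:
  "f \<in> borel_measurable lebesgue \<Longrightarrow> g \<in> borel_measurable lebesgue \<Longrightarrow> \<rho> (\<lambda>x. f x + g x) \<le> \<rho> f + \<rho> g"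
  using norm_axioms unfolding banach_function_norm_def by blast

lemma mono_AE:
  "f \<in> borel_measurable lebesgue \<Longrightarrow> g \<in> borel_measurable lebesgue \<Longrightarrow> AE x in lebesgue. g x \<le> f x \<Longrightarrow> \<rho> g \<le> \<rho> f"
  using norm_axioms unfolding banach_function_norm_def by blast

lemma finite_indicator:
  "E \<in> sets lebesgue \<Longrightarrow> emeasure lebesgue E < \<infinity> \<Longrightarrow> \<rho> (indicator E) < \<infinity>"
  using norm_axioms unfolding banach_function_norm_def by blast

lemma monotone_limit:
  assumes "\<And>j. F j \<in> borel_measurable lebesgue" "f \<in> borel_measurable lebesgue"
    and "\<And>x. incseq (\<lambda>j. F j x)" "\<And>x. (\<lambda>j. F j x) \<longlonglongrightarrow> f x"
  shows "(\<lambda>j. \<rho> (F j)) \<longlonglongrightarrow> \<rho> f"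
proof -
  have "AE x in lebesgue. incseq (\<lambda>j. F j x) \<and> (\<lambda>j. F j x) \<longlonglongrightarrow> f x"
    using assms by simp
  with assms(1,2) norm_axioms show ?thesis
    unfolding banach_function_norm_def by blast
qed

lemma norm_cong_AE:
  "f \<in> borel_measurable lebesgue \<Longrightarrow> g \<in> borel_measurable lebesgue \<Longrightarrow> AE x in lebesgue. f x = g x \<Longrightarrow> \<rho> f = \<rho> g"
  by (intro antisym mono_AE) (auto elim: AE_mp)

lemma norm_sum_le:
  assumes "finite Z" "\<And>z. z \<in> Z \<Longrightarrow> f z \<in> borel_measurable lebesgue" "\<And>z. z \<in> Z \<Longrightarrow> 0 \<le> c z"
  shows "\<rho> (\<lambda>x. \<Sum>z\<in>Z. ennreal (c z) * f z x) \<le> (\<Sum>z\<in>Z. ennreal (c z) * \<rho> (f z))"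
  using assms
proof (induction Z rule: finite_induct)
  case empty
  then show ?case
    using eq_0_iff [of "\<lambda>x. 0"] by simp
next
  case (insert z Z)
  then have "\<rho> (\<lambda>x. ennreal (c z) * f z x + (\<Sum>z\<in>Z. ennreal (c z) * f z x))
     \<le> \<rho> (\<lambda>x. ennreal (c z) * f z x) + \<rho> (\<lambda>x. \<Sum>z\<in>Z. ennreal (c z) * f z x)"
    by (intro subadditive borel_measurable_sum borel_measurable_times) auto
  also have "\<dots> \<le> ennreal (c z) * \<rho> (f z) + (\<Sum>z\<in>Z. ennreal (c z) * \<rho> (f z))"
    using insert by (intro add_mono) (auto simp: scale)
  finally show ?case
    using insert by simp
qed

text \<open>The Fatou property: infima over tails increase to the limit, and (A3) applies to them.
  The approximating sums to which it is applied need not converge monotonically.\<close>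

lemma fatou_bound:
  assumes F: "\<And>j. F j \<in> borel_measurable lebesgue" and lim: "\<And>x. (\<lambda>j. F j x) \<longlonglongrightarrow> f x"
    and B: "\<And>j. \<rho> (F j) \<le> B"
  shows "f \<in> borel_measurable lebesgue" "\<rho> f \<le> B"
proof -
  show fm: "f \<in> borel_measurable lebesgue"
    by (rule borel_measurable_LIMSEQ_order [OF lim F])
  define G where "G = (\<lambda>j x. INF k\<in>{j..}. F k x)"
  have G: "G j \<in> borel_measurable lebesgue" for j
    unfolding G_def by (intro borel_measurable_INF F) auto
  have "incseq (\<lambda>j. G j x)" for x
    unfolding G_def by (intro incseq_SucI INF_superset_mono) auto
  moreover have "(\<lambda>j. G j x) \<longlonglongrightarrow> f x" for x
  proof -
    have "(\<lambda>j. G j x) \<longlonglongrightarrow> (SUP j. G j x)"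
      by (rule LIMSEQ_SUP [OF \<open>incseq (\<lambda>j. G j x)\<close>])
    also have "(SUP j. G j x) = liminf (\<lambda>j. F j x)"
      by (simp add: G_def liminf_SUP_INF)
    also have "\<dots> = f x"
      using lim [of x] by (rule lim_imp_Liminf [OF sequentially_bot])
    finally show ?thesis .
  qed
  ultimately have "(\<lambda>j. \<rho> (G j)) \<longlonglongrightarrow> \<rho> f"
    by (intro monotone_limit G fm)
  moreover have "\<rho> (G j) \<le> B" for j
  proof -
    have "\<rho> (G j) \<le> \<rho> (F j)"
      by (intro mono_AE F G AE_I2) (auto simp: G_def intro: INF_lower)
    with B show ?thesis
      using order_trans by blast
  qed
  ultimately show "\<rho> f \<le> B"
    by (intro LIMSEQ_le_const2) auto
qed

section \<open>Norms of balls and the pigeonhole argument\<close>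

definition ball_norm :: "real^'n \<Rightarrow> real \<Rightarrow> ennreal" where
  "ball_norm y R = \<rho> (indicator (ball y R))"

lemma Xnorm_indicator_ball: "Xnorm \<rho> (indicator (ball y R)) = ball_norm y R"
proof -
  have "(\<lambda>x. ennreal (norm (indicator (ball y R) x :: complex))) = indicator (ball y R)"
    by (auto simp: fun_eq_iff indicator_def)
  then show ?thesis
    by (simp add: Xnorm_def ball_norm_def)
qed

lemma ball_norm_finite: "ball_norm y R < \<infinity>"
  unfolding ball_norm_def
  using lmeasurable_ball [of y R] by (intro finite_indicator) (auto simp: fmeasurable_def)

lemma ball_norm_pos:
  assumes "0 < R"
  shows "0 < ball_norm y R"
proof -
  have "\<not> (AE x in lebesgue. indicator (ball y R) x = (0::ennreal))"
  proof
    assume "AE x in lebesgue. indicator (ball y R) x = (0::ennreal)"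
    then have "AE x in lebesgue. x \<notin> ball y R"
      by (rule AE_mp) (auto simp: indicator_def intro!: AE_I2)
    then have "ball y R \<in> null_sets lebesgue"
      by (subst AE_iff_null_sets) auto
    then have "negligible (ball y R)"
      by (simp add: negligible_iff_null_sets)
    moreover have "\<not> negligible (ball y R)"
      by (rule open_not_negligible) (use assms in auto)
    ultimately show False
      by simp
  qed
  then have "ball_norm y R \<noteq> 0"
    unfolding ball_norm_def by (subst eq_0_iff) (auto intro!: borel_measurable_indicator borel_open lborelD)
  then show ?thesis
    by (simp add: zero_less_iff_neq_zero)
qed

text \<open>Weak doubling bounds a product of \<open>N\<close> consecutive ratios by a constant \<open>D < (1 + e) ^ N\<close>, so one
  of these ratios is at most \<open>1 + e\<close>.\<close>

lemma almost_constant_dilation: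
  assumes "weak_doubling \<rho>" "0 < (e::real)"
  obtains s t where "0 < s" "s < t"
    "\<exists>\<^sub>F R in at_top. \<exists>y. ball_norm y (t * R) \<le> ennreal (1 + e) * ball_norm y (s * R)"
proof -
  let ?Q = "\<lambda>\<tau> R. INF y. ball_norm y (\<tau> * R) / ball_norm y R"
  obtain \<tau> where \<tau>: "\<tau> > 1" "Liminf at_top (?Q \<tau>) < \<infinity>"
    using assms(1) unfolding weak_doubling_def Xnorm_indicator_ball by blast
  then have "\<not> (\<infinity> \<le> Liminf at_top (?Q \<tau>))"
    by (simp add: not_le)
  then obtain c where c: "c < \<infinity>" "\<exists>\<^sub>F R in at_top. ?Q \<tau> R \<le> c"
    unfolding le_Liminf_iff by (auto simp: not_eventually not_less)
  \<comment> \<open>The added 1 makes the bound by \<open>D\<close> strict and gives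
    \<open>D \<ge> 1\<close>, which excludes \<open>N = 0\<close> below.\<close>
  define D where "D = enn2real c + 1"
  have D: "c < ennreal D"
    using c(1) by (cases c) (auto simp: D_def ennreal_less_iff)
  obtain N where N: "D < (1 + e) ^ N"
    using real_arch_pow [of "1 + e" D] assms(2) by auto
  have "D \<ge> 1"
    by (simp add: D_def)
  then have "N \<noteq> 0"
    using N by (intro notI) simp
  \<comment> \<open>\<open>N\<close> equal steps from 1 to \<tau>, the factors by which
    \<open>R\<close> is multiplied.\<close>
  define r where "r = (\<lambda>k::nat. 1 + real k * (\<tau> - 1) / real N)"
  have r: "r 0 = 1" "r N = \<tau>" "0 < r k" "r k < r (Suc k)" for k
    using \<tau>(1) \<open>N \<noteq> 0\<close> by (auto simp: r_def divide_strict_right_mono add_pos_nonneg)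
  define P where "P = (\<lambda>k R. \<exists>y. ball_norm y (r (Suc k) * R) \<le> ennreal (1 + e) * ball_norm y (r k * R))"
  have "\<exists>\<^sub>F R in at_top. ?Q \<tau> R \<le> c \<and> 0 < R"
    using c(2) eventually_gt_at_top [of 0] by (rule frequently_eventually_frequently)
  then have "\<exists>\<^sub>F R in at_top. \<exists>k<N. P k R"
  proof (rule frequently_elim1)
    fix R :: real
    assume R: "?Q \<tau> R \<le> c \<and> 0 < R"
    then have "?Q \<tau> R < ennreal D"
      using D by (auto intro: le_less_trans)
    then obtain y where y: "ball_norm y (\<tau> * R) / ball_norm y R < ennreal D"
      by (auto simp: INF_less_iff)
    have b: "0 < ball_norm y R" "ball_norm y R < \<infinity>"
      using ball_norm_pos ball_norm_finite R by auto
    have "ball_norm y (\<tau> * R) = ball_norm y (\<tau> * R) / ball_norm y R * ball_norm y R"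
      using b by (simp add: ennreal_divide_times ennreal_divide_self)
    also have "\<dots> \<le> ennreal D * ball_norm y R"
      using y by (intro mult_right_mono) auto
    finally have up: "ball_norm y (\<tau> * R) \<le> ennreal D * ball_norm y R" .
    show "\<exists>k<N. P k R"
    proof (rule ccontr)
      assume "\<not> (\<exists>k<N. P k R)"
      then have *: "ennreal (1 + e) * ball_norm y (r k * R) \<le> ball_norm y (r (Suc k) * R)" if "k < N" for k
        using that unfolding P_def by (meson linear)
      have "ennreal ((1 + e) ^ k) * ball_norm y R \<le> ball_norm y (r k * R)" if "k \<le> N" for k
        using that
      proof (induction k)
        case 0
        then show ?case
          by (simp add: r)
      next
        case (Suc k)
        then have "ennreal (1 + e) * (ennreal ((1 + e) ^ k) * ball_norm y R) \<le> ennreal (1 + e) * ball_norm y (r k * R)"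
          by (intro mult_left_mono) auto
        also have "\<dots> \<le> ball_norm y (r (Suc k) * R)"
          using Suc by (intro *) auto
        finally show ?case
          using assms(2) by (simp add: ennreal_mult mult.assoc)
      qed
      from this [of N] have "ennreal ((1 + e) ^ N) * ball_norm y R \<le> ennreal D * ball_norm y R"
        using up r(2) by simp
      moreover have "ennreal D * ball_norm y R < ennreal ((1 + e) ^ N) * ball_norm y R"
        using N b \<open>D \<ge> 1\<close> by (intro ennreal_mult_strict_right_mono) (auto simp: ennreal_less_iff)
      ultimately show False
        by simp
    qed
  qed
  \<comment> \<open>The good index may vary with \<open>R\<close>, but one of finitely many recurs
    for arbitrarily large \<open>R\<close>. It has to be fixed because a single plateau is chosen
    before \<open>R\<close>.\<close>
  then have "\<exists>k<N. \<exists>\<^sub>F R in at_top. P k R"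
  proof (rule contrapos_pp)
    assume "\<not> (\<exists>k<N. \<exists>\<^sub>F R in at_top. P k R)"
    then have "\<forall>k\<in>{..<N}. \<forall>\<^sub>F R in at_top. \<not> P k R"
      by (auto simp: not_frequently)
    then have "\<forall>\<^sub>F R in at_top. \<forall>k\<in>{..<N}. \<not> P k R"
      by (intro eventually_ball_finite) auto
    then show "\<not> (\<exists>\<^sub>F R in at_top. \<exists>k<N. P k R)"
      unfolding not_frequently by (rule eventually_mono) auto
  qed
  then show ?thesis
    using that r(3,4) unfolding P_def by blast
qed

text \<open>Turning the quotient bound into a product requires a nonzero norm of \<open>u\<close>: a
  continuous function that is not identically 0 is nonzero on a nonempty open set, which is not
  negligible.\<close>

lemma Xnorm_multiplier_op_le:
  assumes "mult_norm \<rho> a = ennreal m" "u \<in> schwartz" "in_X \<rho> u" "u \<noteq> (\<lambda>x. 0)"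
  shows "Xnorm \<rho> (multiplier_op a u) \<le> ennreal m * Xnorm \<rho> u"
proof -
  have "Xnorm \<rho> (multiplier_op a u) / Xnorm \<rho> u \<le> ennreal m"
    unfolding assms(1) [symmetric] mult_norm_def using assms by (intro SUP_upper) auto
  moreover have "Xnorm \<rho> u \<noteq> 0"
  proof
    have um: "u \<in> borel_measurable lebesgue"
      using assms(3) by (simp add: in_X_def)
    assume "Xnorm \<rho> u = 0"
    then have "AE x in lebesgue. ennreal (norm (u x)) = 0"
      unfolding Xnorm_def using um by (subst (asm) eq_0_iff) auto
    then have ae: "AE x in lebesgue. u x = 0"
      by simp
    obtain x where x: "u x \<noteq> 0"
      using assms(4) by auto
    have "open (u -` (- {0}))"
      by (rule open_vimage) (auto intro: schwartz_continuous assms(2))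
    moreover have "u -` (- {0}) \<in> null_sets lebesgue"
      using ae um \<open>open (u -` (- {0}))\<close> by (subst AE_iff_null_sets) (auto elim: AE_mp simp: borel_open lborelD)
    then have "negligible (u -` (- {0}))"
      by (simp add: negligible_iff_null_sets)
    ultimately show False
      using open_not_negligible [of "u -` (- {0})"] x by blast
  qed
  moreover have "Xnorm \<rho> u < \<infinity>"
    using assms(3) by (simp add: in_X_def)
  ultimately show ?thesis
    by (metis ennreal_divide_times ennreal_divide_self infinity_ennreal_def less_top mult.right_neutral
        mult_right_mono zero_le)
qed

end

lemma fourier_mult_cis:
  fixes u :: "real^'n::finite \<Rightarrow> complex"
  assumes "u \<in> schwartz"
  shows "fourier u \<xi> * cis (x \<bullet> \<xi>) = cft (\<lambda>z. u (x - z)) \<xi>"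
proof -
  let ?h = "\<lambda>z. u (x - z) * cis (z \<bullet> \<xi>)"
  have "continuous_on UNIV ?h"
    by (intro continuous_intros continuous_on_compose2 [OF schwartz_continuous [OF assms, of UNIV]]) auto
  then have "cft (\<lambda>z. u (x - z)) \<xi> = (LINT z|lebesgue. ?h (x + (-1) *\<^sub>R z))"
    unfolding cft_def using integral_affine [of ?h "-1" x] by simp
  also have "\<dots> = (LINT z|lebesgue. u z * cis (- (z \<bullet> \<xi>)) * cis (x \<bullet> \<xi>))"
    by (simp add: inner_diff_left cis_mult mult.assoc)
  also have "\<dots> = fourier u \<xi> * cis (x \<bullet> \<xi>)"
    by (simp add: fourier_def)
  finally show ?thesis ..
qed

lemma schwartz_reflect: "u \<in> schwartz \<Longrightarrow> (\<lambda>z. u (x - z)) \<in> schwartz"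
  using schwartz_affine [of u "-1" x] by simp

section \<open>Multipliers\<close>

lemma ennreal_norm_measurable:
  fixes f :: "'a \<Rightarrow> complex"
  shows "f \<in> borel_measurable M \<Longrightarrow> (\<lambda>x. ennreal (norm (f x))) \<in> borel_measurable M"
  by measurable

context banach_function_space
begin

text \<open>For \<open>?u\<close>, the plateau \<eta> modulated by the frequency -h,
  \<open>H x h\<close> is (2 pi)^n times a unimodular factor times the explicit value of F^-1 a F at
  \<open>x\<close>. Since \<open>?u\<close> and \<eta> have the same absolute value, the bound is
  uniform in \<open>h\<close>.\<close>

lemma modulated_multiplier:
  assumes a: "tempered a" and m: "mult_norm \<rho> a = ennreal m" "0 \<le> m"
    and \<eta>: "\<eta> \<in> schwartz" "Xnorm \<rho> \<eta> < \<infinity>" "\<eta> \<noteq> (\<lambda>x. 0)"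
  defines "H \<equiv> \<lambda>x h. a (cft (\<lambda>z. \<eta> (x - z) * cis (h \<bullet> z)))"
  shows "(\<lambda>x. H x h) \<in> borel_measurable lebesgue"
    and "\<rho> (\<lambda>x. ennreal (norm (H x h))) \<le> ennreal ((2 * pi) ^ CARD('n) * m) * Xnorm \<rho> \<eta>"
proof -
  let ?p = "(2 * pi) ^ CARD('n)"
  let ?u = "\<lambda>x. \<eta> x * cis ((- h) \<bullet> x)"
  let ?G = "\<lambda>x. complex_of_real (1 / ?p) * a (\<lambda>\<xi>. fourier ?u \<xi> * cis (x \<bullet> \<xi>))"
  have u: "?u \<in> schwartz"
    by (rule schwartz_mult_cis [OF \<eta>(1)])
  have rep: "represents (dist_ifourier (dist_mult a (fourier ?u))) ?G"
    by (rule represents_multiplier [OF a u])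
  then have op: "represents (dist_ifourier (dist_mult a (fourier ?u))) (multiplier_op a ?u)"
    unfolding multiplier_op_def by (rule someI [where P = "represents (dist_ifourier (dist_mult a (fourier ?u)))"])
  have meas: "?G \<in> borel_measurable lebesgue" "multiplier_op a ?u \<in> borel_measurable lebesgue"
    using rep op by (simp_all add: represents_def)
  have GH: "?G x = of_real (1 / ?p) * (cis (- (h \<bullet> x)) * H x h)" for x
  proof -
    have "(\<lambda>\<xi>. fourier ?u \<xi> * cis (x \<bullet> \<xi>)) = cft (\<lambda>z. ?u (x - z))"
      by (rule ext) (rule fourier_mult_cis [OF u])
    also have "(\<lambda>z. ?u (x - z)) = (\<lambda>z. cis (- (h \<bullet> x)) * (\<eta> (x - z) * cis (h \<bullet> z)))"
      by (simp add: fun_eq_iff inner_diff_right cis_mult mult.assoc mult.left_commute [of "cis _"])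
    finally show ?thesis
      unfolding H_def cft_cmult
      by (simp add: tempered_cmult [OF a] schwartz_cft schwartz_mult_cis schwartz_reflect \<eta>(1))
  qed
  then have HG: "H x h = of_real ?p * (cis (h \<bullet> x) * ?G x)" for x
  proof -
    have "of_real ?p * (cis (h \<bullet> x) * ?G x)
        = (of_real ?p * of_real (1 / ?p)) * ((cis (h \<bullet> x) * cis (- (h \<bullet> x))) * H x h)"
      unfolding GH by (simp only: mult_ac)
    then show ?thesis
      by (simp add: cis_mult)
  qed
  show Hm: "(\<lambda>x. H x h) \<in> borel_measurable lebesgue"
    unfolding HG
    by (intro borel_measurable_times borel_measurable_const meas continuous_lebesgue_measurable continuous_intros)
  have "norm (H x h) = ?p * norm (?G x)" for x
    unfolding HG by (simp only: norm_mult norm_of_real norm_cis mult_1) simp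
  then have nH: "ennreal (norm (H x h)) = ennreal ?p * ennreal (norm (?G x))" for x
    by (simp only: ennreal_mult zero_le_power norm_ge_zero mult_nonneg_nonneg pi_ge_zero zero_le_numeral)
  have "\<rho> (\<lambda>x. ennreal (norm (H x h))) = ennreal ?p * Xnorm \<rho> ?G"
    unfolding nH Xnorm_def using meas(1) by (intro scale) auto
  also have "Xnorm \<rho> ?G = Xnorm \<rho> (multiplier_op a ?u)"
    unfolding Xnorm_def
  proof (rule norm_cong_AE)
    show "AE x in lebesgue. ennreal (norm (?G x)) = ennreal (norm (multiplier_op a ?u x))"
      using represents_unique [OF rep op] by (rule AE_mp) auto
  qed (use meas in \<open>auto intro: measurable_compose\<close>)
  also have "Xnorm \<rho> (multiplier_op a ?u) \<le> ennreal m * Xnorm \<rho> ?u"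
  proof (rule Xnorm_multiplier_op_le [OF m(1) u])
    show "in_X \<rho> ?u"
      using \<eta>(2) schwartz_measurable [OF u] by (simp add: in_X_def Xnorm_def norm_mult)
    show "?u \<noteq> (\<lambda>x. 0)"
      using \<eta>(3) by (auto simp: fun_eq_iff)
  qed
  also have "Xnorm \<rho> ?u = Xnorm \<rho> \<eta>"
    by (simp add: Xnorm_def norm_mult)
  finally show "\<rho> (\<lambda>x. ennreal (norm (H x h))) \<le> ennreal (?p * m) * Xnorm \<rho> \<eta>"
    using m(2) by (simp add: ennreal_mult mult.assoc mult_left_mono)
qed

text \<open>Minkowski's inequality for \<open>cft \<phi>\<close> as a superposition of modulations: it holds for the finite
  sums over a simple approximation of the identity, and (A3) carries it over to the limit.\<close>

lemma superposition_bound: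
  assumes a: "tempered a" and m: "mult_norm \<rho> a = ennreal m" "0 \<le> m"
    and \<eta>: "\<eta> \<in> schwartz" "Xnorm \<rho> \<eta> < \<infinity>" "\<eta> \<noteq> (\<lambda>x. 0)" and \<phi>: "\<phi> \<in> schwartz"
  defines "L \<equiv> \<lambda>x. ennreal (norm (a (cft (\<lambda>z. \<eta> (x - z) * cft \<phi> z))))"
  shows "L \<in> borel_measurable lebesgue"
    and "\<rho> L \<le> ennreal ((2 * pi) ^ CARD('n) * m * (LINT x|lebesgue. norm (\<phi> x))) * Xnorm \<rho> \<eta>"
proof -
  let ?H = "\<lambda>x h. a (cft (\<lambda>z. \<eta> (x - z) * cis (h \<bullet> z)))"
  let ?K = "ennreal ((2 * pi) ^ CARD('n) * m) * Xnorm \<rho> \<eta>"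
  note Hm = modulated_multiplier(1) [OF a m \<eta>] and Hle = modulated_multiplier(2) [OF a m \<eta>]
  note b = tempered_cft [OF a]
  obtain q :: "nat \<Rightarrow> real^'n \<Rightarrow> real^'n" where q: "\<And>k. simple_function lebesgue (q k)"
      "\<And>x. (\<lambda>k. q k x) \<longlonglongrightarrow> x" "\<And>k x. norm (q k x) \<le> 2 * norm x"
    using simple_approx_identity by blast
  have q_fin: "finite (range (q k))" for k
    using simple_functionD(1) [OF q(1), of k] by simp
  note \<phi>i = schwartz_integrable [OF \<phi>]
  note sc = integral_simple_compose [OF q(1) \<phi>i space_lebesgue_UNIV]
  define c where "c = (\<lambda>k z. LINT x|lebesgue. indicator (q k -` {z}) x *\<^sub>R \<phi> x)"
  define F where "F = (\<lambda>k x. ennreal (norm (LINT h|lebesgue. \<phi> h * ?H x (q k h))))"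
  have F_eq: "F k x = ennreal (norm (\<Sum>z\<in>range (q k). c k z * ?H x z))" for k x
    unfolding F_def c_def by (subst sc(2)) (rule refl)
  have F_meas: "F k \<in> borel_measurable lebesgue" for k
    unfolding F_eq
    by (intro ennreal_norm_measurable borel_measurable_sum
        borel_measurable_times borel_measurable_const Hm)
  \<comment> \<open>The level sets of \<open>q k\<close> are disjoint, so the coefficients have
    total size at most the L^1 norm of \<phi>.\<close>
  have c_sum: "(\<Sum>z\<in>range (q k). norm (c k z)) \<le> (LINT x|lebesgue. norm (\<phi> x))" for k
  proof -
    have "(\<Sum>z\<in>range (q k). norm (c k z)) \<le> (\<Sum>z\<in>range (q k). (LINT x|lebesgue. indicator (q k -` {z}) x *\<^sub>R norm (\<phi> x)) * 1)"
    proof (rule sum_mono)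
      fix z
      have "norm (c k z) \<le> (LINT x|lebesgue. norm (indicator (q k -` {z}) x *\<^sub>R \<phi> x))"
        unfolding c_def by (rule integral_norm_bound)
      then show "norm (c k z) \<le> (LINT x|lebesgue. indicator (q k -` {z}) x *\<^sub>R norm (\<phi> x)) * 1"
        by simp
    qed
    also have "\<dots> = (LINT x|lebesgue. norm (\<phi> x) * 1)"
      by (rule integral_simple_compose(2) [OF q(1) integrable_norm [OF \<phi>i] space_lebesgue_UNIV, symmetric])
    finally show ?thesis
      by simp
  qed
  have F_le: "\<rho> (F k) \<le> ennreal (LINT x|lebesgue. norm (\<phi> x)) * ?K" for k
  proof -
    have "\<rho> (F k) \<le> \<rho> (\<lambda>x. \<Sum>z\<in>range (q k). ennreal (norm (c k z)) * ennreal (norm (?H x z)))"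
    proof (rule mono_AE [OF _ F_meas AE_I2])
      fix x
      have "norm (\<Sum>z\<in>range (q k). c k z * ?H x z) \<le> (\<Sum>z\<in>range (q k). norm (c k z) * norm (?H x z))"
        by (rule order_trans [OF norm_sum]) (simp add: norm_mult)
      then show "F k x \<le> (\<Sum>z\<in>range (q k). ennreal (norm (c k z)) * ennreal (norm (?H x z)))"
        unfolding F_eq by (simp add: ennreal_mult [symmetric] sum_ennreal ennreal_leI)
    qed (intro borel_measurable_sum borel_measurable_times_ennreal borel_measurable_const
        ennreal_norm_measurable Hm)
    also have "\<dots> \<le> (\<Sum>z\<in>range (q k). ennreal (norm (c k z)) * \<rho> (\<lambda>x. ennreal (norm (?H x z))))"
      by (intro norm_sum_le q_fin ennreal_norm_measurable Hm) auto
    also have "\<dots> \<le> (\<Sum>z\<in>range (q k). ennreal (norm (c k z)) * ?K)"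
      by (intro sum_mono mult_left_mono Hle) auto
    also have "\<dots> = ennreal (\<Sum>z\<in>range (q k). norm (c k z)) * ?K"
      by (simp add: sum_distrib_right [symmetric] sum_ennreal)
    also have "\<dots> \<le> ennreal (LINT x|lebesgue. norm (\<phi> x)) * ?K"
      using c_sum by (intro mult_right_mono ennreal_leI) auto
    finally show ?thesis .
  qed
  \<comment> \<open>Pointwise in \<open>x\<close>, the sums converge by the exchange of integral and
    distribution, used for \<open>a\<close> composed with \<open>cft\<close> and with the reflected
    translate of \<eta> in the role of \<open>v\<close>.\<close>
  have F_lim: "(\<lambda>k. F k x) \<longlonglongrightarrow> L x" for x
  proof -
    have v: "(\<lambda>z. \<eta> (x - z)) \<in> schwartz"
      by (rule schwartz_reflect [OF \<eta>(1)])
    have "(\<lambda>k. LINT h|lebesgue. \<phi> h * ?H x (q k h)) \<longlonglongrightarrow> (LINT h|lebesgue. \<phi> h * ?H x h)"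
      by (rule tempered_simple_limit(2) [OF b v \<phi> q])
    also have "(LINT h|lebesgue. \<phi> h * ?H x h) = a (cft (\<lambda>z. \<eta> (x - z) * cft \<phi> z))"
      by (rule tempered_integral_exchange(2) [OF b v \<phi>, symmetric])
    finally show ?thesis
      unfolding F_def L_def by (intro tendsto_ennrealI tendsto_norm)
  qed
  show "L \<in> borel_measurable lebesgue"
    by (rule fatou_bound(1) [OF F_meas F_lim F_le])
  have "\<rho> L \<le> ennreal (LINT x|lebesgue. norm (\<phi> x)) * ?K"
    by (rule fatou_bound(2) [OF F_meas F_lim F_le])
  also have "\<dots> = ennreal ((2 * pi) ^ CARD('n) * m * (LINT x|lebesgue. norm (\<phi> x))) * Xnorm \<rho> \<eta>"
    using m(2) by (simp add: ennreal_mult mult_ac)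
  finally show "\<rho> L \<le> ennreal ((2 * pi) ^ CARD('n) * m * (LINT x|lebesgue. norm (\<phi> x))) * Xnorm \<rho> \<eta>" .
qed

end

text \<open>The complement vanishes for |z| \<le> d R, and beyond that 1 \<le> |z| / (d R): allowing
  linear growth in \<open>z\<close> buys the factor 1 / R. Derivatives gain at least one factor 1 /
  R from the dilation.\<close>

lemma plateau_complement_small:
  fixes \<theta> :: "real^'n::finite \<Rightarrow> complex"
  assumes \<theta>: "\<theta> \<in> schwartz" "\<And>x. norm x \<le> s + d \<Longrightarrow> \<theta> x = 1" "\<And>x. \<exists>r\<in>{0..1}. \<theta> x = complex_of_real r"
    and d: "0 < d" and B: "schwartz_le N \<theta> B" and R: "1 \<le> R" and x: "norm (x - y) \<le> s * R"
  shows "growth_le N 1 (\<lambda>z. 1 - \<theta> ((- (1 / R)) *\<^sub>R z + (1 / R) *\<^sub>R (x - y))) ((B + 1 / d) / R)"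
  unfolding growth_le_def
proof (intro allI impI)
  fix "is" :: "'n list" and z :: "real^'n"
  assume len: "length is \<le> N"
  let ?w = "(- (1 / R)) *\<^sub>R z + (1 / R) *\<^sub>R (x - y)"
  let ?v = "\<lambda>z. \<theta> ((- (1 / R)) *\<^sub>R z + (1 / R) *\<^sub>R (x - y))"
  have B0: "0 \<le> B"
    by (rule schwartz_le_nonneg [OF B])
  show "norm (pderivs is (\<lambda>z. 1 - ?v z) z) \<le> (B + 1 / d) / R * (1 + norm z) ^ 1"
  proof (cases "is")
    case Nil
    have *: "norm (1 - \<theta> ?w) \<le> (1 / d) / R * norm z"
    proof (cases "norm z \<le> d * R")
      case True
      have "norm ?w \<le> norm z / R + norm (x - y) / R"
        using R norm_triangle_ineq [of "(- (1 / R)) *\<^sub>R z" "(1 / R) *\<^sub>R (x - y)"] by simp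
      also have "\<dots> \<le> d + s"
        using True x R by (intro add_mono) (auto simp: field_simps)
      finally have "\<theta> ?w = 1"
        by (intro \<theta>(2)) simp
      then show ?thesis
        using d R by simp
    next
      case False
      have "norm (1 - \<theta> ?w) \<le> 1"
      proof -
        obtain r where "0 \<le> r" "r \<le> 1" "\<theta> ?w = complex_of_real r"
          using \<theta>(3) [of ?w] by auto
        then have "1 - \<theta> ?w = complex_of_real (1 - r)"
          by simp
        with \<open>0 \<le> r\<close> \<open>r \<le> 1\<close> show ?thesis
          by (simp only: norm_of_real)
      qed
      also have "1 \<le> (1 / d) / R * norm z"
        using False d R by (simp add: field_simps)
      finally show ?thesis .
    qed
    also have "\<dots> \<le> (B + 1 / d) / R * (1 + norm z)"
      using B0 d R by (intro mult_mono divide_right_mono) auto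
    finally show ?thesis
      using Nil by simp
  next
    case (Cons i js)
    have "pderivs is (\<lambda>z. 1 - ?v z) z = - (complex_of_real (- (1 / R)) ^ length is * pderivs is \<theta> ?w)"
      unfolding pderivs_diff [OF smooth_fun_const smooth_fun_affine [OF schwartz_smooth [OF \<theta>(1)]]]
        pderivs_affine [OF schwartz_smooth [OF \<theta>(1)]] pderivs_const
      using Cons by simp
    then have "norm (pderivs is (\<lambda>z. 1 - ?v z) z) = (1 / R) ^ length is * norm (pderivs is \<theta> ?w)"
      using R by (simp add: norm_mult norm_power norm_divide)
    also have "\<dots> \<le> (1 / R) * B"
    proof (rule mult_mono)
      show "(1 / R) ^ length is \<le> 1 / R"
        using R power_decreasing [of 1 "length is" "1 / R"] Cons by simp
      have "1 * norm (pderivs is \<theta> ?w) \<le> (1 + norm ?w) ^ N * norm (pderivs is \<theta> ?w)"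
        by (intro mult_right_mono) auto
      with schwartz_leD [OF B len, of ?w] show "norm (pderivs is \<theta> ?w) \<le> B"
        by simp
    qed (use R in auto)
    also have "\<dots> \<le> (B + 1 / d) / R * (1 + norm z)"
    proof -
      have "B / R * 1 \<le> (B + 1 / d) / R * (1 + norm z)"
        using B0 d R by (intro mult_mono divide_right_mono) auto
      then show ?thesis
        by simp
    qed
    finally show ?thesis
      by simp
  qed
qed

context banach_function_space
begin

lemma multiplier_L1_bound_eps:
  assumes wd: "weak_doubling \<rho>" and a: "tempered a" and m: "mult_norm \<rho> a = ennreal m" "0 \<le> m"
    and \<psi>: "\<psi> \<in> schwartz" and e: "0 < (e::real)"
  shows "norm (a \<psi>) \<le> (1 + e) * (m * (LINT x|lebesgue. norm (\<psi> x))) + e"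
proof -
  let ?p = "(2 * pi) ^ CARD('n)"
  let ?I = "LINT x|lebesgue. norm (\<psi> x)"
  have p: "0 < ?p"
    by simp
  have I: "0 \<le> ?I"
    by (intro Bochner_Integration.integral_nonneg) simp
  \<comment> \<open>Applying \<open>cft\<close> twice reflects a function, so \<psi> is reflected in
    advance.\<close>
  define \<phi> where "\<phi> = (\<lambda>x. \<psi> (- x))"
  have \<phi>: "\<phi> \<in> schwartz"
    unfolding \<phi>_def using schwartz_reflect [OF \<psi>, of 0] by simp
  have \<phi>I: "(LINT x|lebesgue. norm (\<phi> x)) = ?I"
  proof -
    have "(LINT x|lebesgue. complex_of_real (norm (\<psi> x))) = (LINT x|lebesgue. complex_of_real (norm (\<phi> x)))"
      unfolding \<phi>_def using integral_affine [of "\<lambda>x. complex_of_real (norm (\<psi> x))" "-1" 0]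
      by (simp add: continuous_intros schwartz_continuous [OF \<psi>])
    then show ?thesis
      by simp
  qed
  have inv: "cft (cft \<phi>) = (\<lambda>x. of_real ?p * \<psi> x)"
    using cft_inversion [OF \<phi>, of "- _"] by (simp add: fun_eq_iff \<phi>_def)
  obtain s t where st: "0 < s" "s < t"
    "\<exists>\<^sub>F R in at_top. \<exists>y. ball_norm y (t * R) \<le> ennreal (1 + e) * ball_norm y (s * R)"
    using almost_constant_dilation [OF wd e] by blast
  \<comment> \<open>Half of the gap: the plateau is 1 up to radius \<open>s + d\<close>, which
    leaves room for translations by up to \<open>d * R\<close> after dilation.\<close>
  define d where "d = (t - s) / 2"
  have d: "0 < d" "s + d < t" "0 < s + d"
    using st by (auto simp: d_def field_simps)
  obtain \<theta> :: "real^'n \<Rightarrow> complex" where \<theta>: "smooth_fun \<theta>" "\<And>x. norm x \<le> s + d \<Longrightarrow> \<theta> x = 1"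
    "\<And>x. norm x \<ge> t \<Longrightarrow> \<theta> x = 0" "\<And>x. \<exists>r\<in>{0..1}. \<theta> x = complex_of_real r"
    using exists_plateau [OF d(3,2)] by blast
  have \<theta>S: "\<theta> \<in> schwartz"
    by (rule compact_support_schwartz [OF \<theta>(1,3)])
  obtain C N where C: "0 \<le> C"
    "\<And>G e. slow_growth G \<Longrightarrow> growth_le N 1 G e \<Longrightarrow> 0 \<le> e \<Longrightarrow> norm (a (cft (\<lambda>\<xi>. cft \<phi> \<xi> * G \<xi>))) \<le> C * e"
    using tempered_mult_boundE [OF tempered_cft [OF a] schwartz_cft [OF \<phi>]] by blast
  obtain B where B: "schwartz_le N \<theta> B"
    using schwartz_le_exists [OF \<theta>S] by blast
  \<comment> \<open>\<open>C\<close>, \<open>N\<close>, \<open>B\<close> and \<open>d\<close> do not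
    depend on \<open>R\<close> or \<open>y\<close>, so the subtracted error tends to 0 as
    \<open>R\<close> grows.\<close>
  have key: "?p * norm (a \<psi>) - C * ((B + 1 / d) / R) \<le> ?p * m * ?I * (1 + e)"
    if R: "1 \<le> R" and y: "ball_norm y (t * R) \<le> ennreal (1 + e) * ball_norm y (s * R)" for R y
  proof -
    define A where "A = ?p * norm (a \<psi>) - C * ((B + 1 / d) / R)"
    define \<eta> where "\<eta> = (\<lambda>x. \<theta> ((1 / R) *\<^sub>R (x - y)))"
    have \<eta>: "\<eta> \<in> schwartz"
      using schwartz_affine [OF \<theta>S, of "1 / R" "- ((1 / R) *\<^sub>R y)"] R
      by (simp add: \<eta>_def scaleR_diff_right)
    have \<eta>_le: "Xnorm \<rho> \<eta> \<le> ball_norm y (t * R)"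
      unfolding Xnorm_def ball_norm_def
    proof (rule mono_AE [OF _ _ AE_I2])
      show "indicator (ball y (t * R)) \<in> borel_measurable lebesgue"
        by (auto intro!: borel_measurable_indicator borel_open lborelD)
      show "(\<lambda>x. ennreal (norm (\<eta> x))) \<in> borel_measurable lebesgue"
        using schwartz_measurable [OF \<eta>] by auto
      fix x
      show "ennreal (norm (\<eta> x)) \<le> indicator (ball y (t * R)) x"
      proof (cases "x \<in> ball y (t * R)")
        case True
        obtain r where "0 \<le> r" "r \<le> 1" "\<eta> x = complex_of_real r"
          using \<theta>(4) unfolding \<eta>_def by (metis atLeastAtMost_iff)
        with True show ?thesis
          by (simp add: ennreal_le_1)
      next
        case False
        then have "t \<le> norm (x - y) / R"
          using R by (simp add: dist_norm norm_minus_commute field_simps)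
        then have "t \<le> norm ((1 / R) *\<^sub>R (x - y))"
          using R unfolding norm_scaleR by simp
        then show ?thesis
          by (simp add: \<eta>_def \<theta>(3))
      qed
    qed
    then have \<eta>_fin: "Xnorm \<rho> \<eta> < \<infinity>"
      using ball_norm_finite le_less_trans by blast
    have \<eta>_nz: "\<eta> \<noteq> (\<lambda>x. 0)"
    proof
      assume "\<eta> = (\<lambda>x. 0)"
      then have "\<eta> y = 0"
        by simp
      moreover have "\<eta> y = 1"
        using d by (simp add: \<eta>_def \<theta>(2))
      ultimately show False
        by simp
    qed
    let ?L = "\<lambda>x. ennreal (norm (a (cft (\<lambda>z. \<eta> (x - z) * cft \<phi> z))))"
    note sup = superposition_bound [OF a m \<eta> \<eta>_fin \<eta>_nz \<phi>, unfolded \<phi>I]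
    \<comment> \<open>On the inner ball \<open>a\<close> is small on the part cut off by the
      plateau, and inversion evaluates the uncut term as (2 pi)^n times
      \<open>a \<psi>\<close>.\<close>
    have A_le: "A \<le> norm (a (cft (\<lambda>z. \<eta> (x - z) * cft \<phi> z)))" if x: "x \<in> ball y (s * R)" for x
    proof -
      let ?G = "\<lambda>z. 1 - \<theta> ((- (1 / R)) *\<^sub>R z + (1 / R) *\<^sub>R (x - y))"
      have G: "?G z = 1 - \<eta> (x - z)" for z
        by (simp add: \<eta>_def scaleR_diff_right algebra_simps)
      have v: "(\<lambda>z. \<eta> (x - z)) \<in> schwartz"
        by (rule schwartz_reflect [OF \<eta>])
      have G_slow: "slow_growth ?G"
        unfolding G by (intro slow_growth_diff slow_growth_const schwartz_slow_growth v)
      have "growth_le N 1 ?G ((B + 1 / d) / R)"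
        by (rule plateau_complement_small [OF \<theta>S \<theta>(2,4) d(1) B R])
           (use x in \<open>auto simp: dist_norm norm_minus_commute\<close>)
      moreover have "0 \<le> (B + 1 / d) / R"
        using R d schwartz_le_nonneg [OF B] by simp
      ultimately have "norm (a (cft (\<lambda>\<xi>. cft \<phi> \<xi> * ?G \<xi>))) \<le> C * ((B + 1 / d) / R)"
        by (rule C(2) [OF G_slow])
      moreover have "a (cft (\<lambda>\<xi>. cft \<phi> \<xi> * ?G \<xi>)) = of_real ?p * a \<psi> - a (cft (\<lambda>z. \<eta> (x - z) * cft \<phi> z))"
      proof -
        note b = tempered_cft [OF a]
        have "(\<lambda>\<xi>. cft \<phi> \<xi> * ?G \<xi>) = (\<lambda>\<xi>. cft \<phi> \<xi> - \<eta> (x - \<xi>) * cft \<phi> \<xi>)"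
          unfolding G by (simp add: algebra_simps)
        then have "a (cft (\<lambda>\<xi>. cft \<phi> \<xi> * ?G \<xi>)) = a (cft (cft \<phi>)) - a (cft (\<lambda>z. \<eta> (x - z) * cft \<phi> z))"
          using tempered_diff [OF b schwartz_cft [OF \<phi>] schwartz_mult_slow_growth [OF v schwartz_slow_growth [OF schwartz_cft [OF \<phi>]]]]
          by simp
        then show ?thesis
          by (simp only: inv tempered_cmult [OF a \<psi>])
      qed
      ultimately have "norm (of_real ?p * a \<psi> - a (cft (\<lambda>z. \<eta> (x - z) * cft \<phi> z))) \<le> C * ((B + 1 / d) / R)"
        by (simp only:)
      moreover have "norm (of_real ?p * a \<psi>) = ?p * norm (a \<psi>)"
        by (simp only: norm_mult norm_of_real) simp
      ultimately show ?thesis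
        using norm_triangle_ineq2 [of "of_real ?p * a \<psi>" "a (cft (\<lambda>z. \<eta> (x - z) * cft \<phi> z))"]
        unfolding A_def by linarith
    qed
    show ?thesis
    \<comment> \<open>\<open>ennreal\<close> truncates negative numbers, so comparing norms is
      informative only for nonnegative \<open>A\<close>; otherwise the claim is immediate.\<close>
    proof (cases "0 \<le> A")
      case True
      have "ennreal A * ball_norm y (s * R) = \<rho> (\<lambda>x. ennreal A * indicator (ball y (s * R)) x)"
        unfolding ball_norm_def using True
        by (intro scale [symmetric]) (auto intro!: borel_measurable_indicator borel_open lborelD)
      also have "\<dots> \<le> \<rho> ?L"
      proof (rule mono_AE [OF sup(1) _ AE_I2])
        show "(\<lambda>x. ennreal A * indicator (ball y (s * R)) x) \<in> borel_measurable lebesgue"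
          by (auto intro!: borel_measurable_times_ennreal borel_measurable_indicator borel_open lborelD)
        show "ennreal A * indicator (ball y (s * R)) x \<le> ?L x" for x
          using A_le [of x] by (cases "x \<in> ball y (s * R)") (auto intro: ennreal_leI)
      qed
      also have "\<dots> \<le> ennreal (?p * m * ?I) * Xnorm \<rho> \<eta>"
        by (rule sup(2))
      also have "\<dots> \<le> ennreal (?p * m * ?I) * (ennreal (1 + e) * ball_norm y (s * R))"
        using order_trans [OF \<eta>_le y] by (intro mult_left_mono) auto
      also have "\<dots> = ennreal (?p * m * ?I * (1 + e)) * ball_norm y (s * R)"
        using e m I by (simp add: ennreal_mult mult.assoc)
      finally have le: "ennreal A * ball_norm y (s * R) \<le> ennreal (?p * m * ?I * (1 + e)) * ball_norm y (s * R)" .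
      have nn: "0 \<le> ?p * m * ?I * (1 + e)"
        using e m I by simp
      have b: "0 < ball_norm y (s * R)" "ball_norm y (s * R) < \<infinity>"
        using ball_norm_pos [of "s * R" y] ball_norm_finite st R by auto
      have "A \<le> ?p * m * ?I * (1 + e)"
      proof (rule ccontr)
        assume "\<not> A \<le> ?p * m * ?I * (1 + e)"
        then have "ennreal (?p * m * ?I * (1 + e)) * ball_norm y (s * R) < ennreal A * ball_norm y (s * R)"
          using b nn by (intro ennreal_mult_strict_right_mono) (auto simp: ennreal_less_iff)
        with le show False
          by simp
      qed
      then show ?thesis
        by (simp add: A_def)
    next
      case False
      moreover have "0 \<le> ?p * m * ?I * (1 + e)"
        using e m I by simp
      ultimately show ?thesis
        by (simp add: A_def)
    qed
  qed
  have lim: "((\<lambda>R. C * ((B + 1 / d) / R)) \<longlongrightarrow> 0) at_top"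
    using tendsto_mult_left [OF tendsto_divide_0 [OF tendsto_const filterlim_at_top_imp_at_infinity [OF filterlim_ident]], of C "B + 1 / d"]
    by simp
  \<comment> \<open>The error is eventually small and the comparison of balls holds for arbitrarily
    large \<open>R\<close>, so one \<open>R\<close> satisfies both.\<close>
  have "\<forall>\<^sub>F R in at_top. 1 \<le> R \<and> C * ((B + 1 / d) / R) < e * ?p"
    by (intro eventually_conj eventually_ge_at_top order_tendstoD(2) [OF lim]) (use e p in simp)
  from frequently_ex [OF frequently_eventually_frequently [OF st(3) this]]
  obtain R y where R: "1 \<le> R" "C * ((B + 1 / d) / R) < e * ?p"
    "ball_norm y (t * R) \<le> ennreal (1 + e) * ball_norm y (s * R)"
    by auto
  have "?p * norm (a \<psi>) \<le> ?p * ((1 + e) * (m * ?I) + e)"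
    using key [OF R(1,3)] R(2) by (simp add: algebra_simps)
  then show ?thesis
    using p by (simp only: mult_le_cancel_left_pos)
qed

lemma multiplier_L1_bound:
  assumes "weak_doubling \<rho>" "tempered a" "mult_norm \<rho> a = ennreal m" "0 \<le> m" "\<psi> \<in> schwartz"
  shows "norm (a \<psi>) \<le> m * (LINT x|lebesgue. norm (\<psi> x))"
proof (rule tendsto_lowerbound)
  let ?I = "LINT x|lebesgue. norm (\<psi> x)"
  have "((\<lambda>e. (1 + e) * (m * ?I) + e) \<longlongrightarrow> (1 + 0) * (m * ?I) + 0) (at_right 0)"
    by (intro tendsto_intros)
  then show "((\<lambda>e. (1 + e) * (m * ?I) + e) \<longlongrightarrow> m * ?I) (at_right 0)"
    by simp
  show "\<forall>\<^sub>F e in at_right 0. norm (a \<psi>) \<le> (1 + e) * (m * ?I) + e"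
    using multiplier_L1_bound_eps [OF assms] by (simp add: eventually_at_right_less eventually_mono [OF eventually_at_right_less])
qed simp

lemma multiplier_in_Linf:
  assumes "weak_doubling \<rho>" "is_multiplier \<rho> a"
  shows "in_Linf a \<and> Linf_norm a \<le> enn2ereal (mult_norm \<rho> a)"
proof -
  obtain m where m: "0 \<le> m" "mult_norm \<rho> a = ennreal m"
    using assms(2) by (cases "mult_norm \<rho> a") (auto simp: is_multiplier_def)
  have a: "tempered a"
    using assms(2) by (simp add: is_multiplier_def)
  obtain f where f: "represents a f" "AE x in lebesgue. norm (f x) \<le> m"
    using L1_dual_schwartz [OF a m(1) multiplier_L1_bound [OF assms(1) a m(2,1)]] by blast
  have "esssup lebesgue (\<lambda>x. ereal (norm (f x))) \<le> ereal m"
    by (rule esssup_I) (use f in \<open>auto simp: represents_def\<close>)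
  moreover have "Linf_norm a \<le> esssup lebesgue (\<lambda>x. ereal (norm (f x)))"
    unfolding Linf_norm_def using f(1) by (intro INF_lower) simp
  ultimately show ?thesis
    using f(1) m by (auto simp: in_Linf_def enn2ereal_ennreal intro: le_less_trans order_trans)
qed

end

section \<open>The constant multiplier 1 and optimality\<close>

lemma tempered_integral: "tempered (\<lambda>\<phi>. LINT x|lebesgue. \<phi> (x::real^'n::finite) :: complex)"
proof (rule temperedI)
  fix f :: "real^'n \<Rightarrow> complex" and B
  assume f: "f \<in> schwartz" and B: "schwartz_le (2 * CARD('n)) f B"
  have "norm (LINT x|lebesgue. f x) \<le> (LINT x|lebesgue. norm (f x))"
    by (rule integral_norm_bound)
  also have "\<dots> \<le> B * (LINT x|lebesgue. 1 / (1 + norm (x::real^'n)) ^ (2 * CARD('n)))"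
    using schwartz_leD [OF B, of "[]"] by (intro integrable_decay_bound schwartz_measurable f) auto
  finally show "norm (LINT x|lebesgue. f x) \<le> (LINT x|lebesgue. 1 / (1 + norm (x::real^'n)) ^ (2 * CARD('n))) * B"
    by (simp add: mult.commute)
qed (auto simp: schwartz_integrable)

text \<open>The multiplication formula moves the transform from \<open>u\<close> to the inverse
  transform of \<phi>, where inversion returns \<phi>.\<close>

lemma represents_identity_multiplier:
  fixes u :: "real^'n::finite \<Rightarrow> complex"
  assumes u: "u \<in> schwartz"
  shows "represents (dist_ifourier (dist_mult (\<lambda>\<phi>. LINT x|lebesgue. \<phi> x) (fourier u))) u"
  unfolding represents_def
proof (intro conjI ballI)
  fix \<phi> :: "real^'n \<Rightarrow> complex"
  assume \<phi>: "\<phi> \<in> schwartz"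
  show "integrable lebesgue (\<lambda>x. u x * \<phi> x)"
    by (intro schwartz_integrable schwartz_mult_slow_growth schwartz_slow_growth u \<phi>)
  let ?w = "ifourier \<phi>"
  have w: "?w \<in> schwartz"
    unfolding ifourier_eq_cft by (intro schwartz_cmult schwartz_cft \<phi>)
  have "(LINT \<xi>|lebesgue. (LINT x|lebesgue. u x * cis (- (x \<bullet> \<xi>))) * ?w \<xi>)
      = (LINT x|lebesgue. u x * (LINT \<xi>|lebesgue. ?w \<xi> * cis (- (x \<bullet> \<xi>))))"
    by (rule fubini_kernel) (auto intro!: schwartz_continuous schwartz_integrable u w continuous_intros)
  moreover have "(LINT \<xi>|lebesgue. ?w \<xi> * cis (- (x \<bullet> \<xi>))) = \<phi> x" for x
  proof -
    have "(LINT \<xi>|lebesgue. ?w \<xi> * cis (- (x \<bullet> \<xi>))) = cft ?w (- x)"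
      by (simp add: cft_def inner_commute)
    also have "\<dots> = \<phi> x"
      unfolding ifourier_eq_cft cft_cmult cft_inversion [OF \<phi>] by simp
    finally show ?thesis .
  qed
  ultimately show "dist_ifourier (dist_mult (\<lambda>\<phi>. LINT x|lebesgue. \<phi> x) (fourier u)) \<phi> = (LINT x|lebesgue. u x * \<phi> x)"
    by (simp add: dist_ifourier_def dist_mult_def fourier_def)
qed (rule schwartz_measurable [OF u])

text \<open>By uniqueness every representing function equals 1 almost everywhere, and an essential
  supremum below 1 would make the whole space a null set.\<close>

lemma Linf_norm_integral_ge_1: "1 \<le> Linf_norm (\<lambda>\<phi>. LINT x|lebesgue. \<phi> (x::real^'n::finite) :: complex)"
  unfolding Linf_norm_def
proof (rule INF_greatest)
  fix f
  assume "f \<in> {f. represents (\<lambda>\<phi>. LINT x|lebesgue. \<phi> (x::real^'n) :: complex) f}"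
  then have f: "represents (\<lambda>\<phi>. LINT x|lebesgue. \<phi> (x::real^'n) :: complex) f"
    by simp
  have "represents (\<lambda>\<phi>. LINT x|lebesgue. \<phi> (x::real^'n) :: complex) (\<lambda>x. 1)"
    by (simp add: represents_def schwartz_integrable)
  from represents_unique [OF f this] have 1: "AE x in lebesgue. f x = 1" .
  have fm: "(\<lambda>x. ereal (norm (f x))) \<in> borel_measurable lebesgue"
    using f by (auto simp: represents_def)
  show "1 \<le> esssup lebesgue (\<lambda>x. ereal (norm (f x)))"
  proof (rule ccontr)
    assume *: "\<not> 1 \<le> esssup lebesgue (\<lambda>x. ereal (norm (f x)))"
    have "AE x in lebesgue. ereal (norm (f x)) \<le> esssup lebesgue (\<lambda>x. ereal (norm (f x)))"
      by (rule esssup_AE)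
    with 1 have "AE x in lebesgue. x \<notin> (UNIV :: (real^'n) set)"
      by eventually_elim (use * in \<open>auto simp: one_ereal_def\<close>)
    then have "(UNIV :: (real^'n) set) \<in> null_sets lebesgue"
      by (subst AE_iff_null_sets) auto
    then show False
      by (simp add: null_sets_def)
  qed
qed

text \<open>The operator agrees almost everywhere with the identity, so no quotient exceeds 1. An
  upper bound is all that optimality asks for.\<close>

lemma (in banach_function_space) mult_norm_integral_le_1:
  "mult_norm \<rho> (\<lambda>\<phi>. LINT x|lebesgue. \<phi> x) \<le> 1"
  unfolding mult_norm_def
proof (rule SUP_least)
  let ?T = "\<lambda>\<phi>. LINT x|lebesgue. \<phi> (x::real^'n) :: complex"
  fix u
  assume "u \<in> {u. u \<in> schwartz \<and> in_X \<rho> u \<and> u \<noteq> (\<lambda>x. 0)}"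
  then have u: "u \<in> schwartz" "in_X \<rho> u"
    by auto
  note rep = represents_identity_multiplier [OF u(1)]
  then have op: "represents (dist_ifourier (dist_mult ?T (fourier u))) (multiplier_op ?T u)"
    unfolding multiplier_op_def by (rule someI [where P = "represents (dist_ifourier (dist_mult ?T (fourier u)))"])
  have "Xnorm \<rho> (multiplier_op ?T u) = Xnorm \<rho> u"
    unfolding Xnorm_def
  proof (rule norm_cong_AE)
    show "AE x in lebesgue. ennreal (norm (multiplier_op ?T u x)) = ennreal (norm (u x))"
      using represents_unique [OF op rep] by (rule AE_mp) auto
  qed (use op rep in \<open>auto simp: represents_def\<close>)
  moreover have "Xnorm \<rho> u < \<infinity>"
    using u(2) by (simp add: in_X_def)
  \<comment> \<open>In \<open>ennreal\<close> the quotient 0 / 0 is 0, so the degenerate case obeys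
    the bound as well.\<close>
  ultimately show "Xnorm \<rho> (multiplier_op ?T u) / Xnorm \<rho> u \<le> 1"
    by (cases "Xnorm \<rho> u = 0") (auto simp: ennreal_divide_self)
qed

theorem theorem1p3:
  fixes \<rho> :: "(real^'n::finite \<Rightarrow> ennreal) \<Rightarrow> ennreal"
  assumes "banach_function_norm \<rho>"
    and "weak_doubling \<rho>"
  shows "(\<forall>a. is_multiplier \<rho> a \<longrightarrow>
            in_Linf a \<and> Linf_norm a \<le> enn2ereal (mult_norm \<rho> a)) \<and>
         (\<forall>c::real. c < 1 \<longrightarrow>
            (\<exists>a. is_multiplier \<rho> a \<and> \<not> (Linf_norm a \<le> ereal c * enn2ereal (mult_norm \<rho> a))))"
proof (intro conjI allI impI)
  interpret banach_function_space \<rho>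
    by standard (rule assms(1))
  fix a
  assume "is_multiplier \<rho> a"
  from multiplier_in_Linf [OF assms(2) this]
  show "in_Linf a" "Linf_norm a \<le> enn2ereal (mult_norm \<rho> a)"
    by blast+
next
  interpret banach_function_space \<rho>
    by standard (rule assms(1))
  fix c :: real
  assume c: "c < 1"
  let ?T = "\<lambda>\<phi>. LINT x|lebesgue. \<phi> (x::real^'n) :: complex"
  obtain m where m: "0 \<le> m" "m \<le> 1" "mult_norm \<rho> ?T = ennreal m"
    using mult_norm_integral_le_1
    by (cases "mult_norm \<rho> ?T") (auto simp: ennreal_le_1 top_unique)
  \<comment> \<open>Of \<open>m\<close> only bounds are known, namely 0 and 1, so negative
    \<open>c\<close> is treated apart: there the product is at most 0.\<close>
  have "c * m < 1"
  proof (cases "0 \<le> c")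
    case True
    then have "c * m \<le> c * 1"
      using m by (intro mult_left_mono)
    with c show ?thesis
      by simp
  next
    case False
    then have "c * m \<le> 0"
      using m by (intro mult_nonpos_nonneg) auto
    then show ?thesis
      by simp
  qed
  then have "ereal c * enn2ereal (mult_norm \<rho> ?T) < 1"
    using m by (simp add: enn2ereal_ennreal)
  with Linf_norm_integral_ge_1 have "\<not> Linf_norm ?T \<le> ereal c * enn2ereal (mult_norm \<rho> ?T)"
    by (meson leD le_less_trans not_le order_trans)
  moreover have "is_multiplier \<rho> ?T"
    using m tempered_integral by (simp add: is_multiplier_def)
  ultimately show "\<exists>a. is_multiplier \<rho> a \<and> \<not> (Linf_norm a \<le> ereal c * enn2ereal (mult_norm \<rho> a))"
    by blast
qed

end
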